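(* Let $\Lambda$ and $\Omega$ be two Young diagrams with $|\Lambda|=|\Omega|=n$, and let $\lambda$, $\omega$ be the Young diagrams obtained from $\Lambda$, $\Omega$ respectively by deleting the first row. Suppose $|\lambda|\le\frac{n+1}{2}$, $|\omega|\le\frac{n+1}{2}$ and $|\lambda|+|\omega|\le n/2$. Then: (a) For any Young diagram $\Sigma$ with $|\Sigma|=n$ whose first row is strictly shorter than $n-|\lambda|-|\omega|$, the Kronecker coefficient $k^{\Sigma}_{\Lambda,\Omega}$ is zero. (b) For any Young diagram $\Sigma$ with $|\Sigma|=n$ whose first row has length equal to $n-|\lambda|-|\omega|$, the Kronecker coefficient $k^{\Sigma}_{\Lambda,\Omega}$ is equal to the Littlewood-Richardson coefficient $c^{\sigma}_{\lambda,\omega}$, where $\sigma$ is obtained from $\Sigma$ by deleting its first row.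
   Context: The same letter denotes a Young diagram and the corresponding irreducible complex representation of the symmetric group. The Kronecker coefficient is the multiplicity $k^{\Sigma}_{\Lambda,\Omega}=[\Sigma:\Lambda\otimes\Omega]$ of $\Sigma$ in the $S_n$-representation $\Lambda\otimes\Omega$. When $|\sigma|=|\lambda|+|\omega|$, the Littlewood-Richardson coefficient is the multiplicity $c^{\sigma}_{\lambda,\omega}=[\sigma:\mathrm{Ind}_{S_{|\lambda|}\times S_{|\omega|}}^{S_{|\sigma|}}\lambda\boxtimes\omega]$. *)

theory Defs
  imports Complex_Main "HOL-Library.Function_Algebras" "HOL-Library.FuncSet"
    "HOL-Algebra.Sym_Groups"
begin

section \<open>Complex representations of a group\<close>

text \<open>
  Vector spaces are subspaces of the space \<open>'x \<Rightarrow> complex\<close> of all complex functions on a type,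
  with pointwise addition (\<open>Function_Algebras\<close>) and pointwise scaling.  Every finite-dimensional
  complex vector space has this form up to isomorphism.
\<close>

definition cscale :: "complex \<Rightarrow> ('x \<Rightarrow> complex) \<Rightarrow> 'x \<Rightarrow> complex"
  where "cscale c f = (\<lambda>x. c * f x)"

global_interpretation cfun: vector_space cscale
  by unfold_locales (auto simp: cscale_def fun_eq_iff algebra_simps)

definition linear_on :: "('x \<Rightarrow> complex) set \<Rightarrow> (('x \<Rightarrow> complex) \<Rightarrow> 'y \<Rightarrow> complex) \<Rightarrow> bool"
  where "linear_on V T \<longleftrightarrow>
    (\<forall>v\<in>V. \<forall>w\<in>V. T (v + w) = T v + T w) \<and> (\<forall>c. \<forall>v\<in>V. T (cscale c v) = cscale c (T v))"

text \<open>The action is only meaningful on \<open>rep_space\<close>; its values elsewhere are irrelevant.\<close>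

record ('g, 'x) rep =
  rep_space :: "('x \<Rightarrow> complex) set"
  rep_act :: "'g \<Rightarrow> ('x \<Rightarrow> complex) \<Rightarrow> 'x \<Rightarrow> complex"

definition is_rep :: "('g, 'm) monoid_scheme \<Rightarrow> ('g, 'x) rep \<Rightarrow> bool"
  where "is_rep G R \<longleftrightarrow>
    cfun.subspace (rep_space R) \<and>
    (\<forall>g\<in>carrier G. rep_act R g ` rep_space R \<subseteq> rep_space R \<and> linear_on (rep_space R) (rep_act R g)) \<and>
    (\<forall>v\<in>rep_space R. rep_act R \<one>\<^bsub>G\<^esub> v = v) \<and>
    (\<forall>g\<in>carrier G. \<forall>h\<in>carrier G. \<forall>v\<in>rep_space R.
       rep_act R (g \<otimes>\<^bsub>G\<^esub> h) v = rep_act R g (rep_act R h v))"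

definition subrep :: "('g, 'x) rep \<Rightarrow> ('x \<Rightarrow> complex) set \<Rightarrow> ('g, 'x) rep"
  where "subrep R U = R\<lparr>rep_space := U\<rparr>"

definition irreducible_rep :: "('g, 'm) monoid_scheme \<Rightarrow> ('g, 'x) rep \<Rightarrow> bool"
  where "irreducible_rep G R \<longleftrightarrow>
    is_rep G R \<and> rep_space R \<noteq> {0} \<and>
    (\<forall>U. U \<subseteq> rep_space R \<and> is_rep G (subrep R U) \<longrightarrow> U = {0} \<or> U = rep_space R)"

definition rep_iso :: "('g, 'm) monoid_scheme \<Rightarrow> ('g, 'x) rep \<Rightarrow> ('g, 'y) rep \<Rightarrow> bool"
  where "rep_iso G R S \<longleftrightarrow>
    (\<exists>T. linear_on (rep_space R) T \<and> bij_betw T (rep_space R) (rep_space S) \<and>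
      (\<forall>g\<in>carrier G. \<forall>v\<in>rep_space R. T (rep_act R g v) = rep_act S g (T v)))"

text \<open>\<open>rep_space W\<close> is the internal direct sum of the irreducible subrepresentations
  \<open>U 0, \<dots>, U (k - 1)\<close>.\<close>

definition irreducible_decomposition ::
  "('g, 'm) monoid_scheme \<Rightarrow> ('g, 'x) rep \<Rightarrow> nat \<Rightarrow> (nat \<Rightarrow> ('x \<Rightarrow> complex) set) \<Rightarrow> bool"
  where "irreducible_decomposition G W k U \<longleftrightarrow>
    (\<forall>i<k. irreducible_rep G (subrep W (U i))) \<and>
    bij_betw (\<lambda>u. \<Sum>i<k. u i) (\<Pi>\<^sub>E i\<in>{..<k}. U i) (rep_space W)"

text \<open>
  The multiplicity \<open>[V : W]\<close> of an irreducible \<open>V\<close> in \<open>W\<close>: the number of summands isomorphic to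
  \<open>V\<close> in a decomposition of \<open>W\<close> into irreducibles.  For a finite group and finite-dimensional \<open>W\<close>
  such a decomposition exists and the number does not depend on it.
\<close>

definition multiplicity_rep ::
  "('g, 'm) monoid_scheme \<Rightarrow> ('g, 'y) rep \<Rightarrow> ('g, 'x) rep \<Rightarrow> nat"
  where "multiplicity_rep G V W =
    (THE m. \<exists>k U. irreducible_decomposition G W k U \<and>
       m = card {i. i < k \<and> rep_iso G V (subrep W (U i))})"


section \<open>Tensor products and induction\<close>

text \<open>
  \<open>V \<otimes> W\<close> is realised inside the functions on \<open>'x \<times> 'y\<close>.  For \<open>F\<close> in \<open>V \<otimes> W\<close> all slices
  \<open>F (x, _)\<close> lie in \<open>W\<close> and all slices \<open>F (_, y)\<close> lie in \<open>V\<close>, so \<open>A \<otimes> B\<close> can be computed by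
  applying \<open>B\<close> and then \<open>A\<close> slicewise.
\<close>

definition pure_tensor :: "('x \<Rightarrow> complex) \<Rightarrow> ('y \<Rightarrow> complex) \<Rightarrow> 'x \<times> 'y \<Rightarrow> complex"
  where "pure_tensor v w = (\<lambda>(x, y). v x * w y)"

definition tensor_space ::
  "('x \<Rightarrow> complex) set \<Rightarrow> ('y \<Rightarrow> complex) set \<Rightarrow> ('x \<times> 'y \<Rightarrow> complex) set"
  where "tensor_space V W = cfun.span {pure_tensor v w | v w. v \<in> V \<and> w \<in> W}"

definition tensor_map ::
  "(('x \<Rightarrow> complex) \<Rightarrow> 'x \<Rightarrow> complex) \<Rightarrow> (('y \<Rightarrow> complex) \<Rightarrow> 'y \<Rightarrow> complex) \<Rightarrow>
   ('x \<times> 'y \<Rightarrow> complex) \<Rightarrow> 'x \<times> 'y \<Rightarrow> complex"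
  where "tensor_map A B F = (\<lambda>(x, y). A (\<lambda>x'. B (\<lambda>y'. F (x', y')) y) x)"

lemma tensor_map_pure:
  assumes "linear_on V A" "linear_on W B" "v \<in> V" "w \<in> W"
  shows "tensor_map A B (pure_tensor v w) = pure_tensor (A v) (B w)"
proof -
  have 1: "B (\<lambda>y'. v x' * w y') = cscale (v x') (B w)" for x'
    using assms unfolding linear_on_def cscale_def by metis
  have 2: "A (\<lambda>x'. v x' * B w y) = cscale (B w y) (A v)" for y
  proof -
    have "(\<lambda>x'. v x' * B w y) = cscale (B w y) v" by (auto simp: cscale_def mult.commute)
    then show ?thesis using assms unfolding linear_on_def by metis
  qed
  show ?thesis
    by (auto simp: tensor_map_def pure_tensor_def fun_eq_iff 1 cscale_def mult.commute
        2[unfolded cscale_def])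
qed

lemma tensor_space_slices:
  assumes "cfun.subspace V" "cfun.subspace W" "F \<in> tensor_space V W"
  shows "(\<forall>x. (\<lambda>y. F (x, y)) \<in> W) \<and> (\<forall>y. (\<lambda>x. F (x, y)) \<in> V)"
  using assms(3) unfolding tensor_space_def
proof (induction rule: cfun.span_induct_alt)
  case base
  show ?case using assms(1,2) by (auto dest: cfun.subspace_0 simp: zero_fun_def)
next
  case (step c p G)
  then obtain v w where p: "p = pure_tensor v w" "v \<in> V" "w \<in> W" by auto
  have "(\<lambda>y. (cscale c p + G) (x, y)) = cscale (c * v x) w + (\<lambda>y. G (x, y))"
    "(\<lambda>x. (cscale c p + G) (x, y)) = cscale (c * w y) v + (\<lambda>x. G (x, y))" for x y
    by (auto simp: p cscale_def pure_tensor_def)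
  then show ?case using assms(1,2) step p
    by (auto intro: cfun.subspace_add cfun.subspace_scale)
qed

text \<open>The inner tensor product \<open>V \<otimes> W\<close> of two representations of the same group, and the outer
  one \<open>V \<boxtimes> W\<close>, which is a representation of \<open>G \<times>\<times> H\<close>.\<close>

definition tensor_rep :: "('g, 'x) rep \<Rightarrow> ('g, 'y) rep \<Rightarrow> ('g, 'x \<times> 'y) rep"
  where "tensor_rep V W =
    \<lparr>rep_space = tensor_space (rep_space V) (rep_space W),
     rep_act = (\<lambda>g. tensor_map (rep_act V g) (rep_act W g))\<rparr>"

definition outer_tensor_rep :: "('g, 'x) rep \<Rightarrow> ('h, 'y) rep \<Rightarrow> ('g \<times> 'h, 'x \<times> 'y) rep"
  where "outer_tensor_rep V W =
    \<lparr>rep_space = tensor_space (rep_space V) (rep_space W),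
     rep_act = (\<lambda>(g, h). tensor_map (rep_act V g) (rep_act W h))\<rparr>"

text \<open>
  Induction along an embedding \<open>\<iota>\<close> of the finite group \<open>H\<close> into the finite group \<open>G\<close>: functions
  \<open>f : G \<rightarrow> V\<close> with \<open>f (g \<iota>(h)) = h\<^sup>-\<^sup>1 f(g)\<close>, acted on by \<open>(a f)(g) = f (a\<^sup>-\<^sup>1 g)\<close>.  Such an \<open>f\<close> is
  stored as the uncurried function on \<open>'g \<times> 'x\<close> which is zero outside the carrier of \<open>G\<close>.
\<close>

definition induced_rep ::
  "('g, 'm) monoid_scheme \<Rightarrow> ('h, 'n) monoid_scheme \<Rightarrow> ('h \<Rightarrow> 'g) \<Rightarrow> ('h, 'x) rep \<Rightarrow> ('g, 'g \<times> 'x) rep"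
  where "induced_rep G H \<iota> R =
    \<lparr>rep_space = {F.
       (\<forall>g. g \<notin> carrier G \<longrightarrow> (\<forall>x. F (g, x) = 0)) \<and>
       (\<forall>g\<in>carrier G. (\<lambda>x. F (g, x)) \<in> rep_space R) \<and>
       (\<forall>g\<in>carrier G. \<forall>h\<in>carrier H.
          (\<lambda>x. F (g \<otimes>\<^bsub>G\<^esub> \<iota> h, x)) = rep_act R (inv\<^bsub>H\<^esub> h) (\<lambda>x. F (g, x)))},
     rep_act = (\<lambda>a F (g, x). if g \<in> carrier G then F (inv\<^bsub>G\<^esub> a \<otimes>\<^bsub>G\<^esub> g, x) else 0)\<rparr>"


section \<open>Young diagrams and Specht modules\<close>

text \<open>A Young diagram is the weakly decreasing list of its (positive) row lengths; its size is
  \<open>sum_list\<close>, and deleting the first row is \<open>tl\<close>.\<close>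

definition young_diagram :: "nat list \<Rightarrow> bool"
  where "young_diagram d \<longleftrightarrow> sorted_wrt (\<ge>) d \<and> 0 \<notin> set d"

definition first_row :: "nat list \<Rightarrow> nat"
  where "first_row d = (case d of [] \<Rightarrow> 0 | r # _ \<Rightarrow> r)"

definition cells :: "nat list \<Rightarrow> (nat \<times> nat) set"
  where "cells d = {(i, j). i < length d \<and> j < d ! i}"

definition tableau :: "nat list \<Rightarrow> (nat \<times> nat \<Rightarrow> nat) \<Rightarrow> bool"
  where "tableau d t \<longleftrightarrow> bij_betw t (cells d) {1..sum_list d}"

text \<open>The tabloid of a tableau is the list of the sets of entries of its rows.\<close>

definition tabloid :: "nat list \<Rightarrow> (nat \<times> nat \<Rightarrow> nat) \<Rightarrow> nat set list"
  where "tabloid d t = map (\<lambda>i. {t (i, j) | j. j < d ! i}) [0..<length d]"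

definition column_entries :: "nat list \<Rightarrow> (nat \<times> nat \<Rightarrow> nat) \<Rightarrow> nat \<Rightarrow> nat set"
  where "column_entries d t j = {t (i, j) | i. (i, j) \<in> cells d}"

definition column_stabilizer :: "nat list \<Rightarrow> (nat \<times> nat \<Rightarrow> nat) \<Rightarrow> (nat \<Rightarrow> nat) set"
  where "column_stabilizer d t =
    {q \<in> carrier (sym_group (sum_list d)). \<forall>j. q ` column_entries d t j = column_entries d t j}"

definition polytabloid :: "nat list \<Rightarrow> (nat \<times> nat \<Rightarrow> nat) \<Rightarrow> nat set list \<Rightarrow> complex"
  where "polytabloid d t = (\<lambda>T. \<Sum>q\<in>column_stabilizer d t.
    of_int (sign q) * (if T = tabloid d (q \<circ> t) then 1 else 0))"

text \<open>
  The irreducible representation of \<open>sym_group (sum_list d)\<close> corresponding to \<open>d\<close> is the Specht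
  module, the span of the polytabloids; the one-row diagram gives the trivial representation.
  Since \<open>p -` X = p\<^sup>-\<^sup>1(X)\<close>, the action is the linear extension of \<open>T \<mapsto> p T\<close> on tabloids.
\<close>

definition specht :: "nat list \<Rightarrow> (nat \<Rightarrow> nat, nat set list) rep"
  where "specht d =
    \<lparr>rep_space = cfun.span {polytabloid d t | t. tableau d t},
     rep_act = (\<lambda>p v T. v (map (vimage p) T))\<rparr>"


section \<open>Kronecker and Littlewood-Richardson coefficients\<close>

text \<open>The embedding of \<open>S\<^sub>a \<times> S\<^sub>b\<close> into \<open>S\<^sub>a\<^sub>+\<^sub>b\<close>, the second factor acting on \<open>{a + 1..a + b}\<close>.\<close>

definition young_embedding :: "nat \<Rightarrow> (nat \<Rightarrow> nat) \<times> (nat \<Rightarrow> nat) \<Rightarrow> nat \<Rightarrow> nat"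
  where "young_embedding a = (\<lambda>(p, q) i. if i \<le> a then p i else q (i - a) + a)"

definition kronecker_coeff :: "nat list \<Rightarrow> nat list \<Rightarrow> nat list \<Rightarrow> nat"
  where "kronecker_coeff L M S =
    multiplicity_rep (sym_group (sum_list S)) (specht S) (tensor_rep (specht L) (specht M))"

text \<open>Meaningful only for \<open>sum_list s = sum_list l + sum_list m\<close>.\<close>

definition lr_coeff :: "nat list \<Rightarrow> nat list \<Rightarrow> nat list \<Rightarrow> nat"
  where "lr_coeff l m s =
    multiplicity_rep (sym_group (sum_list s)) (specht s)
      (induced_rep (sym_group (sum_list s))
        (sym_group (sum_list l) \<times>\<times> sym_group (sum_list m))
        (young_embedding (sum_list l))
        (outer_tensor_rep (specht l) (specht m)))"

end

theory Submission
  imports Defs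
begin

text \<open>Every representation below consists of functions on a finite set permuted by the group.  For such
  a \<open>V\<close>, closed under complex conjugation and with a line of invariants in \<open>V \<otimes> V\<close>, the multiplicity
  of \<open>V\<close> in \<open>W\<close> is the dimension of the space of invariants of \<open>V \<otimes> W\<close>
  (\<open>multiplicity_eq_dim_fixed\<close>).  So the Kronecker coefficient is the dimension of the space of
  \<open>S\<^sub>n\<close>-invariant functions \<open>F (T, U, U')\<close> of three tabloids that lie in the respective Specht
  modules, and by Frobenius reciprocity the Littlewood-Richardson coefficient is the dimension of the
  space of \<open>S\<^sub>a \<times> S\<^sub>b\<close>-invariant functions \<open>f (T, U, U')\<close> of tabloids with the first rows removed.

  The lower entries of a tabloid of shape \<open>r # d\<close> are those outside its first row.  A function on
  such tabloids is harmonic if, for each tabloid and each lower entry \<open>i\<close>, its values sum to zero over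
  the tabloid itself and all tabloids in which \<open>i\<close> is exchanged with an entry of the first row.
  Polytabloids are harmonic, and with the set of lower entries fixed they restrict to elements of the
  Specht module of \<open>d\<close>.  Let \<open>H\<close> be the space of all functions with these two properties.

  The key principle (\<open>harmonic_eq_zero\<close>) is that a harmonic function which does not change when two
  numbers outside a set \<open>B\<close> are exchanged is determined by its values at tabloids whose lower entries
  all lie in \<open>B\<close>.  It is used twice.

  First, an invariant \<open>F (S, T)\<close> in \<open>H \<otimes> H\<close> is determined by its values where \<open>S\<close> and \<open>T\<close> have the same
  lower entries, hence by an invariant in the tensor square of the Specht module of \<open>d\<close>.  By induction
  on the number of rows these invariants form a line.  So \<open>H\<close> is irreducible and equals the Specht
  module (\<open>specht_absolutely_simple\<close>).

  Second, an invariant \<open>F (T, U, U')\<close> is determined by its values where the lower entries of \<open>T\<close> are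
  lower entries of \<open>U\<close> or of \<open>U'\<close>.  If \<open>T\<close> has more lower entries than \<open>U\<close> and \<open>U'\<close> together there are
  no such triples, which is (a).  If the numbers agree, the lower entries of \<open>T\<close> are the disjoint union
  of those of \<open>U\<close> and \<open>U'\<close>, and \<open>S\<^sub>n\<close> moves every such triple into one standard position.  Restriction
  to that position embeds the first space of invariants into the second
  (\<open>restriction_in_lr_space\<close>, \<open>restriction_inj\<close>).

  That the embedding is onto is where \<open>|\<lambda>| + |\<omega>| \<le> n / 2\<close> enters: each of the \<open>k = |\<lambda>| + |\<omega>|\<close> lower
  entries then has its own partner in the first row.  A function \<open>u\<close> on one slice extends to the
  alternating sum of its translates under all exchanges of lower entries with their partners, and this
  sum is harmonic (\<open>alternating_lift_in_specht\<close>).  Extend \<open>u\<close>, \<open>v\<close>, \<open>w\<close> in this way, average their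
  product over \<open>S\<^sub>n\<close>, and pair the restriction with some \<open>f\<close> in the target: each summand contributes
  either nothing or the pairing of \<open>u \<otimes> v \<otimes> w\<close> with \<open>f\<close> (\<open>swapped_pairing\<close>).  An \<open>f\<close> orthogonal to
  all restrictions is therefore zero.\<close>

section \<open>Hermitian geometry of functions on a finite set\<close>

definition inner_on :: "'x set \<Rightarrow> ('x \<Rightarrow> complex) \<Rightarrow> ('x \<Rightarrow> complex) \<Rightarrow> complex"
  where "inner_on P f h = (\<Sum>x\<in>P. f x * cnj (h x))"

definition funs_on :: "'x set \<Rightarrow> ('x \<Rightarrow> complex) set"
  where "funs_on P = {f. \<forall>x. x \<notin> P \<longrightarrow> f x = 0}"

lemma sum_fun_apply: "(\<Sum>i\<in>I. f i) x = (\<Sum>i\<in>I. f i x)"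
  for f :: "'i \<Rightarrow> 'x \<Rightarrow> complex"
  by (induction I rule: infinite_finite_induct) (auto simp: plus_fun_apply zero_fun_apply)

lemma cscale_apply: "cscale c f x = c * f x"
  by (simp add: cscale_def)

text \<open>As default rewrite rules these would turn sums and zeros of functions, which are vectors here, into
  abstractions.\<close>

declare plus_fun_apply [simp del] zero_fun_apply [simp del] minus_apply [simp del]
  uminus_apply [simp del]

lemmas fun_app = plus_fun_apply zero_fun_apply minus_apply uminus_apply cscale_apply sum_fun_apply

lemma inner_on_add_left: "inner_on P (f + f') h = inner_on P f h + inner_on P f' h"
  by (simp add: inner_on_def fun_app algebra_simps sum.distrib)

lemma inner_on_diff_left: "inner_on P (f - f') h = inner_on P f h - inner_on P f' h"
  by (simp add: inner_on_def fun_app algebra_simps sum_subtractf)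

lemma inner_on_add_right: "inner_on P f (h + h') = inner_on P f h + inner_on P f h'"
  by (simp add: inner_on_def fun_app algebra_simps sum.distrib)

lemma inner_on_scale_left: "inner_on P (cscale c f) h = c * inner_on P f h"
  by (simp add: inner_on_def fun_app algebra_simps sum_distrib_left)

lemma inner_on_scale_right: "inner_on P f (cscale c h) = cnj c * inner_on P f h"
  by (simp add: inner_on_def fun_app algebra_simps sum_distrib_left)

lemma inner_on_zero [simp]: "inner_on P 0 h = 0" "inner_on P f 0 = 0"
  by (simp_all add: inner_on_def fun_app)

lemma inner_on_sum_left: "inner_on P (\<Sum>i\<in>I. f i) h = (\<Sum>i\<in>I. inner_on P (f i) h)"
  by (induction I rule: infinite_finite_induct) (auto simp: inner_on_add_left)

lemma inner_on_commute: "inner_on P h f = cnj (inner_on P f h)"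
  by (simp add: inner_on_def mult.commute)

lemma inner_on_self: "inner_on P f f = of_real (\<Sum>x\<in>P. (cmod (f x))\<^sup>2)"
  by (simp add: inner_on_def complex_norm_square flip: of_real_power)

lemma inner_on_self_eq_0:
  assumes "finite P" "f \<in> funs_on P" "inner_on P f f = 0"
  shows "f = 0"
proof -
  have "(\<Sum>x\<in>P. (cmod (f x))\<^sup>2) = 0"
    using assms(3) unfolding inner_on_self by (simp only: of_real_eq_0_iff)
  then have "\<forall>x\<in>P. f x = 0" using assms(1) by (simp add: sum_nonneg_eq_0_iff)
  then show ?thesis using assms(2) by (auto simp: funs_on_def fun_eq_iff fun_app)
qed

lemma inner_on_span_right:
  assumes "\<And>b. b \<in> B \<Longrightarrow> inner_on P f b = 0" "u \<in> cfun.span B"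
  shows "inner_on P f u = 0"
  using assms(2)
  by (induction rule: cfun.span_induct_alt) (auto simp: inner_on_add_right inner_on_scale_right assms(1))

lemma subspace_funs_on: "cfun.subspace (funs_on P)"
  by (rule cfun.subspaceI) (auto simp: funs_on_def fun_app)

text \<open>Gram-Schmidt, one spanning vector at a time.\<close>

lemma orthogonal_projection_span:
  assumes "finite P" "finite B" "B \<subseteq> funs_on P"
  shows "\<exists>p\<in>cfun.span B. \<forall>u\<in>cfun.span B. inner_on P (f - p) u = 0"
  using assms(2,3)
proof (induction B arbitrary: f rule: finite_induct)
  case empty
  then show ?case by simp
next
  case (insert b B)
  from insert obtain q where q: "q \<in> cfun.span B" "\<And>u. u \<in> cfun.span B \<Longrightarrow> inner_on P (b - q) u = 0"
    by (metis insert_subset)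
  from insert obtain p where p: "p \<in> cfun.span B" "\<And>u. u \<in> cfun.span B \<Longrightarrow> inner_on P (f - p) u = 0"
    by (metis insert_subset)
  define b' where "b' = b - q"
  define c where "c = (if b' = 0 then 0 else inner_on P (f - p) b' / inner_on P b' b')"
  define r where "r = p + cscale c b'"
  have sub: "cfun.span B \<subseteq> cfun.span (insert b B)" by (rule cfun.span_mono) auto
  have b'sp: "b' \<in> cfun.span (insert b B)"
    unfolding b'_def using q(1) sub by (intro cfun.span_diff) (auto intro: cfun.span_base)
  have rsp: "r \<in> cfun.span (insert b B)"
    unfolding r_def using b'sp p(1) sub by (intro cfun.span_add cfun.span_scale) auto
  have "cfun.span B \<subseteq> funs_on P"
    using insert.prems by (intro cfun.span_minimal subspace_funs_on) auto
  then have b'P: "b' \<in> funs_on P" unfolding b'_def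
    using q(1) insert.prems by (intro cfun.subspace_diff[OF subspace_funs_on]) auto
  have o1: "inner_on P (f - r) u = 0" if "u \<in> cfun.span B" for u
  proof -
    have "inner_on P (f - r) u = inner_on P (f - p) u - c * inner_on P b' u"
      unfolding r_def by (simp add: inner_on_diff_left inner_on_add_left inner_on_scale_left)
    then show ?thesis using p(2) q(2) that by (simp add: b'_def)
  qed
  have o2: "inner_on P (f - r) b' = 0"
  proof -
    have e: "inner_on P (f - r) b' = inner_on P (f - p) b' - c * inner_on P b' b'"
      unfolding r_def by (simp add: inner_on_diff_left inner_on_add_left inner_on_scale_left)
    show ?thesis
    proof (cases "b' = 0")
      case False
      then have "inner_on P b' b' \<noteq> 0" using inner_on_self_eq_0[OF assms(1) b'P] by blast
      then show ?thesis using False e by (simp add: c_def)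
    qed simp
  qed
  have "inner_on P (f - r) u = 0" if "u \<in> cfun.span (insert b B)" for u
    using that
  proof (rule inner_on_span_right[rotated])
    fix x assume "x \<in> insert b B"
    moreover have "inner_on P (f - r) b = 0"
    proof -
      have "b = b' + q" by (simp add: b'_def)
      then have "inner_on P (f - r) b = inner_on P (f - r) b' + inner_on P (f - r) q"
        by (simp only: inner_on_add_right)
      then show ?thesis using o2 o1[OF q(1)] by simp
    qed
    ultimately show "inner_on P (f - r) x = 0" using o1 by (auto intro: cfun.span_base)
  qed
  then show ?case using rsp by blast
qed

lemma funs_on_spanned:
  assumes "finite P"
  shows "funs_on P \<subseteq> cfun.span ((\<lambda>x y. if y = x then 1 else 0) ` P)"
proof
  fix f assume f: "f \<in> funs_on P"
  have "f = (\<Sum>x\<in>P. cscale (f x) (\<lambda>y. if y = x then 1 else 0))"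
    using f assms by (auto simp: fun_eq_iff fun_app funs_on_def if_distrib cong: if_cong)
  also have "\<dots> \<in> cfun.span ((\<lambda>x y. if y = x then 1 else 0) ` P)"
    by (intro cfun.span_sum cfun.span_scale cfun.span_base) auto
  finally show "f \<in> cfun.span ((\<lambda>x y. if y = x then 1 else 0) ` P)" .
qed

lemma finite_basis:
  assumes "finite P" "cfun.subspace W" "W \<subseteq> funs_on P"
  obtains B where "finite B" "cfun.independent B" "B \<subseteq> W" "cfun.span B = W"
    "card B = cfun.dim W"
proof -
  obtain B where B: "B \<subseteq> W" "cfun.independent B" "W \<subseteq> cfun.span B" "card B = cfun.dim W"
    using cfun.basis_exists by blast
  have "B \<subseteq> cfun.span ((\<lambda>x y. if y = x then 1 else 0) ` P)"
    using B(1) assms(3) funs_on_spanned[OF assms(1)] by blast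
  then have "finite B" using cfun.independent_span_bound[OF _ B(2)] assms(1) by blast
  moreover have "cfun.span B = W" using B assms(2) cfun.span_minimal by blast
  ultimately show ?thesis using that B by blast
qed

lemma orthogonal_projection:
  assumes "finite P" "cfun.subspace W" "W \<subseteq> funs_on P"
  obtains p where "p \<in> W" "\<And>u. u \<in> W \<Longrightarrow> inner_on P (f - p) u = 0"
proof -
  obtain B where B: "finite B" "B \<subseteq> W" "cfun.span B = W"
    using finite_basis[OF assms] by metis
  then have "\<exists>p\<in>W. \<forall>u\<in>W. inner_on P (f - p) u = 0"
    using orthogonal_projection_span[OF assms(1), of B f] assms(3) by auto
  then show ?thesis using that by blast
qed

lemma orthogonal_vector:
  assumes "finite P" "cfun.subspace V" "V \<subseteq> funs_on P" "cfun.subspace W" "W \<subset> V"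
  obtains v where "v \<in> V" "v \<noteq> 0" "\<And>u. u \<in> W \<Longrightarrow> inner_on P v u = 0"
proof -
  obtain x where x: "x \<in> V" "x \<notin> W" using assms(5) by blast
  obtain p where p: "p \<in> W" "\<And>u. u \<in> W \<Longrightarrow> inner_on P (x - p) u = 0"
    using orthogonal_projection[OF assms(1,4), of x] assms(3,5) by blast
  have "x - p \<in> V" using x p assms(2,5) by (auto intro: cfun.subspace_diff)
  moreover have "x - p \<noteq> 0" using x p by auto
  ultimately show ?thesis using that p(2) by blast
qed

lemma dim_less_of_proper_subspace:
  assumes "finite P" "cfun.subspace V" "V \<subseteq> funs_on P" "cfun.subspace W" "W \<subset> V"
  shows "cfun.dim W < cfun.dim V"
proof -
  obtain B where B: "finite B" "cfun.independent B" "B \<subseteq> W" "cfun.span B = W" "card B = cfun.dim W"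
    using finite_basis[OF assms(1,4)] assms(3,5) by blast
  obtain C where C: "finite C" "cfun.span C = V" "card C = cfun.dim V"
    using finite_basis[OF assms(1-3)] by blast
  obtain x where x: "x \<in> V" "x \<notin> W" using assms(5) by blast
  have "cfun.independent (insert x B)" using x B by (intro cfun.independent_insertI) auto
  moreover have "insert x B \<subseteq> cfun.span C" using x B C assms(5) by auto
  ultimately have "card (insert x B) \<le> card C" using cfun.independent_span_bound C(1) by blast
  moreover have "x \<notin> B" using x B by blast
  ultimately show ?thesis using B C by simp
qed

lemma linear_comp: "Vector_Spaces.linear cscale cscale (\<lambda>F. F \<circ> J)"
  by (rule Vector_Spaces.linear.intro[OF cfun.vector_space_axioms cfun.vector_space_axioms])
    (unfold_locales; auto simp: fun_eq_iff fun_app)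

lemma dim_comp:
  assumes "cfun.subspace A" "inj_on (\<lambda>F. F \<circ> J) A"
  shows "cfun.dim ((\<lambda>F. F \<circ> J) ` A) = cfun.dim A"
proof -
  interpret l: module_hom cscale cscale "\<lambda>F. F \<circ> J"
    using linear_comp by (simp add: module_hom_iff_linear)
  obtain B where B: "B \<subseteq> A" "cfun.independent B" "A \<subseteq> cfun.span B" "card B = cfun.dim A"
    using cfun.basis_exists by blast
  have sp: "cfun.span B = A" using B assms(1) cfun.span_minimal by blast
  have "cfun.independent ((\<lambda>F. F \<circ> J) ` B)"
    using B(2) assms(2) sp l.independent_injective_image by metis
  moreover have "cfun.span ((\<lambda>F. F \<circ> J) ` B) = cfun.span ((\<lambda>F. F \<circ> J) ` A)"
    by (metis sp l.span_image cfun.span_span)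
  moreover have "card ((\<lambda>F. F \<circ> J) ` B) = card B"
    using assms(2) B(1) by (intro card_image) (auto intro: inj_on_subset)
  ultimately show ?thesis using B(4) by (metis cfun.dim_eq_card)
qed

section \<open>Subrepresentations of permutation representations\<close>

lemma linear_onD:
  assumes "linear_on V T"
  shows "v \<in> V \<Longrightarrow> w \<in> V \<Longrightarrow> T (v + w) = T v + T w" "v \<in> V \<Longrightarrow> T (cscale c v) = cscale c (T v)"
  using assms by (auto simp: linear_on_def)

lemma linear_on_zero:
  assumes "linear_on V T" "cfun.subspace V"
  shows "T 0 = 0"
proof -
  have "T (cscale 0 0) = cscale 0 (T 0)"
    using linear_onD(2)[OF assms(1) cfun.subspace_0[OF assms(2)]] .
  then show ?thesis by simp
qed

lemma linear_on_sum:
  assumes "linear_on V T" "cfun.subspace V" "\<And>i. i \<in> I \<Longrightarrow> f i \<in> V"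
  shows "T (\<Sum>i\<in>I. f i) = (\<Sum>i\<in>I. T (f i))"
  using assms(3)
proof (induction I rule: infinite_finite_induct)
  case (insert i I)
  then have "(\<Sum>i\<in>I. f i) \<in> V" by (intro cfun.subspace_sum[OF assms(2)]) auto
  then show ?case using insert linear_onD(1)[OF assms(1)] by simp
qed (use linear_on_zero[OF assms(1,2)] in auto)

lemma linear_on_subset: "linear_on V T \<Longrightarrow> U \<subseteq> V \<Longrightarrow> linear_on U T"
  unfolding linear_on_def by blast

lemma is_repD:
  assumes "is_rep G R"
  shows "cfun.subspace (rep_space R)"
    "g \<in> carrier G \<Longrightarrow> v \<in> rep_space R \<Longrightarrow> rep_act R g v \<in> rep_space R"
    "g \<in> carrier G \<Longrightarrow> linear_on (rep_space R) (rep_act R g)"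
    "v \<in> rep_space R \<Longrightarrow> rep_act R \<one>\<^bsub>G\<^esub> v = v"
    "g \<in> carrier G \<Longrightarrow> h \<in> carrier G \<Longrightarrow> v \<in> rep_space R \<Longrightarrow>
       rep_act R (g \<otimes>\<^bsub>G\<^esub> h) v = rep_act R g (rep_act R h v)"
  using assms unfolding is_rep_def by blast+

lemma rep_space_subrep [simp]: "rep_space (subrep R U) = U"
  and rep_act_subrep [simp]: "rep_act (subrep R U) = rep_act R"
  and subrep_subrep [simp]: "subrep (subrep R U) U' = subrep R U'"
  by (simp_all add: subrep_def)

lemma subrep_self [simp]: "subrep R (rep_space R) = R"
  by (simp add: subrep_def)

lemma is_rep_subrep_iff:
  assumes "is_rep G R" "U \<subseteq> rep_space R"
  shows "is_rep G (subrep R U) \<longleftrightarrow>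
    cfun.subspace U \<and> (\<forall>g\<in>carrier G. \<forall>u\<in>U. rep_act R g u \<in> U)"
proof -
  have "linear_on U (rep_act R g)" if "g \<in> carrier G" for g
    using is_repD(3)[OF assms(1) that] linear_on_subset assms(2) by blast
  then show ?thesis
    using assms is_repD(4,5)[OF assms(1)]
    unfolding is_rep_def by (auto simp: image_subset_iff subset_eq)
qed

text \<open>A representation on functions supported on \<open>P\<close>, in which \<open>g\<close> acts by composition with the
  permutation \<open>\<beta> g\<close> of \<open>P\<close>.  Composition is contravariant: like taking preimages, \<open>\<beta>\<close> reverses products,
  as far as the functions in the representation space can tell.\<close>

definition perm_rep ::
  "('g, 'm) monoid_scheme \<Rightarrow> ('g, 'x) rep \<Rightarrow> 'x set \<Rightarrow> ('g \<Rightarrow> 'x \<Rightarrow> 'x) \<Rightarrow> bool"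
  where "perm_rep G R P \<beta> \<longleftrightarrow> is_rep G R \<and> finite P \<and> rep_space R \<subseteq> funs_on P \<and>
    (\<forall>g\<in>carrier G. bij_betw (\<beta> g) P P \<and>
      (\<forall>v\<in>rep_space R. \<forall>x\<in>P. rep_act R g v x = v (\<beta> g x)))"

lemma perm_repD:
  assumes "perm_rep G R P \<beta>"
  shows "is_rep G R" "finite P" "rep_space R \<subseteq> funs_on P" "cfun.subspace (rep_space R)"
    "g \<in> carrier G \<Longrightarrow> bij_betw (\<beta> g) P P"
    "g \<in> carrier G \<Longrightarrow> v \<in> rep_space R \<Longrightarrow> x \<in> P \<Longrightarrow> rep_act R g v x = v (\<beta> g x)"
    "v \<in> rep_space R \<Longrightarrow> x \<notin> P \<Longrightarrow> v x = 0"
    "g \<in> carrier G \<Longrightarrow> x \<in> P \<Longrightarrow> \<beta> g x \<in> P"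
  using assms unfolding perm_rep_def is_rep_def funs_on_def
  by (auto dest!: bij_betwE)

lemma perm_rep_subrep:
  assumes "perm_rep G R P \<beta>" "U \<subseteq> rep_space R" "is_rep G (subrep R U)"
  shows "perm_rep G (subrep R U) P \<beta>"
  using assms unfolding perm_rep_def by (auto simp: subset_eq)

lemma inner_on_invariant:
  assumes "perm_rep G R P \<beta>" "g \<in> carrier G" "v \<in> rep_space R" "w \<in> rep_space R"
  shows "inner_on P (rep_act R g v) (rep_act R g w) = inner_on P v w"
proof -
  have "inner_on P (rep_act R g v) (rep_act R g w) = (\<Sum>x\<in>P. v (\<beta> g x) * cnj (w (\<beta> g x)))"
    unfolding inner_on_def using perm_repD(6)[OF assms(1,2)] assms(3,4) by (intro sum.cong) auto
  also have "\<dots> = inner_on P v w"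
    unfolding inner_on_def
    using sum.reindex_bij_betw[OF perm_repD(5)[OF assms(1,2)], of "\<lambda>x. v x * cnj (w x)"] .
  finally show ?thesis .
qed

lemma is_rep_act_inv:
  assumes "group G" "is_rep G R" "g \<in> carrier G" "v \<in> rep_space R"
  shows "rep_act R g (rep_act R (inv\<^bsub>G\<^esub> g) v) = v"
  using is_repD[OF assms(2)] assms(3,4) group.inv_closed[OF assms(1,3)] group.r_inv[OF assms(1,3)]
  by metis

definition orth_compl :: "'x set \<Rightarrow> ('x \<Rightarrow> complex) set \<Rightarrow> ('x \<Rightarrow> complex) set \<Rightarrow> ('x \<Rightarrow> complex) set"
  where "orth_compl P V U = {v\<in>V. \<forall>u\<in>U. inner_on P v u = 0}"

lemma is_rep_orth_compl:
  assumes "group G" "perm_rep G R P \<beta>" "U \<subseteq> rep_space R" "is_rep G (subrep R U)"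
  shows "is_rep G (subrep R (orth_compl P (rep_space R) U))"
proof -
  note R = perm_repD(1)[OF assms(2)]
  have sub: "cfun.subspace (orth_compl P (rep_space R) U)"
    using is_repD(1)[OF R]
    by (auto simp: cfun.subspace_def orth_compl_def inner_on_add_left inner_on_scale_left)
  have "inner_on P (rep_act R g v) u = 0"
    if "g \<in> carrier G" "v \<in> orth_compl P (rep_space R) U" "u \<in> U" for g v u
  proof -
    have i: "inv\<^bsub>G\<^esub> g \<in> carrier G" using group.inv_closed[OF assms(1) that(1)] .
    have u: "rep_act R (inv\<^bsub>G\<^esub> g) u \<in> U"
      using assms(4) that(3) i is_rep_subrep_iff[OF R assms(3)] by blast
    have "inner_on P (rep_act R g v) u = inner_on P (rep_act R g v) (rep_act R g (rep_act R (inv\<^bsub>G\<^esub> g) u))"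
      using is_rep_act_inv[OF assms(1) R that(1)] that(3) assms(3) by (metis subsetD)
    also have "\<dots> = inner_on P v (rep_act R (inv\<^bsub>G\<^esub> g) u)"
      using inner_on_invariant[OF assms(2) that(1)] that(2) u assms(3) by (auto simp: orth_compl_def)
    also have "\<dots> = 0" using that(2) u by (auto simp: orth_compl_def)
    finally show ?thesis .
  qed
  then show ?thesis
    using sub is_repD(2)[OF R] is_rep_subrep_iff[OF R, of "orth_compl P (rep_space R) U"]
    by (auto simp: orth_compl_def)
qed

lemma irreducible_subrep_exists:
  assumes "perm_rep G W P \<beta>" "rep_space W \<noteq> {0}"
  obtains U where "U \<subseteq> rep_space W" "irreducible_rep G (subrep W U)"
proof -
  define S where "S = {U. U \<subseteq> rep_space W \<and> is_rep G (subrep W U) \<and> U \<noteq> {0}}"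
  have "rep_space W \<in> S" using assms perm_repD(1)[OF assms(1)] by (auto simp: S_def)
  then obtain U where U: "U \<in> S" and min: "\<And>U'. U' \<in> S \<Longrightarrow> cfun.dim U \<le> cfun.dim U'"
    using ex_has_least_nat[of "\<lambda>U. U \<in> S" "rep_space W" cfun.dim] by blast
  have fin: "finite P" "U \<subseteq> funs_on P" "cfun.subspace U"
    using perm_repD[OF assms(1)] U is_repD(1)[of G "subrep W U"] by (auto simp: S_def)
  have "U' = {0} \<or> U' = U" if U': "U' \<subseteq> U" "is_rep G (subrep W U')" for U'
  proof (rule ccontr)
    assume *: "\<not> (U' = {0} \<or> U' = U)"
    then have "U' \<in> S" using U U' by (auto simp: S_def)
    moreover have "cfun.dim U' < cfun.dim U"
      using dim_less_of_proper_subspace[OF fin(1,3,2), of U'] U' * is_repD(1)[OF U'(2)] by auto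
    ultimately show False using min by fastforce
  qed
  then have "irreducible_rep G (subrep W U)"
    using U by (auto simp: irreducible_rep_def S_def)
  then show ?thesis using that U by (auto simp: S_def)
qed

text \<open>Maschke's theorem: the Hermitian form is invariant, so the orthogonal complement of an irreducible
  subrepresentation is again a subrepresentation, of smaller dimension.\<close>

lemma irreducible_decomposition_exists:
  assumes G: "group G" and "perm_rep G W P \<beta>"
  shows "\<exists>k U. irreducible_decomposition G W k U"
  using assms(2)
proof (induction "cfun.dim (rep_space W)" arbitrary: W rule: less_induct)
  case less
  note W = less.prems
  show ?case
  proof (cases "rep_space W = {0}")
    case True
    then have "irreducible_decomposition G W 0 (\<lambda>_. {0})"
      by (auto simp: irreducible_decomposition_def bij_betw_def)
    then show ?thesis by blast
  next
    case False
    obtain U where U: "U \<subseteq> rep_space W" "irreducible_rep G (subrep W U)"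
      using irreducible_subrep_exists[OF W False] .
    define C where "C = orth_compl P (rep_space W) U"
    have U_rep: "is_rep G (subrep W U)" using U(2) by (simp add: irreducible_rep_def)
    have U_sub: "cfun.subspace U" using is_repD(1)[OF U_rep] by simp
    have C_rep: "is_rep G (subrep W C)"
      unfolding C_def using is_rep_orth_compl[OF G W U(1) U_rep] .
    have C_sub: "cfun.subspace C" using is_repD(1)[OF C_rep] by simp
    have CW: "C \<subseteq> rep_space W" by (auto simp: C_def orth_compl_def)
    have C_perm: "perm_rep G (subrep W C) P \<beta>" using perm_rep_subrep[OF W CW C_rep] .
    have disj: "v = 0" if "v \<in> U" "v \<in> C" for v
    proof (rule inner_on_self_eq_0)
      show "finite P" "v \<in> funs_on P" using perm_repD(2,3)[OF W] that U by auto
      show "inner_on P v v = 0" using that by (auto simp: C_def orth_compl_def)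
    qed
    obtain u where u: "u \<in> U" "u \<noteq> 0"
      using U(2) cfun.subspace_0[OF U_sub] by (auto simp: irreducible_rep_def)
    then have "C \<subset> rep_space W" using CW disj U(1) by blast
    then have "cfun.dim (rep_space (subrep W C)) < cfun.dim (rep_space W)"
      using dim_less_of_proper_subspace[OF perm_repD(2,4,3)[OF W] C_sub] by simp
    from less.hyps[OF this C_perm] obtain k U' where
      dec: "irreducible_decomposition G (subrep W C) k U'" by blast
    define V where "V = (\<lambda>i. if i < k then U' i else U)"
    have bij: "bij_betw (\<lambda>u. \<Sum>i<k. u i) (\<Pi>\<^sub>E i\<in>{..<k}. U' i) C"
      using dec by (simp add: irreducible_decomposition_def)
    have restr: "restrict u {..<k} \<in> (\<Pi>\<^sub>E i\<in>{..<k}. U' i)" "u k \<in> U"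
        "(\<Sum>i<k. u i) = (\<Sum>i<k. restrict u {..<k} i)" "(\<Sum>i<k. u i) \<in> C"
      if "u \<in> (\<Pi>\<^sub>E i\<in>{..<Suc k}. V i)" for u
    proof -
      have m: "u i \<in> V i" if "i < Suc k" for i
        using PiE_mem[OF \<open>u \<in> Pi\<^sub>E {..<Suc k} V\<close>] that by auto
      have "u i \<in> U' i" if "i < k" for i using m[of i] that by (simp add: V_def)
      moreover have "u k \<in> U" using m[of k] by (simp add: V_def)
      ultimately show 1: "restrict u {..<k} \<in> (\<Pi>\<^sub>E i\<in>{..<k}. U' i)" "u k \<in> U" by auto
      show 2: "(\<Sum>i<k. u i) = (\<Sum>i<k. restrict u {..<k} i)" by simp
      show "(\<Sum>i<k. u i) \<in> C" using bij_betwE[OF bij] 1(1) by (subst 2) blast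
    qed
    have inj: "inj_on (\<lambda>u. \<Sum>i<Suc k. u i) (\<Pi>\<^sub>E i\<in>{..<Suc k}. V i)"
    proof (rule inj_onI)
      fix u w assume u: "u \<in> (\<Pi>\<^sub>E i\<in>{..<Suc k}. V i)" and w: "w \<in> (\<Pi>\<^sub>E i\<in>{..<Suc k}. V i)"
        and eq: "(\<Sum>i<Suc k. u i) = (\<Sum>i<Suc k. w i)"
      have e: "(\<Sum>i<k. u i) - (\<Sum>i<k. w i) = w k - u k"
        using eq by (simp add: algebra_simps)
      have "(\<Sum>i<k. u i) - (\<Sum>i<k. w i) \<in> C"
        using restr(4) u w C_sub by (auto intro: cfun.subspace_diff)
      moreover have "w k - u k \<in> U" using restr(2) u w U_sub by (auto intro: cfun.subspace_diff)
      ultimately have z: "w k - u k = 0" using disj e by metis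
      then have "(\<Sum>i<k. restrict u {..<k} i) = (\<Sum>i<k. restrict w {..<k} i)"
        using e by (simp only: restr(3)[OF u, symmetric] restr(3)[OF w, symmetric]) simp
      then have "restrict u {..<k} = restrict w {..<k}"
        using bij restr(1) u w unfolding bij_betw_def inj_on_def by blast
      then have "u i = w i" if "i < k" for i using that by (metis lessThan_iff restrict_apply')
      then show "u = w"
        using z by (intro PiE_ext[OF u w]) (auto simp: less_Suc_eq)
    qed
    have "(\<lambda>u. \<Sum>i<Suc k. u i) ` (\<Pi>\<^sub>E i\<in>{..<Suc k}. V i) = rep_space W"
    proof (rule subset_antisym; rule subsetI)
      fix v assume "v \<in> (\<lambda>u. \<Sum>i<Suc k. u i) ` (\<Pi>\<^sub>E i\<in>{..<Suc k}. V i)"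
      then obtain u where u: "u \<in> (\<Pi>\<^sub>E i\<in>{..<Suc k}. V i)" "v = (\<Sum>i<k. u i) + u k"
        unfolding sum.lessThan_Suc by blast
      show "v \<in> rep_space W"
        unfolding u(2)
        by (rule cfun.subspace_add[OF perm_repD(4)[OF W] subsetD[OF CW restr(4)[OF u(1)]]
              subsetD[OF U(1) restr(2)[OF u(1)]]])
    next
      fix v assume v: "v \<in> rep_space W"
      obtain p where p: "p \<in> U" "\<And>u. u \<in> U \<Longrightarrow> inner_on P (v - p) u = 0"
        using orthogonal_projection[OF perm_repD(2)[OF W] U_sub, of v] U(1) perm_repD(3)[OF W]
        by blast
      have "v - p \<in> C"
        using p v U(1) perm_repD(4)[OF W] by (auto simp: C_def orth_compl_def intro: cfun.subspace_diff)
      then obtain u where u: "u \<in> (\<Pi>\<^sub>E i\<in>{..<k}. U' i)" "v - p = (\<Sum>i<k. u i)"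
        using bij by (auto simp: bij_betw_def)
      define w where "w = (\<lambda>i. if i < k then u i else if i = k then p else undefined)"
      have "w \<in> (\<Pi>\<^sub>E i\<in>{..<Suc k}. V i)"
        using u(1) p(1) by (auto simp: w_def V_def PiE_iff extensional_def less_Suc_eq)
      moreover have "v = (\<Sum>i<Suc k. w i)"
        using u(2) by (simp add: w_def algebra_simps)
      ultimately show "v \<in> (\<lambda>u. \<Sum>i<Suc k. u i) ` (\<Pi>\<^sub>E i\<in>{..<Suc k}. V i)" by blast
    qed
    moreover have "irreducible_rep G (subrep W (V i))" if "i < Suc k" for i
      using dec U(2) that by (auto simp: V_def irreducible_decomposition_def less_Suc_eq)
    ultimately have "irreducible_decomposition G W (Suc k) V"
      using inj by (auto simp: irreducible_decomposition_def bij_betw_def)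
    then show ?thesis by blast
  qed
qed

section \<open>Tensor products\<close>

lemma pure_tensor_apply: "pure_tensor v w (x, y) = v x * w y"
  by (simp add: pure_tensor_def)

lemma pure_tensor_in: "v \<in> V \<Longrightarrow> w \<in> W \<Longrightarrow> pure_tensor v w \<in> tensor_space V W"
  unfolding tensor_space_def by (rule cfun.span_base) blast

lemma subspace_tensor: "cfun.subspace (tensor_space V W)"
  unfolding tensor_space_def by (rule cfun.subspace_span)

lemma tensor_slice:
  assumes "cfun.subspace V" "cfun.subspace W" "F \<in> tensor_space V W"
  shows "(\<lambda>y. F (x, y)) \<in> W" "(\<lambda>x. F (x, y)) \<in> V"
  using tensor_space_slices[OF assms] by auto

lemma tensor_space_funs_on:
  assumes "cfun.subspace V" "cfun.subspace W" "V \<subseteq> funs_on P" "W \<subseteq> funs_on Q"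
  shows "tensor_space V W \<subseteq> funs_on (P \<times> Q)"
proof
  fix F assume F: "F \<in> tensor_space V W"
  have "F (x, y) = 0" if "x \<notin> P \<or> y \<notin> Q" for x y
  proof -
    have "(\<lambda>y. F (x, y)) \<in> funs_on Q" "(\<lambda>x. F (x, y)) \<in> funs_on P"
      using tensor_slice[OF assms(1,2) F] assms(3,4) by blast+
    then show ?thesis using that by (auto simp: funs_on_def)
  qed
  then show "F \<in> funs_on (P \<times> Q)" by (auto simp: funs_on_def)
qed

text \<open>The converse of \<open>tensor_space_slices\<close>.  If \<open>\<rho> y\<close> is the orthogonal projection of the unit vector
  at \<open>y\<close> to \<open>W\<close>, then every \<open>w\<close> in \<open>W\<close> is \<open>\<Sum>y. w y \<cdot> \<rho> y\<close>.  Applied to all the slices in \<open>W\<close>, this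
  writes \<open>F\<close> as a finite sum of pure tensors.\<close>

lemma tensor_spaceI:
  assumes "finite P" "cfun.subspace V" "V \<subseteq> funs_on P" "finite Q" "cfun.subspace W" "W \<subseteq> funs_on Q"
    and F: "\<And>x. (\<lambda>y. F (x, y)) \<in> W" "\<And>y. (\<lambda>x. F (x, y)) \<in> V"
  shows "F \<in> tensor_space V W"
proof -
  define d :: "'b \<Rightarrow> 'b \<Rightarrow> complex" where "d = (\<lambda>y z. if z = y then 1 else 0)"
  have "\<forall>y. \<exists>p. p \<in> W \<and> (\<forall>u\<in>W. inner_on Q (d y - p) u = 0)"
    using orthogonal_projection[OF assms(4-6)] by metis
  then obtain \<rho> where \<rho>: "\<And>y. \<rho> y \<in> W" "\<And>y u. u \<in> W \<Longrightarrow> inner_on Q (d y - \<rho> y) u = 0"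
    by metis
  have expand: "w = (\<Sum>y\<in>Q. cscale (w y) (\<rho> y))" if w: "w \<in> W" for w
  proof -
    define z where "z = w - (\<Sum>y\<in>Q. cscale (w y) (\<rho> y))"
    have zW: "z \<in> W" unfolding z_def
      using w \<rho>(1) by (intro cfun.subspace_diff[OF assms(5)] cfun.subspace_sum[OF assms(5)]
          cfun.subspace_scale[OF assms(5)]) auto
    have "w = (\<Sum>y\<in>Q. cscale (w y) (d y))"
      using w assms(4,6) by (auto simp: fun_eq_iff fun_app funs_on_def d_def if_distrib cong: if_cong)
    then have z: "z = (\<Sum>y\<in>Q. cscale (w y) (d y - \<rho> y))"
      unfolding z_def by (simp only: cfun.scale_right_diff_distrib sum_subtractf)
    have "inner_on Q z z = inner_on Q (\<Sum>y\<in>Q. cscale (w y) (d y - \<rho> y)) z" by (subst (1) z) (rule refl)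
    also have "\<dots> = (\<Sum>y\<in>Q. w y * inner_on Q (d y - \<rho> y) z)"
      by (simp only: inner_on_sum_left inner_on_scale_left)
    also have "\<dots> = 0" using \<rho>(2) zW by simp
    finally have "inner_on Q z z = 0" .
    then have "z = 0" using inner_on_self_eq_0[OF assms(4)] zW assms(6) by blast
    then show ?thesis by (simp add: z_def)
  qed
  have "F = (\<Sum>y\<in>Q. pure_tensor (\<lambda>x. F (x, y)) (\<rho> y))"
  proof
    fix p :: "'a \<times> 'b"
    obtain x z where p: "p = (x, z)" by fastforce
    have "F (x, z) = (\<Sum>y\<in>Q. cscale (F (x, y)) (\<rho> y)) z"
      using expand[OF F(1)[of x]] by metis
    then show "F p = (\<Sum>y\<in>Q. pure_tensor (\<lambda>x. F (x, y)) (\<rho> y)) p"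
      by (simp add: p fun_app pure_tensor_apply)
  qed
  moreover have "\<dots> \<in> tensor_space V W"
    using F(2) \<rho>(1) by (intro cfun.subspace_sum[OF subspace_tensor] pure_tensor_in) auto
  ultimately show ?thesis by metis
qed

lemma tensor_map_perm:
  assumes V: "perm_rep G V P \<beta>" and W: "perm_rep H W Q \<gamma>" and g: "g \<in> carrier G" and h: "h \<in> carrier H"
    and F: "F \<in> tensor_space (rep_space V) (rep_space W)"
  shows "tensor_map (rep_act V g) (rep_act W h) F (x, y) =
    (if x \<in> P \<and> y \<in> Q then F (\<beta> g x, \<gamma> h y) else 0)"
proof -
  note sl = tensor_slice[OF perm_repD(4)[OF V] perm_repD(4)[OF W] F]
  have B: "rep_act W h (\<lambda>y'. F (x', y')) y = (if y \<in> Q then F (x', \<gamma> h y) else 0)" for x'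
    using perm_repD(6)[OF W h sl(1)] perm_repD(7)[OF W is_repD(2)[OF perm_repD(1)[OF W] h sl(1)]]
    by auto
  show ?thesis
  proof (cases "y \<in> Q")
    case True
    then have "tensor_map (rep_act V g) (rep_act W h) F (x, y) = rep_act V g (\<lambda>x'. F (x', \<gamma> h y)) x"
      by (simp add: tensor_map_def B)
    then show ?thesis
      using True perm_repD(6)[OF V g sl(2)] perm_repD(7)[OF V is_repD(2)[OF perm_repD(1)[OF V] g sl(2)]]
      by auto
  next
    case False
    have "rep_act V g 0 = 0"
      using linear_on_zero is_repD(1,3)[OF perm_repD(1)[OF V]] g by blast
    moreover have "tensor_map (rep_act V g) (rep_act W h) F (x, y) = rep_act V g 0 x"
      using False by (simp add: tensor_map_def B zero_fun_def)
    ultimately show ?thesis using False by (simp add: fun_app)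
  qed
qed

lemma tensor_map_in:
  assumes V: "perm_rep G V P \<beta>" and W: "perm_rep H W Q \<gamma>" and g: "g \<in> carrier G" and h: "h \<in> carrier H"
    and F: "F \<in> tensor_space (rep_space V) (rep_space W)"
  shows "tensor_map (rep_act V g) (rep_act W h) F \<in> tensor_space (rep_space V) (rep_space W)"
proof (rule tensor_spaceI[OF perm_repD(2,4,3)[OF V] perm_repD(2,4,3)[OF W]])
  note sl = tensor_slice[OF perm_repD(4)[OF V] perm_repD(4)[OF W] F]
  note inV = is_repD(2)[OF perm_repD(1)[OF V] g] and inW = is_repD(2)[OF perm_repD(1)[OF W] h]
  show "(\<lambda>y. tensor_map (rep_act V g) (rep_act W h) F (x, y)) \<in> rep_space W" for x
  proof (cases "x \<in> P")
    case True
    have "(\<lambda>y. tensor_map (rep_act V g) (rep_act W h) F (x, y)) = rep_act W h (\<lambda>y. F (\<beta> g x, y))"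
      using True perm_repD(6)[OF W h sl(1)] perm_repD(7)[OF W inW[OF sl(1)]]
      by (auto simp: tensor_map_perm[OF assms] fun_eq_iff)
    then show ?thesis using inW[OF sl(1)] by simp
  next
    case False
    then have "(\<lambda>y. tensor_map (rep_act V g) (rep_act W h) F (x, y)) = 0"
      by (simp add: tensor_map_perm[OF assms] fun_eq_iff fun_app)
    then show ?thesis using cfun.subspace_0[OF perm_repD(4)[OF W]] by simp
  qed
  show "(\<lambda>x. tensor_map (rep_act V g) (rep_act W h) F (x, y)) \<in> rep_space V" for y
  proof (cases "y \<in> Q")
    case True
    have "(\<lambda>x. tensor_map (rep_act V g) (rep_act W h) F (x, y)) = rep_act V g (\<lambda>x. F (x, \<gamma> h y))"
      using True perm_repD(6)[OF V g sl(2)] perm_repD(7)[OF V inV[OF sl(2)]]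
      by (auto simp: tensor_map_perm[OF assms] fun_eq_iff)
    then show ?thesis using inV[OF sl(2)] by simp
  next
    case False
    then have "(\<lambda>x. tensor_map (rep_act V g) (rep_act W h) F (x, y)) = 0"
      by (simp add: tensor_map_perm[OF assms] fun_eq_iff fun_app)
    then show ?thesis using cfun.subspace_0[OF perm_repD(4)[OF V]] by simp
  qed
qed

lemma linear_on_tensor_map:
  assumes V: "perm_rep G V P \<beta>" and W: "perm_rep H W Q \<gamma>" and g: "g \<in> carrier G" and h: "h \<in> carrier H"
  shows "linear_on (tensor_space (rep_space V) (rep_space W)) (tensor_map (rep_act V g) (rep_act W h))"
  unfolding linear_on_def
  by (auto simp: fun_eq_iff fun_app tensor_map_perm[OF assms]
      cfun.subspace_add[OF subspace_tensor] cfun.subspace_scale[OF subspace_tensor])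

text \<open>Inner and outer tensor products at once: the group \<open>K\<close> acts on the two factors through maps to \<open>G\<close>
  and \<open>H\<close>, which are identities for the inner product and projections for the outer one.\<close>

lemma perm_rep_tensor_along:
  fixes K :: "('k, 'm) monoid_scheme"
  assumes V: "perm_rep G V P \<beta>" and W: "perm_rep H W Q \<gamma>"
    and K: "monoid K" and f: "\<And>a. a \<in> carrier K \<Longrightarrow> f a \<in> carrier G" "\<And>a. a \<in> carrier K \<Longrightarrow> f' a \<in> carrier H"
      "f \<one>\<^bsub>K\<^esub> = \<one>\<^bsub>G\<^esub>" "f' \<one>\<^bsub>K\<^esub> = \<one>\<^bsub>H\<^esub>"
      "\<And>a b. a \<in> carrier K \<Longrightarrow> b \<in> carrier K \<Longrightarrow> f (a \<otimes>\<^bsub>K\<^esub> b) = f a \<otimes>\<^bsub>G\<^esub> f b"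
      "\<And>a b. a \<in> carrier K \<Longrightarrow> b \<in> carrier K \<Longrightarrow> f' (a \<otimes>\<^bsub>K\<^esub> b) = f' a \<otimes>\<^bsub>H\<^esub> f' b"
  shows "perm_rep K \<lparr>rep_space = tensor_space (rep_space V) (rep_space W),
      rep_act = (\<lambda>a. tensor_map (rep_act V (f a)) (rep_act W (f' a)))\<rparr> (P \<times> Q)
      (\<lambda>a (x, y). (\<beta> (f a) x, \<gamma> (f' a) y))"
proof -
  note rV = perm_repD(1)[OF V] and rW = perm_repD(1)[OF W]
  note slice = tensor_slice[OF perm_repD(4)[OF V] perm_repD(4)[OF W]]
  have one: "tensor_map (rep_act V \<one>\<^bsub>G\<^esub>) (rep_act W \<one>\<^bsub>H\<^esub>) F = F"
    if "F \<in> tensor_space (rep_space V) (rep_space W)" for F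
    by (simp add: tensor_map_def is_repD(4)[OF rW slice(1)[OF that]]
        is_repD(4)[OF rV slice(2)[OF that]])
  have pV: "v (\<beta> (g \<otimes>\<^bsub>G\<^esub> g') x) = v (\<beta> g' (\<beta> g x))"
    if "v \<in> rep_space V" "g \<in> carrier G" "g' \<in> carrier G" "g \<otimes>\<^bsub>G\<^esub> g' \<in> carrier G" "x \<in> P" for v g g' x
    using perm_repD(6,8)[OF V] is_repD(2,5)[OF rV] that by metis
  have pW: "v (\<gamma> (g \<otimes>\<^bsub>H\<^esub> g') x) = v (\<gamma> g' (\<gamma> g x))"
    if "v \<in> rep_space W" "g \<in> carrier H" "g' \<in> carrier H" "g \<otimes>\<^bsub>H\<^esub> g' \<in> carrier H" "x \<in> Q" for v g g' x
    using perm_repD(6,8)[OF W] is_repD(2,5)[OF rW] that by metis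
  have mult: "tensor_map (rep_act V (f (a \<otimes>\<^bsub>K\<^esub> b))) (rep_act W (f' (a \<otimes>\<^bsub>K\<^esub> b))) F =
      tensor_map (rep_act V (f a)) (rep_act W (f' a)) (tensor_map (rep_act V (f b)) (rep_act W (f' b)) F)"
    if F: "F \<in> tensor_space (rep_space V) (rep_space W)" and a: "a \<in> carrier K" and b: "b \<in> carrier K"
    for F a b
  proof -
    have c: "a \<otimes>\<^bsub>K\<^esub> b \<in> carrier K" using a b monoid.m_closed[OF K] by blast
    have F': "tensor_map (rep_act V (f b)) (rep_act W (f' b)) F \<in> tensor_space (rep_space V) (rep_space W)"
      using tensor_map_in[OF V W f(1)[OF b] f(2)[OF b] F] .
    have "F (\<beta> (f (a \<otimes>\<^bsub>K\<^esub> b)) x, \<gamma> (f' (a \<otimes>\<^bsub>K\<^esub> b)) y)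
        = F (\<beta> (f b) (\<beta> (f a) x), \<gamma> (f' b) (\<gamma> (f' a) y))" if "x \<in> P" "y \<in> Q" for x y
      using pV[OF slice(2)[OF F], of "f a" "f b" x] pW[OF slice(1)[OF F], of "f' a" "f' b" y]
        f(1)[OF a] f(2)[OF a] f(1)[OF b] f(2)[OF b] f(1)[OF c] f(2)[OF c] f(5,6)[OF a b] that by simp
    then show ?thesis
      using perm_repD(8)[OF V f(1)[OF a]] perm_repD(8)[OF W f(2)[OF a]]
      by (auto simp: fun_eq_iff tensor_map_perm[OF V W f(1)[OF a] f(2)[OF a] F']
          tensor_map_perm[OF V W f(1)[OF b] f(2)[OF b] F] tensor_map_perm[OF V W f(1)[OF c] f(2)[OF c] F])
  qed
  let ?R = "\<lparr>rep_space = tensor_space (rep_space V) (rep_space W),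
      rep_act = (\<lambda>a. tensor_map (rep_act V (f a)) (rep_act W (f' a)))\<rparr>"
  have "is_rep K ?R"
    unfolding is_rep_def
    using subspace_tensor tensor_map_in[OF V W f(1,2)] linear_on_tensor_map[OF V W f(1,2)] one mult
    by (auto simp: f(3,4) image_subset_iff)
  moreover have "bij_betw (\<lambda>(x, y). (\<beta> (f a) x, \<gamma> (f' a) y)) (P \<times> Q) (P \<times> Q)" if "a \<in> carrier K" for a
    using bij_betw_map_prod[OF perm_repD(5)[OF V f(1)[OF that]] perm_repD(5)[OF W f(2)[OF that]]]
    by (simp add: map_prod_def)
  moreover have "tensor_space (rep_space V) (rep_space W) \<subseteq> funs_on (P \<times> Q)"
    using tensor_space_funs_on perm_repD(3,4)[OF V] perm_repD(3,4)[OF W] by blast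
  moreover have "finite (P \<times> Q)" using perm_repD(2)[OF V] perm_repD(2)[OF W] by blast
  ultimately show ?thesis
    unfolding perm_rep_def using tensor_map_perm[OF V W f(1,2)] by auto
qed

section \<open>Invariants\<close>

definition fixed_space :: "('g, 'm) monoid_scheme \<Rightarrow> ('g, 'x) rep \<Rightarrow> ('x \<Rightarrow> complex) set"
  where "fixed_space G R = {v\<in>rep_space R. \<forall>g\<in>carrier G. rep_act R g v = v}"

lemma subspace_fixed_space:
  assumes "is_rep G R"
  shows "cfun.subspace (fixed_space G R)"
proof -
  note s = is_repD(1)[OF assms]
  show ?thesis
    unfolding fixed_space_def
    using linear_onD[OF is_repD(3)[OF assms]] linear_on_zero[OF is_repD(3)[OF assms] s]
    by (auto intro!: cfun.subspaceI cfun.subspace_0[OF s] cfun.subspace_add[OF s]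
        cfun.subspace_scale[OF s])
qed

definition group_sum :: "('g, 'm) monoid_scheme \<Rightarrow> ('g, 'x) rep \<Rightarrow> ('x \<Rightarrow> complex) \<Rightarrow> 'x \<Rightarrow> complex"
  where "group_sum G R v = (\<Sum>g\<in>carrier G. rep_act R g v)"

lemma group_sum_fixed:
  assumes "group G" "is_rep G R" "v \<in> rep_space R"
  shows "group_sum G R v \<in> fixed_space G R"
proof -
  note R = is_repD[OF assms(2)]
  interpret group G by (rule assms(1))
  have "rep_act R h (group_sum G R v) = group_sum G R v" if h: "h \<in> carrier G" for h
  proof -
    have "rep_act R h (group_sum G R v) = (\<Sum>g\<in>carrier G. rep_act R h (rep_act R g v))"
      unfolding group_sum_def using R(2) assms(3) by (intro linear_on_sum[OF R(3)[OF h] R(1)]) auto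
    also have "\<dots> = (\<Sum>g\<in>carrier G. rep_act R (h \<otimes>\<^bsub>G\<^esub> g) v)"
      using R(5) h assms(3) by (intro sum.cong) auto
    also have "\<dots> = group_sum G R v"
      unfolding group_sum_def using h
      by (intro sum.reindex_bij_witness[of _ "\<lambda>g. inv\<^bsub>G\<^esub> h \<otimes>\<^bsub>G\<^esub> g" "\<lambda>g. h \<otimes>\<^bsub>G\<^esub> g"])
        (auto simp: m_assoc[symmetric])
    finally show ?thesis .
  qed
  moreover have "group_sum G R v \<in> rep_space R"
    unfolding group_sum_def using R(2) assms(3) by (intro cfun.subspace_sum[OF R(1)]) auto
  ultimately show ?thesis by (simp add: fixed_space_def)
qed

lemma tensor_rep_simps [simp]:
  "rep_space (tensor_rep V W) = tensor_space (rep_space V) (rep_space W)"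
  "rep_act (tensor_rep V W) g = tensor_map (rep_act V g) (rep_act W g)"
  by (simp_all add: tensor_rep_def)

lemma perm_rep_tensor:
  assumes "group G" "perm_rep G V P \<beta>" "perm_rep G W Q \<gamma>"
  shows "perm_rep G (tensor_rep V W) (P \<times> Q) (\<lambda>a (x, y). (\<beta> a x, \<gamma> a y))"
proof -
  interpret group G by (rule assms(1))
  show ?thesis
    unfolding tensor_rep_def
    by (rule perm_rep_tensor_along[OF assms(2,3), of G "\<lambda>a. a" "\<lambda>a. a"]) (auto simp: is_monoid)
qed

lemma fixed_tensor_iff:
  assumes "perm_rep G V P \<beta>" "perm_rep G W Q \<gamma>"
  shows "F \<in> fixed_space G (tensor_rep V W) \<longleftrightarrow>
    F \<in> tensor_space (rep_space V) (rep_space W) \<and>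
    (\<forall>g\<in>carrier G. \<forall>x\<in>P. \<forall>y\<in>Q. F (\<beta> g x, \<gamma> g y) = F (x, y))"
proof -
  have "tensor_map (rep_act V g) (rep_act W g) F = F \<longleftrightarrow> (\<forall>x\<in>P. \<forall>y\<in>Q. F (\<beta> g x, \<gamma> g y) = F (x, y))"
    if F: "F \<in> tensor_space (rep_space V) (rep_space W)" and g: "g \<in> carrier G" for g
  proof -
    have "F (x, y) = 0" if "x \<notin> P \<or> y \<notin> Q" for x y
      using that tensor_space_funs_on[OF perm_repD(4)[OF assms(1)] perm_repD(4)[OF assms(2)]
          perm_repD(3)[OF assms(1)] perm_repD(3)[OF assms(2)]] F
      by (auto simp: funs_on_def)
    then show ?thesis
      by (auto simp: fun_eq_iff tensor_map_perm[OF assms g g F])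
  qed
  then show ?thesis by (auto simp: fixed_space_def)
qed

section \<open>Absolutely simple representations\<close>

definition conj_fun :: "('x \<Rightarrow> complex) \<Rightarrow> 'x \<Rightarrow> complex"
  where "conj_fun v = (\<lambda>x. cnj (v x))"

lemma inner_on_pure_tensor:
  "inner_on (P \<times> Q) (pure_tensor v v') (pure_tensor w w') = inner_on P v w * inner_on Q v' w'"
  by (simp add: inner_on_def pure_tensor_apply sum.cartesian_product[symmetric] sum_product
      case_prod_unfold ac_simps) (simp add: pure_tensor_def sum.cartesian_product case_prod_unfold ac_simps)

lemma inner_on_conj_fun: "inner_on P (conj_fun v) (conj_fun w) = cnj (inner_on P v w)"
  by (simp add: inner_on_def conj_fun_def)

text \<open>As \<open>V\<close> is closed under conjugation, it is isomorphic to its dual, and the invariants of \<open>V \<otimes> V\<close>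
  correspond to the equivariant endomorphisms of \<open>V\<close>.  The last condition says that these are scalars;
  it replaces the existence of eigenvalues in Schur's lemma and passes easily along the induction on
  the number of rows of a diagram.\<close>

definition absolutely_simple ::
  "('g, 'm) monoid_scheme \<Rightarrow> ('g, 'x) rep \<Rightarrow> 'x set \<Rightarrow> ('g \<Rightarrow> 'x \<Rightarrow> 'x) \<Rightarrow> bool"
  where "absolutely_simple G V P \<beta> \<longleftrightarrow> perm_rep G V P \<beta> \<and> (\<forall>v\<in>rep_space V. conj_fun v \<in> rep_space V) \<and>
    rep_space V \<noteq> {0} \<and> (\<exists>K. fixed_space G (tensor_rep V V) \<subseteq> cfun.span {K})"

text \<open>The kernel function of the equivariant map \<open>x \<mapsto> \<Sum>g. \<langle>x, g v\<rangle> \<cdot> g v\<close>.\<close>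

definition orbit_tensor ::
  "('g, 'm) monoid_scheme \<Rightarrow> ('g, 'x) rep \<Rightarrow> ('x \<Rightarrow> complex) \<Rightarrow> 'x \<times> 'x \<Rightarrow> complex"
  where "orbit_tensor G V v = group_sum G (tensor_rep V V) (pure_tensor v (conj_fun v))"

lemma orbit_tensor_fixed:
  assumes "group G" "perm_rep G V P \<beta>" "\<And>v. v \<in> rep_space V \<Longrightarrow> conj_fun v \<in> rep_space V" "v \<in> rep_space V"
  shows "orbit_tensor G V v \<in> fixed_space G (tensor_rep V V)"
  unfolding orbit_tensor_def
  using group_sum_fixed[OF assms(1) perm_repD(1)[OF perm_rep_tensor[OF assms(1,2,2)]]]
    pure_tensor_in[OF assms(4) assms(3)[OF assms(4)]] by simp

lemma inner_on_orbit_tensor: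
  assumes V: "perm_rep G V P \<beta>" and closed: "\<And>v. v \<in> rep_space V \<Longrightarrow> conj_fun v \<in> rep_space V"
    and v: "v \<in> rep_space V"
  shows "inner_on (P \<times> P) (orbit_tensor G V v) (pure_tensor w (conj_fun w)) =
    (\<Sum>g\<in>carrier G. of_real ((cmod (inner_on P (rep_act V g v) w))\<^sup>2))"
proof -
  have "inner_on (P \<times> P) (orbit_tensor G V v) (pure_tensor w (conj_fun w)) =
    (\<Sum>g\<in>carrier G. inner_on (P \<times> P) (tensor_map (rep_act V g) (rep_act V g) (pure_tensor v (conj_fun v)))
       (pure_tensor w (conj_fun w)))"
    by (simp add: orbit_tensor_def group_sum_def inner_on_sum_left)
  also have "\<dots> = (\<Sum>g\<in>carrier G. of_real ((cmod (inner_on P (rep_act V g v) w))\<^sup>2))"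
  proof (rule sum.cong[OF refl])
    fix g assume g: "g \<in> carrier G"
    note lin = is_repD(3)[OF perm_repD(1)[OF V] g]
    have "rep_act V g (conj_fun v) = conj_fun (rep_act V g v)"
    proof
      fix x
      show "rep_act V g (conj_fun v) x = conj_fun (rep_act V g v) x"
        using perm_repD(6)[OF V g] perm_repD(7)[OF V is_repD(2)[OF perm_repD(1)[OF V] g v]]
          perm_repD(7)[OF V is_repD(2)[OF perm_repD(1)[OF V] g closed[OF v]]] v closed[OF v]
        by (cases "x \<in> P") (auto simp: conj_fun_def)
    qed
    then show "inner_on (P \<times> P) (tensor_map (rep_act V g) (rep_act V g) (pure_tensor v (conj_fun v)))
       (pure_tensor w (conj_fun w)) = of_real ((cmod (inner_on P (rep_act V g v) w))\<^sup>2)"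
      by (simp add: tensor_map_pure[OF lin lin v closed[OF v]] inner_on_pure_tensor inner_on_conj_fun complex_norm_square
          flip: of_real_power)
  qed
  finally show ?thesis .
qed

lemma inner_on_orbit_tensor_self:
  assumes G: "group G" "finite (carrier G)"
    and V: "perm_rep G V P \<beta>" and closed: "\<And>v. v \<in> rep_space V \<Longrightarrow> conj_fun v \<in> rep_space V"
    and v: "v \<in> rep_space V" "v \<noteq> 0"
  shows "inner_on (P \<times> P) (orbit_tensor G V v) (pure_tensor v (conj_fun v)) \<noteq> 0"
proof -
  interpret group G by (rule G)
  have "inner_on P (rep_act V \<one>\<^bsub>G\<^esub> v) v \<noteq> 0"
    using inner_on_self_eq_0[OF perm_repD(2)[OF V]] perm_repD(3)[OF V] v is_repD(4)[OF perm_repD(1)[OF V]]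
    by auto
  then have "0 < (\<Sum>g\<in>carrier G. (cmod (inner_on P (rep_act V g v) v))\<^sup>2)"
    using G(2) by (intro sum_pos2[of _ "\<one>\<^bsub>G\<^esub>"]) auto
  moreover have "inner_on (P \<times> P) (orbit_tensor G V v) (pure_tensor v (conj_fun v)) =
      of_real (\<Sum>g\<in>carrier G. (cmod (inner_on P (rep_act V g v) v))\<^sup>2)"
    unfolding of_real_sum by (rule inner_on_orbit_tensor[OF V closed v(1)])
  ultimately show ?thesis by (metis less_irrefl of_real_eq_0_iff)
qed

lemma absolutely_simpleD:
  assumes "absolutely_simple G V P \<beta>"
  shows "perm_rep G V P \<beta>" "\<And>v. v \<in> rep_space V \<Longrightarrow> conj_fun v \<in> rep_space V" "rep_space V \<noteq> {0}"
  using assms by (auto simp: absolutely_simple_def)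

lemma absolutely_simple_generator:
  assumes G: "group G" "finite (carrier G)" and V: "absolutely_simple G V P \<beta>"
  obtains K where "K \<noteq> 0" "fixed_space G (tensor_rep V V) = cfun.span {K}"
proof -
  note Vp = absolutely_simpleD[OF V]
  obtain v where v: "v \<in> rep_space V" "v \<noteq> 0"
    using Vp(3) cfun.subspace_0[OF perm_repD(4)[OF Vp(1)]] by blast
  obtain K where K: "fixed_space G (tensor_rep V V) \<subseteq> cfun.span {K}"
    using V by (auto simp: absolutely_simple_def)
  define F where "F = orbit_tensor G V v"
  have F0: "F \<noteq> 0" unfolding F_def using inner_on_orbit_tensor_self[OF G Vp(1,2) v] by auto
  have Ffix: "F \<in> fixed_space G (tensor_rep V V)"
    unfolding F_def by (rule orbit_tensor_fixed[OF G(1) Vp(1,2) v(1)])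
  then obtain c where c: "F = cscale c K" using K by (auto simp: cfun.span_singleton)
  have "c \<noteq> 0" using c F0 by auto
  then have "K = cscale (1 / c) F" using c by simp
  then have "cfun.span {K} \<subseteq> cfun.span {F}" by (auto simp: cfun.span_singleton)
  moreover have "cfun.span {F} \<subseteq> fixed_space G (tensor_rep V V)"
    using Ffix subspace_fixed_space[OF perm_repD(1)[OF perm_rep_tensor[OF G(1) Vp(1) Vp(1)]]]
    by (intro cfun.span_minimal) auto
  ultimately show ?thesis using K that[OF F0] by blast
qed

text \<open>A vector \<open>u\<close> in a proper subrepresentation \<open>U\<close> and a vector \<open>w\<close> orthogonal to \<open>U\<close> would give two nonzero
  orbit tensors.  They are not proportional: the pairing with \<open>w \<otimes> conj_fun w\<close> annihilates only the one
  that comes from \<open>u\<close>.\<close>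

lemma absolutely_simple_irreducible:
  assumes G: "group G" "finite (carrier G)" and V: "absolutely_simple G V P \<beta>"
  shows "irreducible_rep G V"
  unfolding irreducible_rep_def
proof (intro conjI allI impI)
  note Vp = absolutely_simpleD[OF V]
  show "is_rep G V" "rep_space V \<noteq> {0}" using Vp(3) perm_repD(1)[OF Vp(1)] by auto
  fix U assume U: "U \<subseteq> rep_space V \<and> is_rep G (subrep V U)"
  show "U = {0} \<or> U = rep_space V"
  proof (rule ccontr)
    assume *: "\<not> (U = {0} \<or> U = rep_space V)"
    have Us: "cfun.subspace U" using U is_repD(1)[of G "subrep V U"] by simp
    obtain u where u: "u \<in> U" "u \<noteq> 0" using * cfun.subspace_0[OF Us] by blast
    have uV: "u \<in> rep_space V" using u U by blast
    obtain w where w: "w \<in> rep_space V" "w \<noteq> 0" "\<And>u. u \<in> U \<Longrightarrow> inner_on P w u = 0"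
      using orthogonal_vector[OF perm_repD(2,4,3)[OF Vp(1)] Us] * U by blast
    obtain K where K: "fixed_space G (tensor_rep V V) = cfun.span {K}" "K \<noteq> 0"
      using absolutely_simple_generator[OF G V] by metis
    have "orbit_tensor G V u \<in> cfun.span {K}" "orbit_tensor G V w \<in> cfun.span {K}"
      using orbit_tensor_fixed[OF G(1) Vp(1,2)] uV w K by auto
    then obtain c d where c: "orbit_tensor G V u = cscale c K" "orbit_tensor G V w = cscale d K"
      by (auto simp: cfun.span_singleton)
    have "inner_on (P \<times> P) (orbit_tensor G V u) (pure_tensor u (conj_fun u)) \<noteq> 0"
      using inner_on_orbit_tensor_self[OF G Vp(1,2) uV u(2)] .
    then have "c \<noteq> 0" by (auto simp: c)
    moreover have "inner_on (P \<times> P) (orbit_tensor G V u) (pure_tensor w (conj_fun w)) = 0"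
    proof -
      have "inner_on P (rep_act V g u) w = 0" if "g \<in> carrier G" for g
        using w(3)[of "rep_act V g u"] that u(1) U inner_on_commute[of P w "rep_act V g u"]
          is_rep_subrep_iff[OF perm_repD(1)[OF Vp(1)], of U] by simp
      then show ?thesis by (subst inner_on_orbit_tensor[OF Vp(1,2) uV]) auto
    qed
    ultimately have "inner_on (P \<times> P) K (pure_tensor w (conj_fun w)) = 0" by (simp add: c inner_on_scale_left)
    then have "inner_on (P \<times> P) (orbit_tensor G V w) (pure_tensor w (conj_fun w)) = 0" by (simp add: c inner_on_scale_left)
    then show False using inner_on_orbit_tensor_self[OF G Vp(1,2) w(1,2)] by simp
  qed
qed

definition map_right :: "(('y \<Rightarrow> complex) \<Rightarrow> 'z \<Rightarrow> complex) \<Rightarrow> ('x \<times> 'y \<Rightarrow> complex) \<Rightarrow> 'x \<times> 'z \<Rightarrow> complex"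
  where "map_right T F = (\<lambda>(x, z). T (\<lambda>y. F (x, y)) z)"

lemma map_right_slice: "(\<lambda>z. map_right T F (x, z)) = T (\<lambda>y. F (x, y))"
  by (simp add: map_right_def)

lemma map_right_tensor:
  fixes V :: "('x \<Rightarrow> complex) set" and W :: "('y \<Rightarrow> complex) set"
  assumes "cfun.subspace V" "cfun.subspace W" "linear_on W T" "\<And>w. w \<in> W \<Longrightarrow> T w \<in> W'"
    "F \<in> tensor_space V W"
  shows "map_right T F \<in> tensor_space V W'"
proof -
  have "F \<in> cfun.span {pure_tensor v w |v w. v \<in> V \<and> w \<in> W} \<and>
      map_right T F \<in> cfun.span {pure_tensor v w |v w. v \<in> V \<and> w \<in> W'}"
    using assms(5) unfolding tensor_space_def
  proof (induction rule: cfun.span_induct_alt)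
    case base
    have "map_right T (0 :: 'x \<times> 'y \<Rightarrow> complex) = 0"
      using linear_on_zero[OF assms(3,2)]
      by (auto simp: map_right_def fun_eq_iff fun_app) (simp add: zero_fun_def)
    then show ?case by (simp add: cfun.span_zero)
  next
    case (step c p F)
    then obtain v w where p: "p = pure_tensor v w" "v \<in> V" "w \<in> W" by auto
    have F: "F \<in> tensor_space V W" using step by (simp add: tensor_space_def)
    have "T (\<lambda>y. (cscale c p + F) (x, y)) = cscale (c * v x) (T w) + T (\<lambda>y. F (x, y))" for x
    proof -
      have "(\<lambda>y. (cscale c p + F) (x, y)) = cscale (c * v x) w + (\<lambda>y. F (x, y))"
        by (auto simp: fun_app p pure_tensor_apply)
      then show ?thesis
        using linear_onD[OF assms(3)] p(3) tensor_slice(1)[OF assms(1,2) F]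
          cfun.subspace_scale[OF assms(2)] by simp
    qed
    then have "map_right T (cscale c p + F) = cscale c (pure_tensor v (T w)) + map_right T F"
      by (auto simp: map_right_def fun_eq_iff fun_app pure_tensor_apply)
    moreover have "pure_tensor v (T w) \<in> cfun.span {pure_tensor v w |v w. v \<in> V \<and> w \<in> W'}"
      using p assms(4) by (intro cfun.span_base) blast
    moreover have "cscale c p + F \<in> cfun.span {pure_tensor v w |v w. v \<in> V \<and> w \<in> W}"
      using step by (intro cfun.span_add cfun.span_scale) (auto intro: cfun.span_base)
    ultimately show ?case using step by (auto intro: cfun.span_add cfun.span_scale)
  qed
  then show ?thesis by (simp add: tensor_space_def)
qed

lemma map_right_fixed:
  assumes V: "perm_rep G V P \<beta>" and W: "perm_rep G W Q \<gamma>" and W': "perm_rep G W' Q' \<gamma>'"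
    and T: "linear_on (rep_space W) T" "\<And>w. w \<in> rep_space W \<Longrightarrow> T w \<in> rep_space W'"
      "\<And>g w. g \<in> carrier G \<Longrightarrow> w \<in> rep_space W \<Longrightarrow> T (rep_act W g w) = rep_act W' g (T w)"
    and F: "F \<in> fixed_space G (tensor_rep V W)"
  shows "map_right T F \<in> fixed_space G (tensor_rep V W')"
proof -
  have Ft: "F \<in> tensor_space (rep_space V) (rep_space W)"
    and Fi: "\<And>g x y. g \<in> carrier G \<Longrightarrow> x \<in> P \<Longrightarrow> y \<in> Q \<Longrightarrow> F (\<beta> g x, \<gamma> g y) = F (x, y)"
    using F fixed_tensor_iff[OF V W] by auto
  note slF = tensor_slice(1)[OF perm_repD(4)[OF V] perm_repD(4)[OF W] Ft]
  have "map_right T F (\<beta> g x, \<gamma>' g y) = map_right T F (x, y)"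
    if g: "g \<in> carrier G" and x: "x \<in> P" and y: "y \<in> Q'" for g x y
  proof -
    have "rep_act W g (\<lambda>y. F (\<beta> g x, y)) = (\<lambda>y. F (x, y))"
    proof
      fix y
      show "rep_act W g (\<lambda>y. F (\<beta> g x, y)) y = F (x, y)"
        using perm_repD(6)[OF W g slF] perm_repD(7)[OF W is_repD(2)[OF perm_repD(1)[OF W] g slF]]
          perm_repD(7)[OF W slF[of x]] Fi[OF g x] by (cases "y \<in> Q") auto
    qed
    then have "T (\<lambda>y. F (x, y)) = rep_act W' g (T (\<lambda>y. F (\<beta> g x, y)))"
      using T(3)[OF g slF] by metis
    then show ?thesis
      using perm_repD(6)[OF W' g T(2)[OF slF] y] by (simp add: map_right_def)
  qed
  moreover have "map_right T F \<in> tensor_space (rep_space V) (rep_space W')"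
    using map_right_tensor[OF perm_repD(4)[OF V] perm_repD(4)[OF W] T(1,2) Ft] .
  ultimately show ?thesis using fixed_tensor_iff[OF V W'] by blast
qed

lemma inner_on_zero_conj_closed:
  assumes "finite P" "f \<in> funs_on P" "conj_fun f \<in> V" "\<And>v. v \<in> V \<Longrightarrow> (\<Sum>x\<in>P. v x * f x) = 0"
  shows "f = 0"
proof (rule inner_on_self_eq_0[OF assms(1,2)])
  show "inner_on P f f = 0" using assms(4)[OF assms(3)] by (simp add: inner_on_def conj_fun_def mult.commute)
qed

text \<open>Schur's lemma: contraction with an invariant tensor is an equivariant map \<open>V \<rightarrow> U\<close>.\<close>

lemma fixed_tensor_hom_iso:
  assumes G: "group G" "finite (carrier G)" and V: "absolutely_simple G V P \<beta>"
    and U: "perm_rep G U Q \<gamma>" and irr: "irreducible_rep G U"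
    and F: "F \<in> fixed_space G (tensor_rep V U)" "F \<noteq> 0"
  shows "rep_iso G V U"
proof -
  note Vp = absolutely_simpleD[OF V]
  note sV = perm_repD(4)[OF Vp(1)] and sU = perm_repD(4)[OF U]
  note finP = perm_repD(2)[OF Vp(1)]
  have Ft: "F \<in> tensor_space (rep_space V) (rep_space U)"
    and Fi: "\<And>g x y. g \<in> carrier G \<Longrightarrow> x \<in> P \<Longrightarrow> y \<in> Q \<Longrightarrow> F (\<beta> g x, \<gamma> g y) = F (x, y)"
    using F fixed_tensor_iff[OF Vp(1) U] by auto
  note sl = tensor_slice[OF sV sU Ft]
  define T where "T = (\<lambda>v. \<Sum>x\<in>P. cscale (v x) (\<lambda>y. F (x, y)))"
  have T_app: "T v y = (\<Sum>x\<in>P. v x * F (x, y))" for v y by (simp add: T_def fun_app)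
  have TU: "T v \<in> rep_space U" for v
    unfolding T_def using sl(1) by (intro cfun.subspace_sum[OF sU] cfun.subspace_scale[OF sU]) auto
  have lin: "T (v + w) = T v + T w" "T (cscale c v) = cscale c (T v)" for v w c
    by (auto simp: fun_eq_iff T_app fun_app algebra_simps sum.distrib sum_distrib_left)
  then have linV: "linear_on (rep_space V) T" by (simp add: linear_on_def)
  have T0: "T 0 = 0" by (simp add: fun_eq_iff T_app fun_app)
  have equi: "T (rep_act V g v) = rep_act U g (T v)" if g: "g \<in> carrier G" and v: "v \<in> rep_space V" for g v
  proof
    fix y
    show "T (rep_act V g v) y = rep_act U g (T v) y"
    proof (cases "y \<in> Q")
      case True
      have "T (rep_act V g v) y = (\<Sum>x\<in>P. v (\<beta> g x) * F (\<beta> g x, \<gamma> g y))"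
        unfolding T_app using perm_repD(6)[OF Vp(1) g v] Fi[OF g _ True] by (intro sum.cong) auto
      also have "\<dots> = T v (\<gamma> g y)"
        unfolding T_app
        using sum.reindex_bij_betw[OF perm_repD(5)[OF Vp(1) g], of "\<lambda>x. v x * F (x, \<gamma> g y)"] .
      finally show ?thesis using perm_repD(6)[OF U g TU True] by simp
    next
      case False
      then show ?thesis
        using perm_repD(7)[OF U TU] perm_repD(7)[OF U is_repD(2)[OF perm_repD(1)[OF U] g TU]] by simp
    qed
  qed
  define N where "N = {v\<in>rep_space V. T v = 0}"
  have N_sub: "cfun.subspace N"
    unfolding N_def using lin T0
    by (auto intro!: cfun.subspaceI cfun.subspace_0[OF sV] cfun.subspace_add[OF sV]
        cfun.subspace_scale[OF sV])
  have U0: "rep_act U g 0 = 0" if "g \<in> carrier G" for g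
    using linear_on_zero is_repD(1,3)[OF perm_repD(1)[OF U]] that by blast
  have "is_rep G (subrep V N)"
    using is_rep_subrep_iff[OF perm_repD(1)[OF Vp(1)], of N] N_sub equi U0
      is_repD(2)[OF perm_repD(1)[OF Vp(1)]] by (auto simp: N_def)
  then have "N = {0} \<or> N = rep_space V"
    using absolutely_simple_irreducible[OF G V] by (auto simp: irreducible_rep_def N_def)
  moreover have "N \<noteq> rep_space V"
  proof
    assume "N = rep_space V"
    then have z: "T v = 0" if "v \<in> rep_space V" for v using that by (auto simp: N_def)
    have "(\<lambda>x. F (x, y)) = 0" for y
    proof (rule inner_on_zero_conj_closed[OF finP])
      show "(\<lambda>x. F (x, y)) \<in> funs_on P" using sl(2) perm_repD(3)[OF Vp(1)] by blast
      show "conj_fun (\<lambda>x. F (x, y)) \<in> rep_space V" using Vp(2)[OF sl(2)] .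
      show "(\<Sum>x\<in>P. v x * F (x, y)) = 0" if "v \<in> rep_space V" for v
        using z[OF that] by (metis T_app zero_fun_apply)
    qed
    then have "F = 0" by (auto simp: fun_eq_iff fun_app)
    then show False using F by simp
  qed
  ultimately have N0: "N = {0}" by blast
  have inj: "inj_on T (rep_space V)"
  proof (rule inj_onI)
    fix v w assume vw: "v \<in> rep_space V" "w \<in> rep_space V" "T v = T w"
    have "T (v - w) = 0"
      using lin(1)[of "v - w" w] vw(3) by simp
    then have "v - w \<in> N" using vw cfun.subspace_diff[OF sV] by (auto simp: N_def)
    then show "v = w" using N0 by simp
  qed
  define I where "I = T ` rep_space V"
  have IU: "I \<subseteq> rep_space U" using TU by (auto simp: I_def)
  have "is_rep G (subrep U I)"
  proof -
    have "cfun.subspace I"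
    proof (rule cfun.subspaceI)
      show "0 \<in> I" unfolding I_def using T0 cfun.subspace_0[OF sV] by (metis imageI)
      show "x + y \<in> I" if "x \<in> I" "y \<in> I" for x y
        using that unfolding I_def by (auto simp flip: lin intro!: imageI cfun.subspace_add[OF sV])
      show "cscale c x \<in> I" if "x \<in> I" for c x
        using that unfolding I_def by (auto simp flip: lin intro!: imageI cfun.subspace_scale[OF sV])
    qed
    moreover have "rep_act U g x \<in> I" if "g \<in> carrier G" "x \<in> I" for g x
    proof -
      obtain v where v: "v \<in> rep_space V" "x = T v" using \<open>x \<in> I\<close> by (auto simp: I_def)
      show ?thesis
        unfolding v(2) equi[OF that(1) v(1), symmetric] I_def
        by (rule imageI[OF is_repD(2)[OF perm_repD(1)[OF Vp(1)] that(1) v(1)]])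
    qed
    ultimately show ?thesis using is_rep_subrep_iff[OF perm_repD(1)[OF U], of I] IU by blast
  qed
  then have "I = {0} \<or> I = rep_space U"
    using irr IU by (simp add: irreducible_rep_def)
  moreover have "I \<noteq> {0}"
  proof
    assume "I = {0}"
    then have "N = rep_space V" by (auto simp: I_def N_def)
    then show False using N0 Vp(3) by simp
  qed
  ultimately have "bij_betw T (rep_space V) (rep_space U)"
    using inj by (simp add: bij_betw_def I_def)
  then show ?thesis unfolding rep_iso_def using linV equi by blast
qed

lemma fixed_tensor_iso_generator:
  assumes G: "group G" "finite (carrier G)" and V: "absolutely_simple G V P \<beta>"
    and U: "perm_rep G U Q \<gamma>" and iso: "rep_iso G V U"
  obtains K where "K \<noteq> 0" "fixed_space G (tensor_rep V U) = cfun.span {K}"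
proof -
  note Vp = absolutely_simpleD[OF V]
  note sV = perm_repD(4)[OF Vp(1)] and sU = perm_repD(4)[OF U]
  obtain T where T: "linear_on (rep_space V) T" "bij_betw T (rep_space V) (rep_space U)"
    "\<And>g v. g \<in> carrier G \<Longrightarrow> v \<in> rep_space V \<Longrightarrow> T (rep_act V g v) = rep_act U g (T v)"
    using iso by (auto simp: rep_iso_def)
  define S where "S = the_inv_into (rep_space V) T"
  have inj: "inj_on T (rep_space V)" using T(2) by (simp add: bij_betw_def)
  have TU: "T v \<in> rep_space U" if "v \<in> rep_space V" for v using bij_betwE[OF T(2)] that by blast
  have ST: "S (T v) = v" if "v \<in> rep_space V" for v
    unfolding S_def using the_inv_into_f_f[OF inj that] .
  have SV: "S u \<in> rep_space V" "T (S u) = u" if "u \<in> rep_space U" for u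
  proof -
    have "u \<in> T ` rep_space V" using that bij_betw_imp_surj_on[OF T(2)] by (simp only:)
    then obtain v where v: "u = T v" "v \<in> rep_space V" by (rule imageE)
    show "S u \<in> rep_space V" "T (S u) = u" by (simp_all only: v(1) ST[OF v(2)] v(2))
  qed
  have S: "linear_on (rep_space U) S"
    unfolding linear_on_def
  proof (intro conjI ballI allI)
    fix v w assume vw: "v \<in> rep_space U" "w \<in> rep_space U"
    have "v + w = T (S v + S w)"
      by (simp only: linear_onD(1)[OF T(1) SV(1)[OF vw(1)] SV(1)[OF vw(2)]] SV(2)[OF vw(1)] SV(2)[OF vw(2)])
    then show "S (v + w) = S v + S w"
      by (simp only: ST[OF cfun.subspace_add[OF sV SV(1)[OF vw(1)] SV(1)[OF vw(2)]]])
  next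
    fix c v assume v: "v \<in> rep_space U"
    have "cscale c v = T (cscale c (S v))"
      by (simp only: linear_onD(2)[OF T(1) SV(1)[OF v]] SV(2)[OF v])
    then show "S (cscale c v) = cscale c (S v)"
      by (simp only: ST[OF cfun.subspace_scale[OF sV SV(1)[OF v]]])
  qed
  have S_equi: "S (rep_act U g u) = rep_act V g (S u)" if "g \<in> carrier G" "u \<in> rep_space U" for g u
  proof -
    have "rep_act U g u = T (rep_act V g (S u))"
      by (simp only: T(3)[OF that(1) SV(1)[OF that(2)]] SV(2)[OF that(2)])
    then show ?thesis
      by (simp only: ST[OF is_repD(2)[OF perm_repD(1)[OF Vp(1)] that(1) SV(1)[OF that(2)]]])
  qed
  obtain K where K: "K \<noteq> 0" "fixed_space G (tensor_rep V V) = cfun.span {K}"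
    using absolutely_simple_generator[OF G V] .
  have Kfix: "K \<in> fixed_space G (tensor_rep V V)" by (simp add: K cfun.span_base)
  have slice: "(\<lambda>y. F (x, y)) \<in> rep_space W" if "F \<in> fixed_space G (tensor_rep V W)"
    "cfun.subspace (rep_space W)" for F W x
    using that tensor_slice(1)[OF sV] by (auto simp: fixed_space_def)
  have map_c: "map_right T (cscale c K) = cscale c (map_right T K)" for c
  proof -
    have "T (\<lambda>y. cscale c K (x, y)) = cscale c (T (\<lambda>y. K (x, y)))" for x
      using linear_onD(2)[OF T(1) slice[OF Kfix sV], of c x] by (simp add: cscale_def)
    then show ?thesis by (auto simp: map_right_def fun_eq_iff fun_app)
  qed
  have fixed: "map_right T K \<in> fixed_space G (tensor_rep V U)"
    by (rule map_right_fixed[OF Vp(1) Vp(1) U T(1) TU T(3) Kfix])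
  have "map_right T K \<noteq> 0"
  proof
    assume z: "map_right T K = 0"
    have "(\<lambda>y. K (x, y)) = 0" for x
    proof -
      have "T (\<lambda>y. K (x, y)) = 0"
        unfolding map_right_slice[symmetric] z by (simp add: fun_eq_iff fun_app)
      then show ?thesis
        using ST[OF slice[OF Kfix sV]] ST[OF cfun.subspace_0[OF sV]] linear_on_zero[OF T(1) sV] by metis
    qed
    then have "K = 0" by (auto simp: fun_eq_iff fun_app)
    then show False using K by simp
  qed
  moreover have "fixed_space G (tensor_rep V U) \<subseteq> cfun.span {map_right T K}"
  proof
    fix F assume F: "F \<in> fixed_space G (tensor_rep V U)"
    have "map_right S F \<in> fixed_space G (tensor_rep V V)"
      by (rule map_right_fixed[OF Vp(1) U Vp(1) S SV(1) S_equi F])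
    then obtain c where c: "map_right S F = cscale c K" by (auto simp: K cfun.span_singleton)
    have "F = map_right T (map_right S F)"
      using SV(2)[OF slice[OF F sU]] by (auto simp: map_right_def)
    then show "F \<in> cfun.span {map_right T K}" by (auto simp: c map_c cfun.span_singleton)
  qed
  moreover have "cfun.span {map_right T K} \<subseteq> fixed_space G (tensor_rep V U)"
    using fixed subspace_fixed_space[OF perm_repD(1)[OF perm_rep_tensor[OF G(1) Vp(1) U]]]
    by (intro cfun.span_minimal) auto
  ultimately show ?thesis using that by blast
qed

section \<open>Multiplicities as dimensions of invariants\<close>

text \<open>The projection to the \<open>i\<close>-th summand of an internal direct sum.\<close>

definition component ::
  "nat \<Rightarrow> (nat \<Rightarrow> ('x \<Rightarrow> complex) set) \<Rightarrow> nat \<Rightarrow> ('x \<Rightarrow> complex) \<Rightarrow> 'x \<Rightarrow> complex"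
  where "component k U i w = the_inv_into (\<Pi>\<^sub>E i\<in>{..<k}. U i) (\<lambda>u. \<Sum>i<k. u i) w i"

context
  fixes G :: "('g, 'm) monoid_scheme" and W :: "('g, 'x) rep" and k U
  assumes W: "is_rep G W" and dec: "irreducible_decomposition G W k U"
begin

lemma dec_bij: "bij_betw (\<lambda>u. \<Sum>i<k. u i) (\<Pi>\<^sub>E i\<in>{..<k}. U i) (rep_space W)"
  using dec by (simp add: irreducible_decomposition_def)

lemma summand_rep: "i < k \<Longrightarrow> is_rep G (subrep W (U i))"
  using dec by (simp add: irreducible_decomposition_def irreducible_rep_def)

lemma summand_subspace: "i < k \<Longrightarrow> cfun.subspace (U i)"
  using is_repD(1)[OF summand_rep] by simp

lemma component_in: "w \<in> rep_space W \<Longrightarrow> i < k \<Longrightarrow> component k U i w \<in> U i"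
  and sum_component: "w \<in> rep_space W \<Longrightarrow> (\<Sum>i<k. component k U i w) = w"
proof -
  assume w: "w \<in> rep_space W"
  have "the_inv_into (\<Pi>\<^sub>E i\<in>{..<k}. U i) (\<lambda>u. \<Sum>i<k. u i) w \<in> (\<Pi>\<^sub>E i\<in>{..<k}. U i)"
    using bij_betwE[OF bij_betw_the_inv_into[OF dec_bij]] w by blast
  then show "i < k \<Longrightarrow> component k U i w \<in> U i" by (auto simp: component_def PiE_iff)
  show "(\<Sum>i<k. component k U i w) = w"
    unfolding component_def using f_the_inv_into_f_bij_betw[OF dec_bij] w by blast
qed

lemma component_unique:
  assumes "\<And>i. i < k \<Longrightarrow> u i \<in> U i" "i < k"
  shows "component k U i (\<Sum>i<k. u i) = u i"
proof -
  have r: "restrict u {..<k} \<in> (\<Pi>\<^sub>E i\<in>{..<k}. U i)" using assms by auto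
  have "inj_on (\<lambda>u. \<Sum>i<k. u i) (\<Pi>\<^sub>E i\<in>{..<k}. U i)" using dec_bij by (simp add: bij_betw_def)
  from the_inv_into_f_f[OF this r]
  have "the_inv_into (\<Pi>\<^sub>E i\<in>{..<k}. U i) (\<lambda>u. \<Sum>i<k. u i) (\<Sum>i<k. u i) = restrict u {..<k}" by simp
  then show ?thesis using assms(2) by (simp add: component_def)
qed

lemma summand_subset: assumes "i < k" shows "U i \<subseteq> rep_space W"
proof
  fix u assume u: "u \<in> U i"
  let ?v = "\<lambda>j. if j < k then if j = i then u else 0 else undefined"
  have "?v \<in> (\<Pi>\<^sub>E i\<in>{..<k}. U i)"
    using u assms cfun.subspace_0[OF summand_subspace] by (auto simp: PiE_iff extensional_def)
  then have "(\<Sum>j<k. ?v j) \<in> rep_space W" using bij_betwE[OF dec_bij] by blast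
  moreover have "(\<Sum>j<k. ?v j) = (\<Sum>j<k. if j = i then u else 0)" by (intro sum.cong) auto
  moreover have "\<dots> = u" using assms by simp
  ultimately show "u \<in> rep_space W" by simp
qed

lemma component_linear:
  assumes "i < k"
  shows "linear_on (rep_space W) (component k U i)"
  unfolding linear_on_def
proof (intro conjI ballI allI)
  fix v w assume v: "v \<in> rep_space W" and w: "w \<in> rep_space W"
  have "component k U i (\<Sum>i<k. component k U i v + component k U i w)
      = component k U i v + component k U i w"
    using cfun.subspace_add[OF summand_subspace] component_in v w assms
    by (intro component_unique) auto
  then show "component k U i (v + w) = component k U i v + component k U i w"
    by (simp add: sum.distrib sum_component v w)
next
  fix c v assume v: "v \<in> rep_space W"
  have "component k U i (\<Sum>i<k. cscale c (component k U i v)) = cscale c (component k U i v)"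
    using cfun.subspace_scale[OF summand_subspace] component_in v assms
    by (intro component_unique) auto
  then show "component k U i (cscale c v) = cscale c (component k U i v)"
    by (simp add: cfun.scale_sum_right[symmetric] sum_component v)
qed

lemma component_equivariant:
  assumes "i < k" "g \<in> carrier G" and w: "w \<in> rep_space W"
  shows "component k U i (rep_act W g w) = rep_act (subrep W (U i)) g (component k U i w)"
proof -
  have in_U: "rep_act W g (component k U j w) \<in> U j" if "j < k" for j
    using is_repD(2)[OF summand_rep[OF that] assms(2)] component_in[OF w that] by simp
  have "rep_act W g w = rep_act W g (\<Sum>i<k. component k U i w)" by (simp add: sum_component w)
  also have "\<dots> = (\<Sum>i<k. rep_act W g (component k U i w))"
    using component_in[OF w] summand_subset
    by (intro linear_on_sum[OF is_repD(3,1)[OF W]]) (use assms in auto)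
  finally show ?thesis using component_unique[of "\<lambda>j. rep_act W g (component k U j w)"] in_U assms(1) by simp
qed

end

text \<open>Each summand isomorphic to \<open>V\<close> contributes a line of invariants, each other summand contributes
  nothing, and the invariants of \<open>V \<otimes> W\<close> are the direct sum of these contributions.\<close>

lemma card_isomorphic_summands:
  fixes V :: "('g, 'x) rep" and W :: "('g, 'y) rep"
  assumes G: "group G" "finite (carrier G)" and V: "absolutely_simple G V P \<beta>"
    and W: "perm_rep G W Q \<gamma>" and dec: "irreducible_decomposition G W k U"
  shows "card {i. i < k \<and> rep_iso G V (subrep W (U i))} = cfun.dim (fixed_space G (tensor_rep V W))"
proof -
  note Vp = absolutely_simpleD[OF V] and rW = perm_repD(1)[OF W]
  note sV = perm_repD(4)[OF Vp(1)] and sW = perm_repD(4)[OF W]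
  define I where "I = {i. i < k \<and> rep_iso G V (subrep W (U i))}"
  have finI: "finite I" by (simp add: I_def)
  have Up: "perm_rep G (subrep W (U i)) Q \<gamma>" if "i < k" for i
    using perm_rep_subrep[OF W summand_subset[OF rW dec that] summand_rep[OF rW dec that]] .
  have irr: "irreducible_rep G (subrep W (U i))" if "i < k" for i
    using dec that by (simp add: irreducible_decomposition_def)
  have "\<forall>i. i \<in> I \<longrightarrow> (\<exists>K. K \<noteq> 0 \<and> fixed_space G (tensor_rep V (subrep W (U i))) = cfun.span {K})"
    using fixed_tensor_iso_generator[OF G V Up] by (metis (mono_tags, lifting) I_def mem_Collect_eq)
  then obtain K where K: "\<And>i. i \<in> I \<Longrightarrow> K i \<noteq> 0"
    "\<And>i. i \<in> I \<Longrightarrow> fixed_space G (tensor_rep V (subrep W (U i))) = cfun.span {K i}" by metis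
  have none: "F = 0" if "i < k" "i \<notin> I" "F \<in> fixed_space G (tensor_rep V (subrep W (U i)))" for i F
    using fixed_tensor_hom_iso[OF G V Up irr that(3)] that(1,2) by (auto simp: I_def)
  have Kfix: "K i \<in> fixed_space G (tensor_rep V (subrep W (U i)))" if "i \<in> I" for i
    using K(2)[OF that] by (simp add: cfun.span_base)
  have Kslice: "(\<lambda>y. K i (x, y)) \<in> U i" if "i \<in> I" for i x
    using tensor_slice(1)[OF sV, of "U i" "K i" x] Kfix[OF that] summand_subspace[OF rW dec] that
    by (auto simp: fixed_space_def I_def)
  have incl: "K i \<in> fixed_space G (tensor_rep V W)" if "i \<in> I" for i
  proof -
    have "tensor_space (rep_space V) (U i) \<subseteq> tensor_space (rep_space V) (rep_space W)"
      unfolding tensor_space_def using summand_subset[OF rW dec, of i] that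
      by (intro cfun.span_mono) (auto simp: I_def)
    then show ?thesis using Kfix[OF that] by (auto simp: fixed_space_def)
  qed
  have indep: "c j = 0" if z: "(\<Sum>i\<in>I. cscale (c i) (K i)) = 0" and j: "j \<in> I" for c j
  proof -
    have jk: "j < k" using j by (simp add: I_def)
    have "cscale (c j) (\<lambda>y. K j (x, y)) = 0" for x
    proof -
      define u where "u = (\<lambda>i. if i \<in> I then cscale (c i) (\<lambda>y. K i (x, y)) else 0)"
      have uU: "u i \<in> U i" if "i < k" for i
        using that Kslice cfun.subspace_0[OF summand_subspace[OF rW dec that]]
          cfun.subspace_scale[OF summand_subspace[OF rW dec that]] by (simp add: u_def)
      have "(\<Sum>i<k. u i) = (\<Sum>i\<in>I. cscale (c i) (\<lambda>y. K i (x, y)))"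
        unfolding u_def by (intro sum.mono_neutral_cong_right) (auto simp: I_def)
      also have "\<dots> = 0"
      proof
        fix y
        show "(\<Sum>i\<in>I. cscale (c i) (\<lambda>y. K i (x, y))) y = 0 y"
          using fun_cong[OF z, of "(x, y)"] by (simp add: fun_app)
      qed
      finally have "(\<Sum>i<k. u i) = (\<Sum>i<k. 0)" by simp
      then have "component k U j (\<Sum>i<k. u i) = component k U j (\<Sum>i<k. 0)" by (simp only:)
      then have "u j = 0"
        using component_unique[OF rW dec uU jk] component_unique[OF rW dec _ jk, of "\<lambda>_. 0"]
          cfun.subspace_0[OF summand_subspace[OF rW dec]] by simp
      then show ?thesis using j by (simp add: u_def)
    qed
    then have "cscale (c j) (K j) (x, y) = 0" for x y
      by (metis cscale_apply zero_fun_apply)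
    then have "cscale (c j) (K j) = 0" by (auto simp: fun_eq_iff zero_fun_apply)
    then show ?thesis using K(1)[OF j] by simp
  qed
  have injK: "inj_on K I"
  proof (rule inj_onI, rule ccontr)
    fix i j assume ij: "i \<in> I" "j \<in> I" "K i = K j" "i \<noteq> j"
    define c :: "nat \<Rightarrow> complex" where "c = (\<lambda>l. if l = i then 1 else if l = j then -1 else 0)"
    have "(\<Sum>l\<in>I. cscale (c l) (K l)) = (\<Sum>l\<in>{i, j}. cscale (c l) (K l))"
      using ij finI by (intro sum.mono_neutral_right) (auto simp: c_def)
    also have "\<dots> = 0" using ij by (simp add: c_def)
    finally show False using indep[of c i] ij by (simp add: c_def)
  qed
  have "cfun.independent (K ` I)"
  proof (rule cfun.independent_if_scalars_zero)
    fix f x assume "(\<Sum>x\<in>K ` I. cscale (f x) x) = 0" "x \<in> K ` I"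
    then show "f x = 0"
      using indep[of "\<lambda>i. f (K i)"] by (auto simp: sum.reindex[OF injK])
  qed (simp add: finI)
  moreover have "fixed_space G (tensor_rep V W) \<subseteq> cfun.span (K ` I)"
  proof
    fix F assume F: "F \<in> fixed_space G (tensor_rep V W)"
    have sl: "(\<lambda>y. F (x, y)) \<in> rep_space W" for x
      using tensor_slice(1)[OF sV sW] F by (auto simp: fixed_space_def)
    have comp: "map_right (component k U i) F \<in> fixed_space G (tensor_rep V (subrep W (U i)))" if i: "i < k" for i
      by (rule map_right_fixed[OF Vp(1) W Up[OF i] component_linear[OF rW dec i] _ _ F])
        (use component_in[OF rW dec _ i] component_equivariant[OF rW dec i] in auto)
    have "F = (\<Sum>i<k. map_right (component k U i) F)"
    proof
      fix p :: "'x \<times> 'y"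
      obtain x y where p: "p = (x, y)" by fastforce
      show "F p = (\<Sum>i<k. map_right (component k U i) F) p"
        using fun_cong[OF sum_component[OF rW dec sl[of x]], of y]
        by (simp add: p fun_app map_right_def)
    qed
    moreover have "map_right (component k U i) F \<in> cfun.span (K ` I)" if i: "i < k" for i
    proof (cases "i \<in> I")
      case True
      then have "map_right (component k U i) F \<in> cfun.span {K i}" using comp[OF i] K(2) by blast
      moreover have "cfun.span {K i} \<subseteq> cfun.span (K ` I)" using True by (intro cfun.span_mono) auto
      ultimately show ?thesis by blast
    next
      case False
      then show ?thesis using none[OF i _ comp[OF i]] by (simp add: cfun.span_zero)
    qed
    ultimately show "F \<in> cfun.span (K ` I)"
      by (metis (no_types, lifting) cfun.span_sum lessThan_iff)
  qed
  moreover have "K ` I \<subseteq> fixed_space G (tensor_rep V W)" using incl by blast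
  ultimately have "card (K ` I) = cfun.dim (fixed_space G (tensor_rep V W))"
    using cfun.basis_card_eq_dim by blast
  then show ?thesis using card_image[OF injK] by (simp add: I_def)
qed

theorem multiplicity_eq_dim_fixed:
  assumes G: "group G" "finite (carrier G)" and V: "absolutely_simple G V P \<beta>" and W: "perm_rep G W Q \<gamma>"
  shows "multiplicity_rep G V W = cfun.dim (fixed_space G (tensor_rep V W))"
  unfolding multiplicity_rep_def
  by (rule the_equality)
    (use irreducible_decomposition_exists[OF G(1) W] card_isomorphic_summands[OF G V W] in metis)+

section \<open>Tabloids\<close>

abbreviation tab_act :: "(nat \<Rightarrow> nat) \<Rightarrow> nat set list \<Rightarrow> nat set list"
  where "tab_act p \<equiv> map (image p)"

lemma tab_act_comp: "tab_act p (tab_act q T) = tab_act (p \<circ> q) T"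
  by (simp add: image_comp)

lemma tab_act_cong: "(\<And>x. x \<in> \<Union>(set T) \<Longrightarrow> p x = q x) \<Longrightarrow> tab_act p T = tab_act q T"
  by (auto intro!: map_cong image_cong)

lemma tab_act_id [simp]: "tab_act id T = T"
  by simp

lemma tab_act_inv:
  assumes "p permutes S"
  shows "tab_act p (tab_act (inv' p) T) = T" "tab_act (inv' p) (tab_act p T) = T"
  by (simp_all only: tab_act_comp permutes_inv_o[OF assms] tab_act_id)

abbreviation tab_pull :: "(nat \<Rightarrow> nat) \<Rightarrow> nat set list \<Rightarrow> nat set list"
  where "tab_pull p \<equiv> map (vimage p)"

lemma map_vimage_eq:
  assumes "p permutes S"
  shows "map (vimage p) T = tab_act (inv' p) T"
  using bij_vimage_eq_inv_image[OF permutes_bij[OF assms]] by (auto intro: map_cong)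

lemma all_tab_pull_iff:
  "(\<forall>p\<in>carrier (sym_group n). R (tab_pull p)) \<longleftrightarrow> (\<forall>p. p permutes {1..n} \<longrightarrow> R (tab_act p))"
proof (intro iffI allI impI ballI)
  have e: "tab_pull p = tab_act (inv' p)" if "p permutes {1..n}" for p
    using map_vimage_eq[OF that] by (rule ext)
  {
    fix p assume R: "\<forall>g\<in>carrier (sym_group n). R (tab_pull g)" and p: "p permutes {1..n}"
    have "R (tab_pull (inv' p))" using R permutes_inv[OF p] by (simp add: sym_group_def)
    then show "R (tab_act p)"
      by (simp only: e[OF permutes_inv[OF p]] inv_inv_eq[OF permutes_bij[OF p]])
  next
    fix g assume R: "\<forall>p. p permutes {1..n} \<longrightarrow> R (tab_act p)" and g: "g \<in> carrier (sym_group n)"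
    then have g: "g permutes {1..n}" by (simp add: sym_group_def)
    show "R (tab_pull g)" using R permutes_inv[OF g] by (simp only: e[OF g])
  }
qed

text \<open>The tabloids of shape \<open>d\<close> on the entries \<open>Z\<close>, defined by recursion on the rows because all inductions
  below split off the first row.\<close>

fun tabs_on :: "nat list \<Rightarrow> nat set \<Rightarrow> nat set list set" where
  "tabs_on [] Z = (if Z = {} then {[]} else {})"
| "tabs_on (r # d) Z = {R # T | R T. R \<subseteq> Z \<and> finite R \<and> card R = r \<and> T \<in> tabs_on d (Z - R)}"

abbreviation tabs :: "nat list \<Rightarrow> nat set list set"
  where "tabs d \<equiv> tabs_on d {1..sum_list d}"

lemma tabs_on_Union: "T \<in> tabs_on d Z \<Longrightarrow> \<Union>(set T) = Z"
proof (induction d arbitrary: Z T)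
  case (Cons r d)
  then obtain R T' where "T = R # T'" "R \<subseteq> Z" "T' \<in> tabs_on d (Z - R)" by auto
  then show ?case using Cons.IH[of T' "Z - R"] by auto
qed (auto split: if_splits)

lemma finite_tabs_on: "finite Z \<Longrightarrow> finite (tabs_on d Z)"
proof (induction d arbitrary: Z)
  case (Cons r d)
  have "tabs_on (r # d) Z \<subseteq> (\<Union>R\<in>Pow Z. (\<lambda>T. R # T) ` tabs_on d (Z - R))" by auto
  moreover have "finite (\<Union>R\<in>Pow Z. (\<lambda>T. R # T) ` tabs_on d (Z - R))"
    using Cons by (intro finite_UN_I) auto
  ultimately show ?case by (rule finite_subset)
qed simp

lemma tab_act_tabs_on:
  assumes "inj_on p Z" "T \<in> tabs_on d Z"
  shows "tab_act p T \<in> tabs_on d (p ` Z)"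
  using assms
proof (induction d arbitrary: Z T)
  case Nil
  then show ?case by (auto split: if_splits)
next
  case (Cons r d)
  then obtain R T' where T: "T = R # T'" "R \<subseteq> Z" "finite R" "card R = r" "T' \<in> tabs_on d (Z - R)"
    by auto
  have "tab_act p T' \<in> tabs_on d (p ` (Z - R))"
    using Cons.IH[OF _ T(5)] Cons.prems(1) by (meson Diff_subset inj_on_subset)
  moreover have "p ` (Z - R) = p ` Z - p ` R"
    using inj_on_image_set_diff[OF Cons.prems(1), of Z R] T(2) by blast
  moreover have "card (p ` R) = r"
    using T Cons.prems(1) by (metis card_image inj_on_subset)
  ultimately show ?case using T by auto
qed

lemma tab_act_tabs_on_permutes:
  assumes "p permutes Z"
  shows "tab_act p T \<in> tabs_on d Z \<longleftrightarrow> T \<in> tabs_on d Z"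
proof -
  have 1: "tab_act q S \<in> tabs_on d Z" if "q permutes Z" "S \<in> tabs_on d Z" for q S
    using tab_act_tabs_on[OF _ that(2), of q] permutes_inj_on[OF that(1)] permutes_image[OF that(1)]
    by metis
  show ?thesis
    using 1[OF assms, of T] 1[OF permutes_inv[OF assms], of "tab_act p T"] tab_act_inv(2)[OF assms]
    by auto
qed

lemma cells_Cons: "cells (r # d) = ({0} \<times> {..<r}) \<union> (\<lambda>(i, j). (Suc i, j)) ` cells d"
  by (auto simp: cells_def less_Suc_eq_0_disj nth_Cons image_iff split: nat.splits)

definition tail_tableau :: "(nat \<times> nat \<Rightarrow> nat) \<Rightarrow> nat \<times> nat \<Rightarrow> nat"
  where "tail_tableau t = (\<lambda>(i, j). t (Suc i, j))"

lemma tabloid_Cons: "tabloid (r # d) t = {t (0, j) | j. j < r} # tabloid d (tail_tableau t)"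
  by (simp add: tabloid_def tail_tableau_def map_upt_Suc del: upt_Suc)

lemma tabloid_comp: "tabloid d (p \<circ> t) = tab_act p (tabloid d t)"
  by (auto simp: tabloid_def)

lemma tail_tableau_bij:
  assumes "bij_betw t (cells (r # d)) Z"
  shows "bij_betw (tail_tableau t) (cells d) (Z - {t (0, j) | j. j < r})"
    "{t (0, j) | j. j < r} \<subseteq> Z" "card {t (0, j) | j. j < r} = r"
proof -
  have inj: "inj_on t (cells (r # d))" and im: "t ` cells (r # d) = Z"
    using assms by (auto simp: bij_betw_def)
  let ?f = "\<lambda>(i, j). (Suc i, j :: nat)"
  have R: "{t (0, j) | j. j < r} = t ` ({0} \<times> {..<r})" by auto
  have tl: "tail_tableau t = t \<circ> ?f" by (auto simp: tail_tableau_def)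
  have "inj_on t (?f ` cells d)" using inj by (rule inj_on_subset) (auto simp: cells_Cons)
  then have inj': "inj_on (tail_tableau t) (cells d)"
    unfolding tl by (intro comp_inj_on) (auto simp: inj_on_def)
  have "?f ` cells d = cells (r # d) - {0} \<times> {..<r}" by (auto simp: cells_Cons)
  moreover have "t ` (cells (r # d) - {0} \<times> {..<r}) = Z - t ` ({0} \<times> {..<r})"
    unfolding im[symmetric] by (rule inj_on_image_set_diff[OF inj]) (auto simp: cells_Cons)
  ultimately have "tail_tableau t ` cells d = Z - t ` ({0} \<times> {..<r})"
    unfolding tl image_comp[symmetric] by simp
  with inj' show "bij_betw (tail_tableau t) (cells d) (Z - {t (0, j) | j. j < r})"
    by (simp add: bij_betw_def R)
  show "{t (0, j) | j. j < r} \<subseteq> Z" using im by (auto simp: R cells_Cons)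
  have "inj_on t ({0} \<times> {..<r})" using inj by (rule inj_on_subset) (auto simp: cells_Cons)
  then show "card {t (0, j) | j. j < r} = r" by (simp add: R card_image)
qed

lemma tabloid_in_tabs_on: "bij_betw t (cells d) Z \<Longrightarrow> tabloid d t \<in> tabs_on d Z"
proof (induction d arbitrary: t Z)
  case Nil
  then show ?case by (auto simp: tabloid_def cells_def bij_betw_def)
next
  case (Cons r d)
  then show ?case
    using tail_tableau_bij[OF Cons.prems] Cons.IH[OF tail_tableau_bij(1)[OF Cons.prems]]
    by (auto simp: tabloid_Cons)
qed

lemma tableau_exists: "finite Z \<Longrightarrow> card Z = sum_list d \<Longrightarrow> \<exists>t. bij_betw t (cells d) Z"
proof -
  have "finite (cells d) \<and> card (cells d) = sum_list d"
  proof (induction d)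
    case (Cons r d)
    have "inj_on (\<lambda>(i, j). (Suc i, j :: nat)) (cells d)" by (auto simp: inj_on_def)
    then have "card ((\<lambda>(i, j). (Suc i, j)) ` cells d) = sum_list d" using Cons by (simp add: card_image)
    moreover have "({0} \<times> {..<r}) \<inter> (\<lambda>(i, j). (Suc i, j)) ` cells d = {}" by auto
    ultimately show ?case using Cons unfolding cells_Cons
      by (subst card_Un_disjoint) auto
  qed (auto simp: cells_def)
  then show "finite Z \<Longrightarrow> card Z = sum_list d \<Longrightarrow> \<exists>t. bij_betw t (cells d) Z"
    using finite_same_card_bij[of "cells d" Z] by auto
qed

lemma extend_to_permutation:
  assumes "finite S" "A \<subseteq> S" "inj_on f A" "f ` A \<subseteq> S"
  obtains p where "p permutes S" "\<And>x. x \<in> A \<Longrightarrow> p x = f x"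
proof -
  have "card (S - A) = card (S - f ` A)"
    using assms card_image[OF assms(3)] by (simp add: card_Diff_subset finite_subset)
  then obtain h where h: "bij_betw h (S - A) (S - f ` A)"
    using finite_same_card_bij[of "S - A" "S - f ` A"] assms(1) by auto
  define p where "p = (\<lambda>x. if x \<in> A then f x else if x \<in> S then h x else x)"
  have "bij_betw p A (f ` A)"
    by (subst bij_betw_cong[of A p f]) (use inj_on_imp_bij_betw[OF assms(3)] in \<open>simp_all add: p_def\<close>)
  moreover have "bij_betw p (S - A) (S - f ` A)"
    by (subst bij_betw_cong[of "S - A" p h]) (use h in \<open>simp_all add: p_def\<close>)
  ultimately have "bij_betw p (A \<union> (S - A)) (f ` A \<union> (S - f ` A))"
    by (rule bij_betw_combine) auto
  moreover have "A \<union> (S - A) = S" "f ` A \<union> (S - f ` A) = S" using assms by auto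
  ultimately have "p permutes S" using assms(2) by (intro bij_imp_permutes) (auto simp: p_def)
  then show ?thesis by (rule that) (simp add: p_def)
qed

section \<open>Specht modules inside tabloid functions\<close>

lemma specht_simps [simp]:
  "rep_space (specht d) = cfun.span {polytabloid d t | t. tableau d t}"
  "rep_act (specht d) p v T = v (map (vimage p) T)"
  by (simp_all add: specht_def)

lemma specht_act_eq: "rep_act (specht d) p v = v \<circ> map (vimage p)"
  by (auto simp: specht_def)

lemma finite_sym_group: "finite (carrier (sym_group n))"
  by (simp add: sym_group_def finite_permutations)

lemma perm_rep_tabloid_functions:
  assumes "cfun.subspace U" "U \<subseteq> funs_on (tabs d)"
    and "\<And>p v. p permutes {1..sum_list d} \<Longrightarrow> v \<in> U \<Longrightarrow> v \<circ> tab_act (inv' p) \<in> U"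
  shows "perm_rep (sym_group (sum_list d)) (subrep (specht d) U) (tabs d) (\<lambda>p. map (vimage p))"
proof -
  have inv: "rep_act (specht d) p v \<in> U" if "p permutes {1..sum_list d}" "v \<in> U" for p v
  proof -
    have "map (vimage p) = tab_act (inv' p)" using map_vimage_eq[OF that(1)] by (rule ext)
    then show ?thesis using assms(3)[OF that] by (simp only: specht_act_eq)
  qed
  have "is_rep (sym_group (sum_list d)) (subrep (specht d) U)"
    unfolding is_rep_def using assms(1) inv
    by (auto simp: sym_group_def linear_on_def fun_eq_iff fun_app vimage_comp comp_def)
  moreover have "bij_betw (map (vimage p)) (tabs d) (tabs d)" if p: "p permutes {1..sum_list d}" for p
  proof (rule bij_betw_byWitness[where f' = "tab_act p"])
    have e: "map (vimage p) T = tab_act (inv' p) T" for T by (rule map_vimage_eq[OF p])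
    show "\<forall>T\<in>tabs d. tab_act p (map (vimage p) T) = T" "\<forall>T\<in>tabs d. map (vimage p) (tab_act p T) = T"
      unfolding e by (simp_all only: tab_act_inv[OF p]) simp_all
    show "map (vimage p) ` tabs d \<subseteq> tabs d" "tab_act p ` tabs d \<subseteq> tabs d"
      unfolding e image_subset_iff
      using tab_act_tabs_on_permutes[OF p] tab_act_tabs_on_permutes[OF permutes_inv[OF p]] by blast+
  qed
  ultimately show ?thesis
    using assms(2) finite_tabs_on[of "{1..sum_list d}" d] by (auto simp: perm_rep_def sym_group_def)
qed

lemma column_stabilizer_permutes: "q \<in> column_stabilizer d t \<Longrightarrow> q permutes {1..sum_list d}"
  by (simp add: column_stabilizer_def sym_group_def)

lemma finite_column_stabilizer: "finite (column_stabilizer d t)"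
  unfolding column_stabilizer_def using finite_sym_group by (rule finite_subset[rotated]) auto

lemma tableau_comp: "p permutes {1..sum_list d} \<Longrightarrow> tableau d t \<Longrightarrow> tableau d (p \<circ> t)"
  unfolding tableau_def using bij_betw_trans permutes_imp_bij by blast

lemma polytabloid_funs_on: "tableau d t \<Longrightarrow> polytabloid d t \<in> funs_on (tabs d)"
  unfolding funs_on_def polytabloid_def
  using tabloid_in_tabs_on tableau_comp[OF column_stabilizer_permutes]
  by (fastforce simp: tableau_def intro!: sum.neutral)

lemma column_entries_comp: "column_entries d (p \<circ> t) j = p ` column_entries d t j"
  by (auto simp: column_entries_def)

text \<open>The column stabilizer of \<open>p \<circ> t\<close> is the conjugate by \<open>p\<close> of that of \<open>t\<close>.\<close>

lemma polytabloid_act: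
  assumes p: "p permutes {1..sum_list d}" and t: "tableau d t"
  shows "polytabloid d t \<circ> tab_act (inv' p) = polytabloid d (p \<circ> t)"
proof
  fix T
  have eq: "tab_act (inv' p) T = S \<longleftrightarrow> T = tab_act p S" for S
    using tab_act_inv[OF p] by metis
  note pinv = permutes_inv[OF p] permutes_inv_o[OF p]
  have conj: "a \<circ> q \<circ> b \<in> column_stabilizer d (a \<circ> s)"
    if "a permutes {1..sum_list d}" "b permutes {1..sum_list d}" "b \<circ> a = id" "q \<in> column_stabilizer d s" for a b q s
  proof -
    have "(a \<circ> q \<circ> b) ` (a ` column_entries d s j) = a ` column_entries d s j" for j
    proof -
      have "(a \<circ> q \<circ> b) ` (a ` column_entries d s j) = a ` q ` (b \<circ> a) ` column_entries d s j"
        by (simp only: image_comp comp_assoc)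
      then show ?thesis using that by (simp add: column_stabilizer_def)
    qed
    then show ?thesis
      using that column_stabilizer_permutes[OF that(4)]
      by (simp add: column_stabilizer_def column_entries_comp sym_group_def permutes_compose)
  qed
  have "(polytabloid d t \<circ> tab_act (inv' p)) T =
    (\<Sum>q\<in>column_stabilizer d t. of_int (sign q) * (if T = tabloid d (p \<circ> q \<circ> t) then 1 else 0))"
    unfolding polytabloid_def comp_apply eq tabloid_comp[symmetric] comp_assoc ..
  also have "\<dots> = (\<Sum>q\<in>column_stabilizer d (p \<circ> t).
      of_int (sign q) * (if T = tabloid d (q \<circ> (p \<circ> t)) then 1 else 0))"
  proof (rule sum.reindex_bij_witness[where i = "\<lambda>q. inv' p \<circ> q \<circ> p" and j = "\<lambda>q. p \<circ> q \<circ> inv' p"])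
    fix q assume q: "q \<in> column_stabilizer d t"
    show "p \<circ> q \<circ> inv' p \<in> column_stabilizer d (p \<circ> t)" using conj[OF p pinv(1) pinv(3) q] .
    show "inv' p \<circ> (p \<circ> q \<circ> inv' p) \<circ> p = q" using pinv(3) by (simp add: fun_eq_iff)
    have "permutation p" "permutation q" "permutation (inv' p)"
      using p column_stabilizer_permutes[OF q] pinv(1) by (auto simp: permutation_permutes)
    then have "sign (p \<circ> q \<circ> inv' p) = sign q"
      by (simp add: sign_compose permutation_compose sign_inverse sign_idempotent)
    moreover have "p \<circ> q \<circ> inv' p \<circ> (p \<circ> t) = p \<circ> q \<circ> t" using pinv(3) by (simp add: fun_eq_iff)
    ultimately show "of_int (sign (p \<circ> q \<circ> inv' p)) * (if T = tabloid d (p \<circ> q \<circ> inv' p \<circ> (p \<circ> t)) then 1 else 0) =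
      of_int (sign q) * (if T = tabloid d (p \<circ> q \<circ> t) then 1 else (0 :: complex))" by simp
  next
    fix q assume q: "q \<in> column_stabilizer d (p \<circ> t)"
    have "inv' p \<circ> (p \<circ> t) = t" using pinv(3) by (simp add: fun_eq_iff)
    then show "inv' p \<circ> q \<circ> p \<in> column_stabilizer d t" using conj[OF pinv(1) p pinv(2) q] by simp
    show "p \<circ> (inv' p \<circ> q \<circ> p) \<circ> inv' p = q" using pinv(2) by (simp add: fun_eq_iff)
  qed
  finally show "(polytabloid d t \<circ> tab_act (inv' p)) T = polytabloid d (p \<circ> t) T"
    by (simp add: polytabloid_def)
qed

lemma linear_act_span:
  assumes "\<And>b. b \<in> B \<Longrightarrow> b \<circ> f \<in> cfun.span B'" "v \<in> cfun.span B"
  shows "v \<circ> f \<in> cfun.span B'"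
proof -
  interpret l: module_hom cscale cscale "\<lambda>F. F \<circ> f"
    using linear_comp by (simp add: module_hom_iff_linear)
  have "(\<lambda>F. F \<circ> f) ` cfun.span B \<subseteq> cfun.span B'"
    unfolding l.span_image[symmetric] using assms(1) by (intro cfun.span_minimal) auto
  then show ?thesis using assms(2) by blast
qed

lemma perm_rep_specht: "perm_rep (sym_group (sum_list d)) (specht d) (tabs d) (\<lambda>p. map (vimage p))"
proof -
  have "perm_rep (sym_group (sum_list d)) (subrep (specht d) (rep_space (specht d))) (tabs d) (\<lambda>p. map (vimage p))"
  proof (rule perm_rep_tabloid_functions)
    show "rep_space (specht d) \<subseteq> funs_on (tabs d)"
      unfolding specht_simps using polytabloid_funs_on by (intro cfun.span_minimal subspace_funs_on) auto
    show "v \<circ> tab_act (inv' p) \<in> rep_space (specht d)"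
      if "p permutes {1..sum_list d}" "v \<in> rep_space (specht d)" for p v
      using that(2) unfolding specht_simps
      by (rule linear_act_span[rotated])
        (use polytabloid_act[OF that(1)] tableau_comp[OF that(1)] in \<open>auto intro!: cfun.span_base\<close>)
  qed simp
  then show ?thesis by (simp only: subrep_self)
qed

lemma specht_conj_closed:
  assumes "v \<in> rep_space (specht d)"
  shows "conj_fun v \<in> rep_space (specht d)"
  using assms unfolding specht_simps
proof (induction rule: cfun.span_induct_alt)
  case base
  have "conj_fun (0 :: nat set list \<Rightarrow> complex) = 0" by (simp add: conj_fun_def fun_eq_iff fun_app)
  then show ?case by (simp add: cfun.span_zero)
next
  case (step c x y)
  then obtain t where t: "x = polytabloid d t" "tableau d t" by auto
  have "conj_fun x = x" by (auto simp: t conj_fun_def polytabloid_def fun_eq_iff intro!: sum.cong)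
  then have "conj_fun (cscale c x + y) = cscale (cnj c) x + conj_fun y" by (auto simp: conj_fun_def fun_eq_iff fun_app)
  then show ?case using step by (auto intro: cfun.span_add cfun.span_scale cfun.span_base)
qed

text \<open>Only the identity preserves all rows and all columns of a tableau, so a polytabloid takes the value
  1 at its own tabloid.\<close>

lemma specht_nonzero: "rep_space (specht d) \<noteq> {0}"
proof -
  obtain t where t: "tableau d t"
    using tableau_exists[of "{1..sum_list d}" d] by (auto simp: tableau_def)
  have inj: "inj_on t (cells d)" and im: "t ` cells d = {1..sum_list d}"
    using t by (auto simp: tableau_def bij_betw_def)
  have only_id: "q = id" if q: "q \<in> column_stabilizer d t" "tabloid d t = tabloid d (q \<circ> t)" for q
  proof
    fix x
    show "q x = id x"
    proof (cases "x \<in> {1..sum_list d}")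
      case False
      then show ?thesis using column_stabilizer_permutes[OF q(1)] by (simp add: permutes_def)
    next
      case True
      then obtain i j where ij: "(i, j) \<in> cells d" "x = t (i, j)" using im by fastforce
      then have "i < length d" "j < d ! i" by (auto simp: cells_def)
      then have "{t (i, j) | j. j < d ! i} = {q (t (i, j)) | j. j < d ! i}"
        using arg_cong[OF q(2), of "\<lambda>T. T ! i"] by (simp add: tabloid_def)
      then obtain j' where j': "j' < d ! i" "q x = t (i, j')"
        using ij \<open>j < d ! i\<close> by blast
      have "q x \<in> column_entries d t j"
        using q(1) ij by (force simp: column_stabilizer_def column_entries_def)
      then obtain i' where i': "(i', j) \<in> cells d" "q x = t (i', j)" by (auto simp: column_entries_def)
      have "(i, j') \<in> cells d" using j' \<open>i < length d\<close> by (simp add: cells_def)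
      then have "(i, j') = (i', j)" using inj i' j' by (metis inj_onD)
      then show ?thesis using ij j' by simp
    qed
  qed
  have id_in: "id \<in> column_stabilizer d t" by (simp add: column_stabilizer_def sym_group_def permutes_id)
  have "polytabloid d t (tabloid d t) = (\<Sum>q\<in>{id}. of_int (sign q) * (if tabloid d t = tabloid d (q \<circ> t) then 1 else 0))"
    unfolding polytabloid_def
    using finite_column_stabilizer id_in only_id by (intro sum.mono_neutral_right) auto
  then have "polytabloid d t (tabloid d t) = 1" by (simp add: sign_id)
  then have "polytabloid d t \<noteq> 0" by (metis zero_fun_apply zero_neq_one)
  moreover have "polytabloid d t \<in> rep_space (specht d)" using t by (auto intro: cfun.span_base)
  ultimately show ?thesis by blast
qed

declare specht_simps(1) [simp del]

section \<open>Polytabloids are harmonic\<close>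

lemma tabs_on_disjoint_rows: "R # T \<in> tabs_on (r # d) Z \<Longrightarrow> S \<in> set T \<Longrightarrow> S \<inter> R = {}"
  using tabs_on_Union[of T d "Z - R"] by auto

lemma tabs_ConsE:
  assumes "T \<in> tabs_on (r # d) Z"
  obtains R T' where "T = R # T'" "R \<subseteq> Z" "finite R" "card R = r" "T' \<in> tabs_on d (Z - R)"
  using assms by auto

lemma transpose_image_swap: "a \<in> S \<Longrightarrow> b \<notin> S \<Longrightarrow> transpose a b ` S = insert b (S - {a})"
  by (auto simp: transpose_def image_iff)

lemma tab_act_transpose_fix:
  assumes "T \<in> tabs_on (r # d) Z" "i \<in> hd T" "x \<in> hd T"
  shows "tab_act (transpose i x) T = T"
proof -
  obtain R T' where T: "T = R # T'" using assms(1) by (rule tabs_ConsE)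
  have "transpose i x ` S = S" if "S \<in> set T" for S
    using that assms tabs_on_disjoint_rows[of R T' r d Z] by (intro transpose_image_eq) (auto simp: T)
  then show ?thesis by (simp add: map_idI)
qed

text \<open>On a row that contains both \<open>x\<close> and \<open>y\<close> the two sides differ as maps, but have the same image.\<close>

lemma tab_act_transpose_exchange:
  assumes T: "R # T' \<in> tabs_on (r # d) Z" and i: "i \<notin> R"
    and x: "x \<in> insert i R" and y: "y \<in> insert i R" and neq: "x \<noteq> y"
  shows "tab_act (transpose i y) (R # T') = tab_act (transpose x y) (tab_act (transpose i x) (R # T'))"
proof (cases "x = i \<or> y = i")
  case True
  then have "transpose i y = transpose x y \<circ> transpose i x"
    by (auto simp: fun_eq_iff transpose_def)
  then show ?thesis by (simp only: tab_act_comp)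
next
  case False
  then have xy: "x \<in> R" "y \<in> R" using x y by auto
  have "transpose i y ` R = insert i (R - {y})"
    using transpose_image_swap[of y R i] xy i by (simp add: transpose_commute)
  moreover have "transpose i x ` R = insert i (R - {x})"
    using transpose_image_swap[of x R i] xy i by (simp add: transpose_commute)
  moreover have "transpose x y ` insert i (R - {x}) = insert x (insert i (R - {x}) - {y})"
    using transpose_image_swap[of y "insert i (R - {x})" x] xy i neq by (auto simp: transpose_commute)
  moreover have "insert x (insert i (R - {x}) - {y}) = insert i (R - {y})" using xy i neq by auto
  ultimately have 1: "transpose i y ` R = transpose x y ` transpose i x ` R" by simp
  have 2: "transpose i y ` S = transpose x y ` transpose i x ` S" if "S \<in> set T'" for S
  proof -
    have "transpose i y z = transpose x y (transpose i x z)" if "z \<in> S" for z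
      using tabs_on_disjoint_rows[OF T \<open>S \<in> set T'\<close>] that xy by (auto simp: transpose_def)
    then show ?thesis unfolding image_image by (rule image_cong[OF refl])
  qed
  show ?thesis by (simp add: 1 2)
qed

text \<open>The conditions of James's kernel intersection theorem that concern moving a single entry into the
  first row.\<close>

definition harmonic :: "nat list \<Rightarrow> (nat set list \<Rightarrow> complex) \<Rightarrow> bool"
  where "harmonic d v \<longleftrightarrow> (\<forall>T\<in>tabs d. \<forall>i\<in>{1..sum_list d} - hd T.
     v T + (\<Sum>x\<in>hd T. v (tab_act (transpose i x) T)) = 0)"

lemma sum_sign_reversing_involution:
  fixes f :: "'a \<Rightarrow> complex"
  assumes "\<And>p. p \<in> D \<Longrightarrow> \<phi> p \<in> D" "\<And>p. p \<in> D \<Longrightarrow> \<phi> (\<phi> p) = p" "\<And>p. p \<in> D \<Longrightarrow> f (\<phi> p) = - f p"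
  shows "sum f D = 0"
proof -
  have "sum f D = (\<Sum>p\<in>D. - f p)"
    by (rule sum.reindex_bij_witness[where i = \<phi> and j = \<phi>]) (simp_all add: assms)
  then show ?thesis by (simp add: sum_negf)
qed

lemma young_diagram_tl: "young_diagram (r # d) \<Longrightarrow> young_diagram d"
  by (simp add: young_diagram_def)

lemma young_diagram_first_row_longest: "young_diagram (r # d) \<Longrightarrow> (i, j) \<in> cells (r # d) \<Longrightarrow> j < r"
  by (auto simp: young_diagram_def cells_def nth_Cons split: nat.splits dest!: nth_mem)

text \<open>The sum in question runs over the pairs of an entry \<open>x\<close> and a column permutation \<open>q\<close> such that
  exchanging \<open>i\<close> with \<open>x\<close> gives the tabloid of \<open>q \<circ> t\<close>; the term is the sign of \<open>q\<close>.  In \<open>q \<circ> t\<close> the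
  entry \<open>x\<close> is below the first row.  Let \<open>y\<close> be the entry at the top of its column.  Replacing \<open>x\<close> by
  \<open>y\<close> and \<open>q\<close> by \<open>(x y) \<circ> q\<close> is an involution on the pairs that reverses the sign.\<close>

lemma polytabloid_harmonic:
  assumes Y: "young_diagram (r # d)" and t: "tableau (r # d) t"
  shows "harmonic (r # d) (polytabloid (r # d) t)"
  unfolding harmonic_def
proof (intro ballI)
  let ?d = "r # d" and ?n = "sum_list (r # d)"
  fix T i assume T: "T \<in> tabs ?d" and i: "i \<in> {1..?n} - hd T"
  obtain R T' where TR: "T = R # T'" "R \<subseteq> {1..?n}" "finite R" using T by (rule tabs_ConsE)
  define A where "A = insert i R"
  define C where "C = column_stabilizer ?d t"
  define D where "D = {(x, q) \<in> A \<times> C. tab_act (transpose i x) T = tabloid ?d (q \<circ> t)}"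
  define col where "col = (\<lambda>x. snd (the_inv_into (cells ?d) t x))"
  define top where "top q x = (q (t (0, col x)) :: nat)" for q :: "nat \<Rightarrow> nat" and x
  define \<phi> where "\<phi> = (\<lambda>(x, q). (top q x, transpose x (top q x) \<circ> q))"
  have iR: "i \<notin> R" using i TR by simp
  have An: "A \<subseteq> {1..?n}" using i TR by (auto simp: A_def)
  have inj: "inj_on t (cells ?d)" and im: "t ` cells ?d = {1..?n}"
    using t by (auto simp: tableau_def bij_betw_def)
  have col: "col (t (s, j)) = j" if "(s, j) \<in> cells ?d" for s j
    using the_inv_into_f_f[OF inj that] by (simp add: col_def)
  have col_iff: "x \<in> column_entries ?d t j \<longleftrightarrow> x \<in> {1..?n} \<and> col x = j" for x j
  proof
    assume "x \<in> column_entries ?d t j"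
    then obtain i where i: "x = t (i, j)" "(i, j) \<in> cells ?d" by (auto simp: column_entries_def)
    then have "x \<in> t ` cells ?d" by (simp only: imageI)
    then show "x \<in> {1..?n} \<and> col x = j" unfolding im using col i by simp
  next
    assume x: "x \<in> {1..?n} \<and> col x = j"
    then have "x \<in> t ` cells ?d" unfolding im by simp
    then obtain i j' where i: "x = t (i, j')" "(i, j') \<in> cells ?d" by (metis imageE surj_pair)
    then have "j' = j" using col x by simp
    then show "x \<in> column_entries ?d t j" using i by (auto simp: column_entries_def)
  qed
  have finC: "finite C" unfolding C_def by (rule finite_column_stabilizer)
  have main: "top q x \<in> A" "top q x \<noteq> x" "transpose x (top q x) \<circ> q \<in> C" "col (top q x) = col x"
      "sign (transpose x (top q x) \<circ> q) = - sign q"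
      "tab_act (transpose i (top q x)) T = tabloid ?d (transpose x (top q x) \<circ> q \<circ> t)"
    if "(x, q) \<in> D" for x q
  proof -
    define y where "y = top q x"
    have x: "x \<in> A" and q: "q \<in> C" and eq: "tab_act (transpose i x) T = tabloid ?d (q \<circ> t)"
      using that by (auto simp: D_def)
    have qcol: "q ` column_entries ?d t j = column_entries ?d t j" for j
      using q by (simp add: C_def column_stabilizer_def)
    have q_perm: "q permutes {1..?n}" using column_stabilizer_permutes[of q ?d t] q by (simp add: C_def)
    define R0 where "R0 = transpose i x ` R"
    have R0: "R0 = {q (t (0, j)) | j. j < r}" using eq by (simp add: TR tabloid_Cons R0_def)
    have xR0: "x \<notin> R0"
      using x iR by (auto simp: R0_def A_def transpose_def)
    have R0A: "R0 \<subseteq> A" using x by (auto simp: R0_def A_def transpose_def)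
    have xn: "x \<in> {1..?n}" using x An by blast
    then have "x \<in> q ` column_entries ?d t (col x)" unfolding qcol by (simp add: col_iff)
    then obtain s where s: "(s, col x) \<in> cells ?d" "x = q (t (s, col x))"
      by (auto simp: column_entries_def)
    have jr: "col x < r" using young_diagram_first_row_longest[OF Y s(1)] .
    then have yR0: "y \<in> R0" unfolding R0 y_def top_def by blast
    then show "top q x \<in> A" using R0A by (auto simp: y_def)
    show neq: "top q x \<noteq> x" using yR0 xR0 by (auto simp: y_def)
    have "(0, col x) \<in> cells ?d" using jr by (simp add: cells_def)
    then have "t (0, col x) \<in> column_entries ?d t (col x)" by (auto simp: column_entries_def)
    then have "y \<in> column_entries ?d t (col x)"
      unfolding y_def top_def using qcol by blast
    then have y: "y \<in> {1..?n}" "col y = col x" by (auto simp: col_iff)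
    then show "col (top q x) = col x" by (simp add: y_def)
    have "transpose x y ` column_entries ?d t j = column_entries ?d t j" for j
      by (rule transpose_image_eq) (use y xn in \<open>auto simp: col_iff\<close>)
    then have "(transpose x y \<circ> q) ` column_entries ?d t j = column_entries ?d t j" for j
      using qcol by (simp only: image_comp[symmetric])
    moreover have "transpose x y \<circ> q permutes {1..?n}"
      using permutes_compose[OF q_perm permutes_swap_id[OF xn y(1)]] .
    ultimately show "transpose x (top q x) \<circ> q \<in> C"
      by (simp add: C_def column_stabilizer_def sym_group_def y_def)
    have "permutation q" using q_perm by (auto simp: permutation_permutes)
    then show "sign (transpose x (top q x) \<circ> q) = - sign q"
      using neq by (simp add: sign_compose permutation_swap_id sign_swap_id)
    have "tab_act (transpose i y) T = tab_act (transpose x y) (tab_act (transpose i x) T)"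
      unfolding TR(1)
      by (rule tab_act_transpose_exchange[OF T[unfolded TR(1)] iR])
        (use x yR0 R0A neq in \<open>auto simp: A_def y_def\<close>)
    also have "\<dots> = tabloid ?d (transpose x y \<circ> q \<circ> t)" unfolding eq tabloid_comp[symmetric] comp_assoc ..
    finally show "tab_act (transpose i (top q x)) T = tabloid ?d (transpose x (top q x) \<circ> q \<circ> t)"
      by (simp add: y_def)
  qed
  have "(\<Sum>p\<in>D. of_int (sign (snd p))) = (0 :: complex)"
  proof (rule sum_sign_reversing_involution)
    fix p assume "p \<in> D"
    then obtain x q where p: "p = (x, q)" "(x, q) \<in> D" by (cases p) auto
    note m = main[OF p(2)]
    show "\<phi> p \<in> D" using m by (simp add: p \<phi>_def D_def)
    have "top (transpose x (top q x) \<circ> q) (top q x) = x"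
    proof -
      have "q (t (0, col (top q x))) = top q x" using m(4) by (simp add: top_def)
      then have "(transpose x (top q x) \<circ> q) (t (0, col (top q x))) = x" by simp
      then show ?thesis by (simp only: top_def[of "transpose x (top q x) \<circ> q"])
    qed
    then show "\<phi> (\<phi> p) = p"
      by (simp add: p \<phi>_def comp_assoc[symmetric] transpose_commute[of "top q x" x])
    show "complex_of_int (sign (snd (\<phi> p))) = - of_int (sign (snd p))" using m(5) by (simp add: p \<phi>_def)
  qed
  also have "(\<Sum>p\<in>D. of_int (sign (snd p))) =
      (\<Sum>p\<in>A \<times> C. of_int (sign (snd p)) * (if tab_act (transpose i (fst p)) T = tabloid ?d (snd p \<circ> t) then 1 else (0 :: complex)))"
    using finC TR(3) unfolding D_def A_def by (intro sum.mono_neutral_cong_left) auto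
  also have "\<dots> = (\<Sum>x\<in>A. polytabloid ?d t (tab_act (transpose i x) T))"
    unfolding polytabloid_def C_def[symmetric] by (simp add: sum.cartesian_product case_prod_unfold)
  also have "\<dots> = polytabloid ?d t T + (\<Sum>x\<in>hd T. polytabloid ?d t (tab_act (transpose i x) T))"
    unfolding A_def using iR TR by simp
  finally show "polytabloid ?d t T + (\<Sum>x\<in>hd T. polytabloid ?d t (tab_act (transpose i x) T)) = 0" .
qed

section \<open>Slices of polytabloids\<close>

definition lift_row :: "nat \<Rightarrow> nat list \<Rightarrow> nat set list \<Rightarrow> nat set list"
  where "lift_row r d T = {Suc (sum_list d)..r + sum_list d} # T"

lemma lift_row_in_tabs: "lift_row r d T \<in> tabs (r # d) \<longleftrightarrow> T \<in> tabs d"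
proof -
  have "{1..r + sum_list d} - {Suc (sum_list d)..r + sum_list d} = {1..sum_list d}" by auto
  then show ?thesis by (auto simp: lift_row_def)
qed

declare tabs_on.simps(2) [simp del]

lemmas lift_row_in_tabs_simp [simp] = lift_row_in_tabs[simplified]

text \<open>Every tabloid is a translate of a lifted one; \<open>h\<close> may be any permutation that carries
  \<open>1, \<dots>, sum_list d\<close> to the lower entries.\<close>

lemma tabs_standard:
  assumes T: "T \<in> tabs (r # d)" and h: "h permutes {1..r + sum_list d}"
    and im: "h ` {1..sum_list d} = {1..r + sum_list d} - hd T"
  obtains T' where "T' \<in> tabs d" "T = tab_act h (lift_row r d T')"
proof -
  let ?k = "sum_list d"
  obtain R T1 where TR: "T = R # T1" "R \<subseteq> {1..r + ?k}" "T1 \<in> tabs_on d ({1..r + ?k} - R)"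
    using T by (auto elim!: tabs_ConsE)
  have "h ` {Suc ?k..r + ?k} = h ` ({1..r + ?k} - {1..?k})"
    by (rule arg_cong[where f = "image h"]) auto
  also have "\<dots> = h ` {1..r + ?k} - h ` {1..?k}"
    by (rule image_set_diff[OF permutes_inj[OF h]])
  also have "\<dots> = R" using TR im permutes_image[OF h] by auto
  finally have R: "h ` {Suc ?k..r + ?k} = R" .
  define T' where "T' = tab_act (inv' h) T1"
  have "T' \<in> tabs_on d (inv' h ` ({1..r + ?k} - R))"
    unfolding T'_def using TR(3) permutes_inj_on[OF permutes_inv[OF h]] by (intro tab_act_tabs_on)
  moreover have "inv' h ` ({1..r + ?k} - R) = {1..?k}"
    using im TR(1) image_inv_f_f[OF permutes_inj[OF h], of "{1..?k}"] by simp
  moreover have "T = tab_act h (lift_row r d T')"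
    using R tab_act_inv(1)[OF h] by (simp add: TR lift_row_def T'_def)
  ultimately show ?thesis using that by simp
qed

text \<open>A column permutation \<open>q\<close> contributes if it maps the first row of \<open>t\<close> to the first row of lifted
  tabloids; the remaining rows of \<open>q \<circ> t\<close> then form a tableau of shape \<open>d\<close>.  The column
  stabilizers of all these tableaux are one and the same group \<open>C'\<close>, which acts on the contributing
  \<open>q\<close> from the left.  Averaging over \<open>C'\<close> turns the sum over \<open>q\<close> into a sum of polytabloids of
  shape \<open>d\<close>.\<close>

lemma polytabloid_slice:
  assumes t: "tableau (r # d) t"
  shows "polytabloid (r # d) t \<circ> lift_row r d \<in> rep_space (specht d)"
proof -
  let ?d = "r # d" and ?k = "sum_list d" and ?n = "r + sum_list d"
  define C where "C = column_stabilizer ?d t"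
  define R where "R = {t (0, j) | j. j < r}"
  define Q where "Q = {q \<in> C. q ` R = {Suc ?k..?n}}"
  \<comment> \<open>By \<open>stab\<close> below, this is the column stabilizer of every tableau \<open>s q\<close>.\<close>
  define C' where "C' = {c. c permutes {1..?k} \<and>
     (\<forall>j. c ` (column_entries ?d t j \<inter> {1..?k}) = column_entries ?d t j \<inter> {1..?k})}"
  define s where "s = (\<lambda>q. tail_tableau (q \<circ> t))"
  have finC: "finite C" unfolding C_def by (rule finite_column_stabilizer)
  then have finQ: "finite Q" by (simp add: Q_def)
  have finC': "finite C'" by (rule finite_subset[OF _ finite_permutations[of "{1..?k}"]]) (auto simp: C'_def)
  have perm: "q permutes {1..?n}" if "q \<in> C" for q
    using that column_stabilizer_permutes[of q ?d t] by (simp add: C_def)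
  have row: "{(q \<circ> t) (0, j) | j. j < r} = q ` R" for q :: "nat \<Rightarrow> nat" by (auto simp: R_def)
  have bij: "bij_betw (q \<circ> t) (cells ?d) {1..?n}" if "q \<in> C" for q
    using tableau_comp[of q ?d t] perm[OF that] t by (simp add: tableau_def)
  have s_tab: "tableau d (s q)" if q: "q \<in> Q" for q
  proof -
    have "{1..?n} - {Suc ?k..?n} = {1..?k}" by auto
    then show ?thesis
      using tail_tableau_bij(1)[OF bij, of q] q unfolding row by (simp add: Q_def s_def tableau_def)
  qed
  have stab: "column_stabilizer d (s q) = C'" if q: "q \<in> Q" for q
  proof -
    have "column_entries d (s q) j = column_entries ?d t j \<inter> {1..?k}" for j
    proof -
      have "column_entries ?d t j = column_entries ?d (q \<circ> t) j"
        using q by (simp add: Q_def C_def column_stabilizer_def column_entries_comp)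
      also have "\<dots> = {(q \<circ> t) (0, j) | i :: nat. j < r} \<union> column_entries d (s q) j"
        by (auto simp: column_entries_def cells_Cons s_def tail_tableau_def)
      finally have e: "column_entries ?d t j = {(q \<circ> t) (0, j) | i :: nat. j < r} \<union> column_entries d (s q) j" .
      have "{(q \<circ> t) (0, j) | i :: nat. j < r} \<subseteq> q ` R" by (auto simp: R_def)
      then have "{(q \<circ> t) (0, j) | i :: nat. j < r} \<subseteq> {Suc ?k..?n}" using q by (simp add: Q_def)
      moreover have "column_entries d (s q) j \<subseteq> {1..?k}"
        using bij_betw_imp_surj_on[OF s_tab[OF q, unfolded tableau_def]] by (auto simp: column_entries_def)
      ultimately show ?thesis unfolding e by fastforce
    qed
    then show ?thesis by (auto simp: column_stabilizer_def C'_def sym_group_def)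
  qed
  have perm': "c permutes {1..?n}" if "c \<in> C'" for c
    using that permutes_subset[of c "{1..?k}" "{1..?n}"] by (auto simp: C'_def)
  have closed: "c \<circ> q \<in> Q" if c: "c \<in> C'" and q: "q \<in> Q" for c q
  proof -
    have cfix: "c x = x" if "x \<notin> {1..?k}" for x using c that by (auto simp: C'_def permutes_def)
    have "c ` column_entries ?d t j = column_entries ?d t j" for j
    proof -
      let ?K = "column_entries ?d t j"
      have "c ` ?K = c ` (?K \<inter> {1..?k}) \<union> c ` (?K - {1..?k})" by (metis Int_Diff_Un image_Un)
      moreover have "c ` (?K \<inter> {1..?k}) = ?K \<inter> {1..?k}" using c by (simp add: C'_def)
      moreover have "c ` (?K - {1..?k}) = ?K - {1..?k}" using cfix by (auto simp: image_iff)
      ultimately show ?thesis by (simp add: Int_Diff_Un)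
    qed
    moreover have "q ` column_entries ?d t j = column_entries ?d t j" for j
      using q by (simp add: Q_def C_def column_stabilizer_def)
    ultimately have "(c \<circ> q) ` column_entries ?d t j = column_entries ?d t j" for j
      by (simp only: image_comp[symmetric])
    moreover have "c \<circ> q permutes {1..?n}"
      using permutes_compose[OF perm perm'[OF c]] q by (simp add: Q_def)
    moreover have "c ` {Suc ?k..?n} = {Suc ?k..?n}" using cfix by (auto simp: image_iff)
    moreover have "q ` R = {Suc ?k..?n}" using q by (simp add: Q_def)
    ultimately have "c \<circ> q \<in> C" "(c \<circ> q) ` R = {Suc ?k..?n}"
      by (simp_all only: C_def column_stabilizer_def sym_group_def image_comp[symmetric] mem_Collect_eq
          partial_object.simps sum_list.Cons) simp_all
    then show ?thesis by (simp add: Q_def)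
  qed
  have inv_closed: "inv' c \<in> C'" if c: "c \<in> C'" for c
  proof -
    have p: "c permutes {1..?k}" using c by (simp add: C'_def)
    have "inv' c ` (column_entries ?d t j \<inter> {1..?k}) = column_entries ?d t j \<inter> {1..?k}" for j
    proof -
      have "c ` (column_entries ?d t j \<inter> {1..?k}) = column_entries ?d t j \<inter> {1..?k}"
        using c by (simp add: C'_def)
      then show ?thesis using image_inv_f_f[OF permutes_inj[OF p]] by metis
    qed
    then show ?thesis using permutes_inv[OF p] by (simp add: C'_def)
  qed
  have restr: "polytabloid ?d t (lift_row r d T) =
      (\<Sum>q\<in>Q. of_int (sign q) * (if T = tabloid d (s q) then 1 else 0))" for T
  proof -
    have "polytabloid ?d t (lift_row r d T) =
      (\<Sum>q\<in>C. of_int (sign q) * (if {Suc ?k..?n} = q ` R \<and> T = tabloid d (s q) then 1 else 0))"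
      unfolding polytabloid_def C_def[symmetric] tabloid_Cons lift_row_def row s_def by simp
    also have "\<dots> = (\<Sum>q\<in>Q. of_int (sign q) * (if T = tabloid d (s q) then 1 else 0))"
      using finC by (intro sum.mono_neutral_cong_right) (auto simp: Q_def)
    finally show ?thesis .
  qed
  have shift: "(\<Sum>q\<in>Q. of_int (sign q) * (if T = tabloid d (s q) then 1 else (0 :: complex))) =
      (\<Sum>q\<in>Q. of_int (sign q) * (of_int (sign c) * (if T = tabloid d (c \<circ> s q) then 1 else 0)))"
    if c: "c \<in> C'" for c T
  proof (rule sum.reindex_bij_witness[where i = "\<lambda>q. c \<circ> q" and j = "\<lambda>q. inv' c \<circ> q"])
    have p: "c permutes {1..?k}" using c by (simp add: C'_def)
    fix q assume q: "q \<in> Q"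
    show "c \<circ> (inv' c \<circ> q) = q" "inv' c \<circ> (c \<circ> q) = q"
      by (simp_all only: comp_assoc[symmetric] permutes_inv_o[OF p] id_comp)
    show "c \<circ> q \<in> Q" "inv' c \<circ> q \<in> Q" using closed[OF c q] closed[OF inv_closed[OF c] q] .
    have "permutation c" "permutation (inv' c)" "permutation q"
      using p permutes_inv[OF p] perm[of q] q by (auto simp: permutation_permutes Q_def)
    then have "sign (inv' c \<circ> q) * sign c = sign q"
      by (simp add: sign_compose sign_inverse sign_idempotent ac_simps)
    moreover have "c \<circ> s (inv' c \<circ> q) = s q"
      by (auto simp: s_def tail_tableau_def fun_eq_iff permutes_inverses[OF p])
    ultimately show "of_int (sign (inv' c \<circ> q)) * (of_int (sign c) * (if T = tabloid d (c \<circ> s (inv' c \<circ> q)) then 1 else 0)) =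
      of_int (sign q) * (if T = tabloid d (s q) then 1 else (0 :: complex))"
      by (simp flip: of_int_mult)
  qed
  have "cscale (of_nat (card C')) (polytabloid ?d t \<circ> lift_row r d) =
    (\<Sum>q\<in>Q. cscale (of_int (sign q)) (polytabloid d (s q)))"
  proof
    fix T
    have "cscale (of_nat (card C')) (polytabloid ?d t \<circ> lift_row r d) T =
      (\<Sum>c\<in>C'. \<Sum>q\<in>Q. of_int (sign q) * (of_int (sign c) * (if T = tabloid d (c \<circ> s q) then 1 else 0)))"
    proof -
      have "cscale (of_nat (card C')) (polytabloid ?d t \<circ> lift_row r d) T =
          (\<Sum>c\<in>C'. \<Sum>q\<in>Q. of_int (sign q) * (if T = tabloid d (s q) then 1 else 0))"
        by (simp add: cscale_apply restr)
      also have "\<dots> = (\<Sum>c\<in>C'. \<Sum>q\<in>Q. of_int (sign q) * (of_int (sign c) * (if T = tabloid d (c \<circ> s q) then 1 else 0)))"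
        by (rule sum.cong[OF refl shift])
      finally show ?thesis .
    qed
    also have "\<dots> = (\<Sum>q\<in>Q. \<Sum>c\<in>C'. of_int (sign q) * (of_int (sign c) * (if T = tabloid d (c \<circ> s q) then 1 else 0)))"
      by (rule sum.swap)
    also have "\<dots> = (\<Sum>q\<in>Q. of_int (sign q) * polytabloid d (s q) T)"
      by (intro sum.cong refl) (simp only: polytabloid_def stab sum_distrib_left)
    finally show "cscale (of_nat (card C')) (polytabloid ?d t \<circ> lift_row r d) T =
      (\<Sum>q\<in>Q. cscale (of_int (sign q)) (polytabloid d (s q))) T" by (simp add: fun_app)
  qed
  also have "\<dots> \<in> rep_space (specht d)"
    unfolding specht_simps using s_tab by (intro cfun.span_sum cfun.span_scale cfun.span_base) auto
  finally have "cscale (1 / of_nat (card C')) (cscale (of_nat (card C')) (polytabloid ?d t \<circ> lift_row r d))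
      \<in> rep_space (specht d)"
    unfolding specht_simps by (rule cfun.span_scale)
  moreover have "id \<in> C'" by (simp add: C'_def permutes_id)
  then have "card C' \<noteq> 0" using finC' by auto
  ultimately show ?thesis by simp
qed

section \<open>Harmonic functions on tabloids\<close>

lemma tabs_Cons_hd:
  assumes "T \<in> tabs (r # d)"
  shows "hd T \<subseteq> {1..r + sum_list d}" "finite (hd T)" "card (hd T) = r"
    "card ({1..r + sum_list d} - hd T) = sum_list d"
proof -
  obtain R T' where T: "T = R # T'" "R \<subseteq> {1..r + sum_list d}" "finite R" "card R = r"
    using assms by (auto elim!: tabs_ConsE)
  then show "hd T \<subseteq> {1..r + sum_list d}" "finite (hd T)" "card (hd T) = r"
    "card ({1..r + sum_list d} - hd T) = sum_list d"
    by (simp_all add: card_Diff_subset)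
qed

lemma hd_tab_act:
  assumes "T \<in> tabs_on (r # d) Z"
  shows "hd (tab_act p T) = p ` hd T"
  using assms by (auto elim!: tabs_ConsE)

text \<open>Take a lower entry \<open>i\<close> of \<open>T\<close> outside \<open>B\<close> and the harmonic relation at \<open>i\<close>.  Exchanging \<open>i\<close> with an
  entry of the first row outside \<open>B\<close> does not change the value.  Exchanging it with one in \<open>B\<close> gives a
  tabloid with fewer lower entries outside \<open>B\<close>, where \<open>v\<close> vanishes by induction.  So a positive multiple
  of \<open>v T\<close> is zero.\<close>

lemma harmonic_eq_zero:
  assumes v: "harmonic (r # d) v" "v \<in> funs_on (tabs (r # d))"
    and inv: "\<And>i x T. i \<in> {1..r + sum_list d} - B \<Longrightarrow> x \<in> {1..r + sum_list d} - B \<Longrightarrow> T \<in> tabs (r # d) \<Longrightarrow>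
      v (tab_act (transpose i x) T) = v T"
    and zero: "\<And>T. T \<in> tabs (r # d) \<Longrightarrow> {1..r + sum_list d} - hd T \<subseteq> B \<Longrightarrow> v T = 0"
  shows "v = 0"
proof -
  let ?d = "r # d" and ?n = "r + sum_list d"
  have "v T = 0" if "T \<in> tabs ?d" for T
    using that
  proof (induction "card ({1..?n} - hd T - B)" arbitrary: T rule: less_induct)
    case less
    note T = less.prems
    note R = tabs_Cons_hd[OF T]
    show ?case
    proof (cases "{1..?n} - hd T \<subseteq> B")
      case False
      then obtain i where i: "i \<in> {1..?n}" "i \<notin> hd T" "i \<notin> B" by blast
      have small: "v (tab_act (transpose i x) T) = 0" if x: "x \<in> hd T \<inter> B" for x
      proof (rule less.hyps)
        have xn: "x \<in> {1..?n}" using x R by blast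
        show T': "tab_act (transpose i x) T \<in> tabs ?d"
          using tab_act_tabs_on_permutes[OF permutes_swap_id[OF i(1) xn], of T ?d] T by simp
        have "hd (tab_act (transpose i x) T) = insert i (hd T - {x})"
          using hd_tab_act[OF T] transpose_image_swap[of x "hd T" i] x i
          by (simp add: transpose_commute)
        then have "{1..?n} - hd (tab_act (transpose i x) T) - B \<subset> {1..?n} - hd T - B"
          using x i by auto
        then show "card ({1..?n} - hd (tab_act (transpose i x) T) - B) < card ({1..?n} - hd T - B)"
          by (intro psubset_card_mono) auto
      qed
      have same: "v (tab_act (transpose i x) T) = v T" if "x \<in> hd T - B" for x
        using that R(1) i by (intro inv T) auto
      have "0 = v T + (\<Sum>x\<in>hd T. v (tab_act (transpose i x) T))"
        using v(1) T i by (auto simp: harmonic_def)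
      also have "(\<Sum>x\<in>hd T. v (tab_act (transpose i x) T)) = (\<Sum>x\<in>hd T - B. v (tab_act (transpose i x) T))"
        using R(2) small by (intro sum.mono_neutral_right) auto
      also have "\<dots> = of_nat (card (hd T - B)) * v T" using same by simp
      finally have "of_nat (Suc (card (hd T - B))) * v T = 0" by (simp add: algebra_simps)
      then show ?thesis by (metis mult_eq_0_iff of_nat_neq_0)
    qed (use zero T in blast)
  qed
  then show ?thesis using v(2) by (auto simp: funs_on_def fun_eq_iff fun_app)
qed

text \<open>The candidate for the Specht module of \<open>r # d\<close>.  Composing with all translates \<open>tab_act g\<close> makes the
  slice condition independent of which set of lower entries is fixed.\<close>

definition harmonic_space :: "nat \<Rightarrow> nat list \<Rightarrow> (nat set list \<Rightarrow> complex) set"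
  where "harmonic_space r d = {v \<in> funs_on (tabs (r # d)). harmonic (r # d) v \<and>
    (\<forall>g. g permutes {1..r + sum_list d} \<longrightarrow> v \<circ> tab_act g \<circ> lift_row r d \<in> rep_space (specht d))}"

lemma subspace_specht: "cfun.subspace (rep_space (specht d))"
  unfolding specht_simps by (rule cfun.subspace_span)

lemma specht_funs_on: "rep_space (specht d) \<subseteq> funs_on (tabs d)"
  using perm_repD(3)[OF perm_rep_specht] .

lemma specht_invariant:
  assumes "p permutes {1..sum_list d}" "v \<in> rep_space (specht d)"
  shows "v \<circ> tab_act p \<in> rep_space (specht d)"
proof -
  have "inv' p \<in> carrier (sym_group (sum_list d))"
    using permutes_inv[OF assms(1)] by (simp add: sym_group_def)
  from is_repD(2)[OF perm_repD(1)[OF perm_rep_specht] this assms(2)]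
  have "v \<circ> map (vimage (inv' p)) \<in> rep_space (specht d)" by (simp add: specht_act_eq comp_def)
  moreover have "map (vimage (inv' p)) = tab_act p"
    using map_vimage_eq[OF permutes_inv[OF assms(1)]] inv_inv_eq[OF permutes_bij[OF assms(1)]]
    by (simp add: fun_eq_iff)
  ultimately show ?thesis by simp
qed

lemma subspace_harmonic_space: "cfun.subspace (harmonic_space r d)"
proof (rule cfun.subspaceI)
  have c: "0 \<circ> f = (0 :: 'a \<Rightarrow> complex)" "(v + w) \<circ> f = (v \<circ> f) + (w \<circ> f)" "cscale k v \<circ> f = cscale k (v \<circ> f)"
    for f :: "'a \<Rightarrow> 'b" and v w :: "'b \<Rightarrow> complex" and k
    by (auto simp: fun_eq_iff fun_app)
  have "harmonic (r # d) 0" by (simp add: harmonic_def zero_fun_apply)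
  then show "0 \<in> harmonic_space r d"
    unfolding harmonic_space_def mem_Collect_eq c
    using cfun.subspace_0[OF subspace_funs_on] cfun.subspace_0[OF subspace_specht] by blast
  fix v w assume v: "v \<in> harmonic_space r d" and w: "w \<in> harmonic_space r d"
  have "harmonic (r # d) (v + w)"
    unfolding harmonic_def
  proof (intro ballI)
    fix T i assume T: "T \<in> tabs (r # d)" "i \<in> {1..sum_list (r # d)} - hd T"
    have "v T + (\<Sum>x\<in>hd T. v (tab_act (transpose i x) T)) = 0" "w T + (\<Sum>x\<in>hd T. w (tab_act (transpose i x) T)) = 0"
      using v w T unfolding harmonic_space_def harmonic_def by blast+
    then show "(v + w) T + (\<Sum>x\<in>hd T. (v + w) (tab_act (transpose i x) T)) = 0"
      unfolding plus_fun_apply sum.distrib by (metis (no_types, lifting) add.assoc add.left_commute add.right_neutral)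
  qed
  then show "v + w \<in> harmonic_space r d"
    using v w cfun.subspace_add[OF subspace_funs_on] cfun.subspace_add[OF subspace_specht]
    unfolding harmonic_space_def mem_Collect_eq c by blast
next
  have c: "cscale k v \<circ> f = cscale k (v \<circ> f)"
    for f :: "'a \<Rightarrow> 'b" and v :: "'b \<Rightarrow> complex" and k
    by (auto simp: fun_eq_iff fun_app)
  fix k v assume v: "v \<in> harmonic_space r d"
  have "harmonic (r # d) (cscale k v)"
    unfolding harmonic_def
  proof (intro ballI)
    fix T i assume T: "T \<in> tabs (r # d)" "i \<in> {1..sum_list (r # d)} - hd T"
    have "v T + (\<Sum>x\<in>hd T. v (tab_act (transpose i x) T)) = 0"
      using v T unfolding harmonic_space_def harmonic_def by blast
    then show "cscale k v T + (\<Sum>x\<in>hd T. cscale k v (tab_act (transpose i x) T)) = 0"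
      unfolding cscale_apply sum_distrib_left[symmetric] distrib_left[symmetric] by simp
  qed
  then show "cscale k v \<in> harmonic_space r d"
    using v cfun.subspace_scale[OF subspace_funs_on] cfun.subspace_scale[OF subspace_specht]
    unfolding harmonic_space_def mem_Collect_eq c by blast
qed

lemma harmonic_act:
  assumes v: "harmonic d v" and p: "p permutes {1..sum_list d}" and d: "d \<noteq> []"
  shows "harmonic d (v \<circ> tab_act p)"
  unfolding harmonic_def
proof (intro ballI)
  fix T i assume T: "T \<in> tabs d" and i: "i \<in> {1..sum_list d} - hd T"
  have pT: "tab_act p T \<in> tabs d" using tab_act_tabs_on_permutes[OF p] T by blast
  have hd: "hd (tab_act p T) = p ` hd T" using d T hd_tab_act by (cases d) auto
  have pi: "p i \<in> {1..sum_list d} - hd (tab_act p T)"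
    using i permutes_inj[OF p] permutes_in_image[OF p] by (auto simp: hd inj_image_mem_iff)
  have "v (tab_act p T) + (\<Sum>x\<in>hd (tab_act p T). v (tab_act (transpose (p i) x) (tab_act p T))) = 0"
    using v pT pi unfolding harmonic_def by blast
  then have "0 = v (tab_act p T) + (\<Sum>x\<in>p ` hd T. v (tab_act (transpose (p i) x) (tab_act p T)))"
    unfolding hd by (rule sym)
  also have "(\<Sum>x\<in>p ` hd T. v (tab_act (transpose (p i) x) (tab_act p T)))
      = (\<Sum>x\<in>hd T. v (tab_act (transpose (p i) (p x)) (tab_act p T)))"
    using sum.reindex[OF permutes_inj_on[OF p], of _ "hd T"] by (simp add: comp_def)
  also have "\<dots> = (\<Sum>x\<in>hd T. v (tab_act p (tab_act (transpose i x) T)))"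
  proof (rule sum.cong[OF refl])
    fix x
    have "transpose (p i) (p x) \<circ> p = p \<circ> transpose i x"
      using permutes_inj[OF p] by (auto simp: fun_eq_iff transpose_def inj_def)
    then show "v (tab_act (transpose (p i) (p x)) (tab_act p T)) = v (tab_act p (tab_act (transpose i x) T))"
      by (simp only: tab_act_comp)
  qed
  finally show "(v \<circ> tab_act p) T + (\<Sum>x\<in>hd T. (v \<circ> tab_act p) (tab_act (transpose i x) T)) = 0"
    by simp
qed

lemma harmonic_space_act:
  assumes v: "v \<in> harmonic_space r d" and p: "p permutes {1..r + sum_list d}"
  shows "v \<circ> tab_act p \<in> harmonic_space r d"
proof -
  have "v \<circ> tab_act p \<in> funs_on (tabs (r # d))"
    using v tab_act_tabs_on_permutes[of p "{1..sum_list (r # d)}"] p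
    by (auto simp: harmonic_space_def funs_on_def)
  moreover have "harmonic (r # d) (v \<circ> tab_act p)"
    using harmonic_act[of "r # d" v p] v p by (simp add: harmonic_space_def)
  moreover have "v \<circ> tab_act p \<circ> tab_act g \<circ> lift_row r d \<in> rep_space (specht d)"
    if g: "g permutes {1..r + sum_list d}" for g
  proof -
    have "v \<circ> tab_act (p \<circ> g) \<circ> lift_row r d \<in> rep_space (specht d)"
      using v permutes_compose[OF g p] unfolding harmonic_space_def by blast
    moreover have "tab_act (p \<circ> g) = tab_act p \<circ> tab_act g" by (auto simp: fun_eq_iff)
    ultimately show ?thesis by (simp only: comp_assoc)
  qed
  ultimately show ?thesis by (simp only: harmonic_space_def mem_Collect_eq) blast
qed

lemma harmonic_space_conj:
  assumes "v \<in> harmonic_space r d"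
  shows "conj_fun v \<in> harmonic_space r d"
proof -
  have "harmonic (r # d) (conj_fun v)"
    unfolding harmonic_def
  proof (intro ballI)
    fix T i assume T: "T \<in> tabs (r # d)" "i \<in> {1..sum_list (r # d)} - hd T"
    have "v T + (\<Sum>x\<in>hd T. v (tab_act (transpose i x) T)) = 0"
      using assms T unfolding harmonic_space_def harmonic_def by blast
    then have "cnj (v T + (\<Sum>x\<in>hd T. v (tab_act (transpose i x) T))) = 0" by simp
    then show "conj_fun v T + (\<Sum>x\<in>hd T. conj_fun v (tab_act (transpose i x) T)) = 0"
      by (simp only: conj_fun_def complex_cnj_add cnj_sum)
  qed
  moreover have "conj_fun v \<circ> f = conj_fun (v \<circ> f)" for f :: "nat set list \<Rightarrow> nat set list"
    by (auto simp: conj_fun_def fun_eq_iff)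
  moreover have "conj_fun v \<in> funs_on (tabs (r # d))"
    using assms by (auto simp: harmonic_space_def conj_fun_def funs_on_def)
  ultimately show ?thesis
    using assms specht_conj_closed unfolding harmonic_space_def comp_assoc by simp
qed

lemma polytabloid_in_harmonic_space:
  assumes "young_diagram (r # d)" "tableau (r # d) t"
  shows "polytabloid (r # d) t \<in> harmonic_space r d"
proof -
  have "polytabloid (r # d) t \<circ> tab_act g \<circ> lift_row r d \<in> rep_space (specht d)"
    if g: "g permutes {1..r + sum_list d}" for g
  proof -
    have p: "inv' g permutes {1..sum_list (r # d)}" using permutes_inv[OF g] by simp
    have "polytabloid (r # d) t \<circ> tab_act g = polytabloid (r # d) (inv' g \<circ> t)"
      using polytabloid_act[OF p assms(2)] inv_inv_eq[OF permutes_bij[OF g]] by simp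
    then show ?thesis using polytabloid_slice[OF tableau_comp[OF p assms(2)]] by simp
  qed
  then show ?thesis
    using polytabloid_harmonic[OF assms] polytabloid_funs_on[OF assms(2)]
    unfolding harmonic_space_def by blast
qed

lemma specht_subset_harmonic_space:
  assumes "young_diagram (r # d)"
  shows "rep_space (specht (r # d)) \<subseteq> harmonic_space r d"
  unfolding specht_simps
  using polytabloid_in_harmonic_space[OF assms] by (intro cfun.span_minimal subspace_harmonic_space) auto

lemma perm_rep_harmonic_space:
  "perm_rep (sym_group (r + sum_list d)) (subrep (specht (r # d)) (harmonic_space r d)) (tabs (r # d)) tab_pull"
proof -
  have "perm_rep (sym_group (sum_list (r # d))) (subrep (specht (r # d)) (harmonic_space r d)) (tabs (r # d)) tab_pull"
  proof (rule perm_rep_tabloid_functions[OF subspace_harmonic_space])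
    show "harmonic_space r d \<subseteq> funs_on (tabs (r # d))" by (auto simp: harmonic_space_def)
    show "v \<circ> tab_act (inv' p) \<in> harmonic_space r d"
      if "p permutes {1..sum_list (r # d)}" "v \<in> harmonic_space r d" for p v
      using harmonic_space_act[OF that(2), of "inv' p"] permutes_inv[OF that(1)] by simp
  qed
  then show ?thesis by (simp only: sum_list.Cons)
qed

section \<open>Absolute simplicity of Specht modules\<close>

lemma fixed_tabloid_tensor_iff:
  assumes V: "perm_rep (sym_group n) V P tab_pull" and W: "perm_rep (sym_group n) W Q tab_pull"
  shows "F \<in> fixed_space (sym_group n) (tensor_rep V W) \<longleftrightarrow>
    F \<in> tensor_space (rep_space V) (rep_space W) \<and>
    (\<forall>p. p permutes {1..n} \<longrightarrow> (\<forall>S\<in>P. \<forall>T\<in>Q. F (tab_act p S, tab_act p T) = F (S, T)))"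
  unfolding fixed_tensor_iff[OF V W]
  using all_tab_pull_iff[of n "\<lambda>f. \<forall>S\<in>P. \<forall>T\<in>Q. F (f S, f T) = F (S, T)"] by simp

lemma tabs_standard_pair:
  assumes S: "S \<in> tabs (r # d)" and T: "T \<in> tabs (r # d)" and eq: "hd S = hd T"
  obtains h S' T' where "h permutes {1..r + sum_list d}" "S' \<in> tabs d" "T' \<in> tabs d"
    "S = tab_act h (lift_row r d S')" "T = tab_act h (lift_row r d T')"
proof -
  have "card {1..sum_list d} = card ({1..r + sum_list d} - hd S)"
    using tabs_Cons_hd(4)[OF S] by simp
  then obtain f where f: "bij_betw f {1..sum_list d} ({1..r + sum_list d} - hd S)"
    using finite_same_card_bij[of "{1..sum_list d}" "{1..r + sum_list d} - hd S"] by auto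
  obtain h where h: "h permutes {1..r + sum_list d}" "\<And>x. x \<in> {1..sum_list d} \<Longrightarrow> h x = f x"
    by (rule extend_to_permutation[of "{1..r + sum_list d}" "{1..sum_list d}" f])
      (use f in \<open>auto simp: bij_betw_def\<close>)
  have im: "h ` {1..sum_list d} = {1..r + sum_list d} - hd S"
    using f h(2) by (metis (no_types, lifting) bij_betw_imp_surj_on image_cong)
  obtain S' where "S' \<in> tabs d" "S = tab_act h (lift_row r d S')"
    using tabs_standard[OF S h(1) im] .
  moreover obtain T' where "T' \<in> tabs d" "T = tab_act h (lift_row r d T')"
    using tabs_standard[OF T h(1)] im eq by metis
  ultimately show ?thesis using that h(1) by blast
qed

lemma tab_act_lift_row:
  assumes "p permutes {1..sum_list d}" "g permutes {1..r + sum_list d}"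
    "\<And>i. i \<in> {1..sum_list d} \<Longrightarrow> g i = p i" "T \<in> tabs d"
  shows "tab_act g (lift_row r d T) = lift_row r d (tab_act p T)"
proof -
  have "tab_act g T = tab_act p T"
    using tabs_on_Union[OF assms(4)] assms(3) by (intro tab_act_cong) auto
  moreover have "g ` {Suc (sum_list d)..r + sum_list d} = {Suc (sum_list d)..r + sum_list d}"
  proof -
    have "{Suc (sum_list d)..r + sum_list d} = {1..r + sum_list d} - {1..sum_list d}" by auto
    moreover have "g ` {1..sum_list d} = {1..sum_list d}"
      using permutes_image[OF assms(1)] assms(3) by (metis (no_types, lifting) image_cong)
    ultimately show ?thesis
      using permutes_image[OF assms(2)] by (simp add: image_set_diff[OF permutes_inj[OF assms(2)]])
  qed
  ultimately show ?thesis by (simp add: lift_row_def)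
qed

lemma harmonic_space_slice:
  assumes "v \<in> harmonic_space r d"
  shows "v \<circ> lift_row r d \<in> rep_space (specht d)"
proof -
  have "v \<circ> tab_act id \<circ> lift_row r d \<in> rep_space (specht d)"
    using assms permutes_id unfolding harmonic_space_def by blast
  moreover have "tab_act id = id" by (auto simp: fun_eq_iff)
  ultimately show ?thesis by simp
qed

text \<open>For fixed \<open>T\<close>, \<open>harmonic_eq_zero\<close> applies to \<open>S \<mapsto> F (S, T)\<close> with \<open>B\<close> the lower entries of \<open>T\<close>: exchanging two
  entries of the first row of \<open>T\<close> preserves \<open>T\<close>.  As \<open>S\<close> has as many lower entries as \<open>T\<close>, only the pairs
  with equal first rows remain, and these are translates of pairs of lifted tabloids.\<close>

lemma fixed_harmonic_tensor_eq_zero: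
  assumes F: "F \<in> fixed_space (sym_group (r + sum_list d))
      (tensor_rep (subrep (specht (r # d)) (harmonic_space r d)) (subrep (specht (r # d)) (harmonic_space r d)))"
    and zero: "\<And>S T. S \<in> tabs d \<Longrightarrow> T \<in> tabs d \<Longrightarrow> F (lift_row r d S, lift_row r d T) = 0"
  shows "F = 0"
proof -
  let ?n = "r + sum_list d"
  note H = perm_rep_harmonic_space[of r d]
  have Ft: "F \<in> tensor_space (harmonic_space r d) (harmonic_space r d)"
    and Fi: "\<And>p S T. p permutes {1..?n} \<Longrightarrow> S \<in> tabs (r # d) \<Longrightarrow> T \<in> tabs (r # d) \<Longrightarrow>
      F (tab_act p S, tab_act p T) = F (S, T)"
    using F unfolding fixed_tabloid_tensor_iff[OF H H] by auto
  note sl = tensor_slice[OF subspace_harmonic_space subspace_harmonic_space Ft]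
  have "(\<lambda>S. F (S, T)) = 0" if T: "T \<in> tabs (r # d)" for T
  proof (rule harmonic_eq_zero[where B = "{1..?n} - hd T"])
    show "harmonic (r # d) (\<lambda>S. F (S, T))" "(\<lambda>S. F (S, T)) \<in> funs_on (tabs (r # d))"
      using sl(2)[of T] by (simp_all add: harmonic_space_def)
    show "F (tab_act (transpose i x) S, T) = F (S, T)"
      if ix: "i \<in> {1..?n} - ({1..?n} - hd T)" "x \<in> {1..?n} - ({1..?n} - hd T)" and S: "S \<in> tabs (r # d)" for i x S
    proof -
      have "transpose i x permutes {1..?n}" using ix by (intro permutes_swap_id) auto
      moreover have "tab_act (transpose i x) T = T" using tab_act_transpose_fix[OF T] ix by auto
      ultimately show ?thesis using Fi[OF _ S T] by metis
    qed
    show "F (S, T) = 0" if S: "S \<in> tabs (r # d)" and sub: "{1..?n} - hd S \<subseteq> {1..?n} - hd T" for S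
    proof -
      have "{1..?n} - hd S = {1..?n} - hd T"
        using sub tabs_Cons_hd(4)[OF S] tabs_Cons_hd(4)[OF T] by (intro card_subset_eq) auto
      then have "hd S = hd T" using tabs_Cons_hd(1)[OF S] tabs_Cons_hd(1)[OF T] by blast
      then obtain h S' T' where h: "h permutes {1..?n}" "S' \<in> tabs d" "T' \<in> tabs d"
        "S = tab_act h (lift_row r d S')" "T = tab_act h (lift_row r d T')"
        using tabs_standard_pair[OF S T] by metis
      have "F (S, T) = F (lift_row r d S', lift_row r d T')"
        unfolding h(4,5) using h(1-3) by (intro Fi) (simp_all add: lift_row_in_tabs)
      then show ?thesis using zero h by simp
    qed
  qed
  then have "F (S, T) = 0" if "T \<in> tabs (r # d)" for S T
    using that by (metis zero_fun_apply)
  moreover have "F (S, T) = 0" if "T \<notin> tabs (r # d)" for S T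
    using sl(1)[of S] that by (simp add: harmonic_space_def funs_on_def)
  ultimately show "F = 0" by (auto simp: fun_eq_iff zero_fun_apply)
qed

text \<open>Induction on the number of rows.  Restriction to lifted tabloids embeds the invariants of the tensor
  square of the harmonic space into those of the tensor square of the Specht module of \<open>d'\<close>, a line by
  induction.  So the harmonic space is absolutely simple, hence irreducible, and the Specht module is a
  nonzero subrepresentation of it.\<close>

theorem specht_absolutely_simple:
  assumes "young_diagram d"
  shows "absolutely_simple (sym_group (sum_list d)) (specht d) (tabs d) tab_pull"
    and "d = r # d' \<Longrightarrow> rep_space (specht d) = harmonic_space r d'"
proof -
  have "absolutely_simple (sym_group (sum_list d)) (specht d) (tabs d) tab_pull \<and>
    (\<forall>r d'. d = r # d' \<longrightarrow> rep_space (specht d) = harmonic_space r d')"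
    using assms
  proof (induction d)
    case Nil
    have "F \<in> cfun.span {\<lambda>p. if p = ([], []) then 1 else 0}"
      if "F \<in> fixed_space (sym_group (sum_list [])) (tensor_rep (specht []) (specht []))" for F
    proof -
      have "F \<in> tensor_space (rep_space (specht [])) (rep_space (specht []))"
        using that by (simp add: fixed_space_def)
      then have "F \<in> funs_on (tabs [] \<times> tabs [])"
        using tensor_space_funs_on[OF subspace_specht subspace_specht specht_funs_on specht_funs_on] by blast
      then have "F = cscale (F ([], [])) (\<lambda>p. if p = ([], []) then 1 else 0)"
        by (auto simp: fun_eq_iff cscale_apply funs_on_def)
      then show ?thesis by (auto simp: cfun.span_singleton)
    qed
    then show ?case
      unfolding absolutely_simple_def
      using perm_rep_specht[of "[]"] specht_conj_closed[of _ "[]"] specht_nonzero[of "[]"] by blast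
  next
    case (Cons r d)
    let ?G = "sym_group (r + sum_list d)" and ?H = "subrep (specht (r # d)) (harmonic_space r d)"
    let ?J = "\<lambda>(S, T). (lift_row r d S, lift_row r d T)"
    have Y: "young_diagram d" using Cons.prems by (rule young_diagram_tl)
    note IH = conjunct1[OF Cons.IH[OF Y]]
    note H = perm_rep_harmonic_space[of r d] and S = perm_rep_specht[of d]
    obtain K where K: "fixed_space (sym_group (sum_list d)) (tensor_rep (specht d) (specht d)) \<subseteq> cfun.span {K}"
      using IH by (auto simp: absolutely_simple_def)
    have restr: "F \<circ> ?J \<in> fixed_space (sym_group (sum_list d)) (tensor_rep (specht d) (specht d))"
      if F: "F \<in> fixed_space ?G (tensor_rep ?H ?H)" for F
    proof -
      have Ft: "F \<in> tensor_space (harmonic_space r d) (harmonic_space r d)"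
        and Fi: "\<And>p S T. p permutes {1..r + sum_list d} \<Longrightarrow> S \<in> tabs (r # d) \<Longrightarrow> T \<in> tabs (r # d) \<Longrightarrow>
          F (tab_act p S, tab_act p T) = F (S, T)"
        using F unfolding fixed_tabloid_tensor_iff[OF H H] by auto
      note sl = tensor_slice[OF subspace_harmonic_space subspace_harmonic_space Ft]
      have "F \<circ> ?J \<in> tensor_space (rep_space (specht d)) (rep_space (specht d))"
        by (rule tensor_spaceI[OF perm_repD(2,4,3)[OF S] perm_repD(2,4,3)[OF S]])
          (use harmonic_space_slice[OF sl(1)] harmonic_space_slice[OF sl(2)] in \<open>simp_all add: comp_def\<close>)
      moreover have "(F \<circ> ?J) (tab_act p S, tab_act p T) = (F \<circ> ?J) (S, T)"
        if p: "p permutes {1..sum_list d}" and ST: "S \<in> tabs d" "T \<in> tabs d" for p S T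
      proof -
        have p': "p permutes {1..r + sum_list d}" using p by (rule permutes_subset) auto
        show ?thesis
          using Fi[OF p', of "lift_row r d S" "lift_row r d T"] ST
            tab_act_lift_row[OF p p' refl ST(1)] tab_act_lift_row[OF p p' refl ST(2)]
          by (simp add: lift_row_in_tabs)
      qed
      ultimately show ?thesis unfolding fixed_tabloid_tensor_iff[OF S S] by blast
    qed
    have "\<exists>K'. fixed_space ?G (tensor_rep ?H ?H) \<subseteq> cfun.span {K'}"
    proof (cases "fixed_space ?G (tensor_rep ?H ?H) \<subseteq> {0}")
      case True
      then show ?thesis by (intro exI[of _ 0]) simp
    next
      case False
      note sub = subspace_fixed_space[OF perm_repD(1)[OF perm_rep_tensor[OF sym_group_is_group H H]]]
      have inj: "F = 0" if "F \<in> fixed_space ?G (tensor_rep ?H ?H)" "F \<circ> ?J = 0" for F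
      proof (rule fixed_harmonic_tensor_eq_zero[OF that(1)])
        show "F (lift_row r d S, lift_row r d T) = 0" for S T
          using fun_cong[OF that(2), of "(S, T)"] by (simp add: zero_fun_apply)
      qed
      obtain F0 where F0: "F0 \<in> fixed_space ?G (tensor_rep ?H ?H)" "F0 \<noteq> 0" using False by blast
      obtain c where c: "F0 \<circ> ?J = cscale c K" using restr[OF F0(1)] K by (auto simp: cfun.span_singleton)
      have c0: "c \<noteq> 0" using inj[OF F0(1)] F0(2) c by auto
      have "F \<in> cfun.span {F0}" if F: "F \<in> fixed_space ?G (tensor_rep ?H ?H)" for F
      proof -
        obtain e where e: "F \<circ> ?J = cscale e K" using restr[OF F] K by (auto simp: cfun.span_singleton)
        have "(F - cscale (e / c) F0) \<circ> ?J = (F \<circ> ?J) - cscale (e / c) (F0 \<circ> ?J)"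
          by (auto simp: fun_eq_iff fun_app)
        also have "\<dots> = 0" unfolding c e using c0 by simp
        finally have "F - cscale (e / c) F0 = 0"
          using inj cfun.subspace_diff[OF sub F cfun.subspace_scale[OF sub F0(1)]] by blast
        then show ?thesis by (auto simp: cfun.span_singleton)
      qed
      then show ?thesis by blast
    qed
    moreover have sub: "rep_space (specht (r # d)) \<subseteq> harmonic_space r d"
      using specht_subset_harmonic_space[OF Cons.prems] .
    then have "harmonic_space r d \<noteq> {0}"
      using specht_nonzero[of "r # d"] cfun.subspace_0[OF subspace_specht[of "r # d"]] by blast
    ultimately have Hs: "absolutely_simple ?G ?H (tabs (r # d)) tab_pull"
      unfolding absolutely_simple_def using H harmonic_space_conj by auto
    have "is_rep ?G (subrep ?H (rep_space (specht (r # d))))"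
      using perm_repD(1)[OF perm_rep_specht[of "r # d"]] by simp
    then have "rep_space (specht (r # d)) = {0} \<or> rep_space (specht (r # d)) = harmonic_space r d"
      using absolutely_simple_irreducible[OF sym_group_is_group finite_sym_group Hs] sub
      unfolding irreducible_rep_def by simp
    then have eq: "rep_space (specht (r # d)) = harmonic_space r d" using specht_nonzero by blast
    then show ?case using Hs by (metis list.inject subrep_self sum_list.Cons)
  qed
  then show "absolutely_simple (sym_group (sum_list d)) (specht d) (tabs d) tab_pull"
    and "d = r # d' \<Longrightarrow> rep_space (specht d) = harmonic_space r d'" by auto
qed

section \<open>Frobenius reciprocity\<close>

lemma induced_rep_simps:
  "F \<in> rep_space (induced_rep G H \<iota> R) \<longleftrightarrow>
     (\<forall>g. g \<notin> carrier G \<longrightarrow> (\<forall>x. F (g, x) = 0)) \<and>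
     (\<forall>g\<in>carrier G. (\<lambda>x. F (g, x)) \<in> rep_space R) \<and>
     (\<forall>g\<in>carrier G. \<forall>h\<in>carrier H.
        (\<lambda>x. F (g \<otimes>\<^bsub>G\<^esub> \<iota> h, x)) = rep_act R (inv\<^bsub>H\<^esub> h) (\<lambda>x. F (g, x)))"
  "rep_act (induced_rep G H \<iota> R) a F (g, x) = (if g \<in> carrier G then F (inv\<^bsub>G\<^esub> a \<otimes>\<^bsub>G\<^esub> g, x) else 0)"
  by (simp_all add: induced_rep_def)

lemma perm_rep_induced:
  assumes G: "group G" "finite (carrier G)" and H: "group H" and R: "perm_rep H R P \<beta>"
    and \<iota>: "\<And>h. h \<in> carrier H \<Longrightarrow> \<iota> h \<in> carrier G"
  shows "perm_rep G (induced_rep G H \<iota> R) (carrier G \<times> P) (\<lambda>a (g, x). (inv\<^bsub>G\<^esub> a \<otimes>\<^bsub>G\<^esub> g, x))"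
proof -
  interpret G: group G by (rule G(1))
  interpret H: group H by (rule H)
  note sR = perm_repD(4)[OF R]
  let ?I = "induced_rep G H \<iota> R"
  have lin: "linear_on (rep_space R) (rep_act R (inv\<^bsub>H\<^esub> h))" if "h \<in> carrier H" for h
    using is_repD(3)[OF perm_repD(1)[OF R]] that by simp
  have sub: "cfun.subspace (rep_space ?I)"
  proof (rule cfun.subspaceI)
    show "0 \<in> rep_space ?I"
      using cfun.subspace_0[OF sR] linear_on_zero[OF lin sR]
      by (auto simp: induced_rep_simps zero_fun_def)
  next
    fix F F' assume F: "F \<in> rep_space ?I" and F': "F' \<in> rep_space ?I"
    have e: "(\<lambda>x. (F + F') (g, x)) = (\<lambda>x. F (g, x)) + (\<lambda>x. F' (g, x))" for g
      by (simp add: fun_eq_iff fun_app)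
    show "F + F' \<in> rep_space ?I"
      unfolding induced_rep_simps e
    proof (intro conjI ballI allI impI)
      show "(F + F') (g, x) = 0" if "g \<notin> carrier G" for g x
        using F F' that by (simp add: induced_rep_simps fun_app)
      show "(\<lambda>x. F (g, x)) + (\<lambda>x. F' (g, x)) \<in> rep_space R" if "g \<in> carrier G" for g
        using F F' that by (auto simp: induced_rep_simps intro: cfun.subspace_add[OF sR])
      show "(\<lambda>x. F (g \<otimes>\<^bsub>G\<^esub> \<iota> h, x)) + (\<lambda>x. F' (g \<otimes>\<^bsub>G\<^esub> \<iota> h, x)) =
          rep_act R (inv\<^bsub>H\<^esub> h) ((\<lambda>x. F (g, x)) + (\<lambda>x. F' (g, x)))"
        if "g \<in> carrier G" "h \<in> carrier H" for g h
        using F F' that linear_onD(1)[OF lin[OF that(2)]] by (simp add: induced_rep_simps)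
    qed
  next
    fix c F assume F: "F \<in> rep_space ?I"
    have e: "(\<lambda>x. cscale c F (g, x)) = cscale c (\<lambda>x. F (g, x))" for g
      by (simp add: fun_eq_iff fun_app)
    show "cscale c F \<in> rep_space ?I"
      unfolding induced_rep_simps e
    proof (intro conjI ballI allI impI)
      show "cscale c F (g, x) = 0" if "g \<notin> carrier G" for g x
        using F that by (simp add: induced_rep_simps fun_app)
      show "cscale c (\<lambda>x. F (g, x)) \<in> rep_space R" if "g \<in> carrier G" for g
        using F that by (auto simp: induced_rep_simps intro: cfun.subspace_scale[OF sR])
      show "cscale c (\<lambda>x. F (g \<otimes>\<^bsub>G\<^esub> \<iota> h, x)) = rep_act R (inv\<^bsub>H\<^esub> h) (cscale c (\<lambda>x. F (g, x)))"
        if "g \<in> carrier G" "h \<in> carrier H" for g h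
        using F that linear_onD(2)[OF lin[OF that(2)]] by (simp add: induced_rep_simps)
    qed
  qed
  have act: "rep_act ?I a F \<in> rep_space ?I" if a: "a \<in> carrier G" and F: "F \<in> rep_space ?I" for a F
    unfolding induced_rep_simps
  proof (intro conjI ballI allI impI)
    fix g x assume "g \<notin> carrier G"
    then show "(if g \<in> carrier G then F (inv\<^bsub>G\<^esub> a \<otimes>\<^bsub>G\<^esub> g, x) else 0) = 0" by simp
  next
    fix g assume g: "g \<in> carrier G"
    have ag: "inv\<^bsub>G\<^esub> a \<otimes>\<^bsub>G\<^esub> g \<in> carrier G" using a g by simp
    then show "(\<lambda>x. if g \<in> carrier G then F (inv\<^bsub>G\<^esub> a \<otimes>\<^bsub>G\<^esub> g, x) else 0) \<in> rep_space R"
      using F g by (simp add: induced_rep_simps)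
    fix h assume h: "h \<in> carrier H"
    have "inv\<^bsub>G\<^esub> a \<otimes>\<^bsub>G\<^esub> (g \<otimes>\<^bsub>G\<^esub> \<iota> h) = (inv\<^bsub>G\<^esub> a \<otimes>\<^bsub>G\<^esub> g) \<otimes>\<^bsub>G\<^esub> \<iota> h"
      using a g \<iota>[OF h] by (simp add: G.m_assoc)
    then show "(\<lambda>x. if g \<otimes>\<^bsub>G\<^esub> \<iota> h \<in> carrier G then F (inv\<^bsub>G\<^esub> a \<otimes>\<^bsub>G\<^esub> (g \<otimes>\<^bsub>G\<^esub> \<iota> h), x) else 0) =
        rep_act R (inv\<^bsub>H\<^esub> h) (\<lambda>x. if g \<in> carrier G then F (inv\<^bsub>G\<^esub> a \<otimes>\<^bsub>G\<^esub> g, x) else 0)"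
      using F g h ag \<iota>[OF h] by (simp add: induced_rep_simps)
  qed
  have "is_rep G ?I"
    unfolding is_rep_def
  proof (intro conjI ballI)
    show "cfun.subspace (rep_space ?I)" by (rule sub)
    show "rep_act ?I g ` rep_space ?I \<subseteq> rep_space ?I" if "g \<in> carrier G" for g
      using act[OF that] by blast
    show "linear_on (rep_space ?I) (rep_act ?I g)" if "g \<in> carrier G" for g
      by (auto simp: linear_on_def fun_eq_iff induced_rep_simps(2) fun_app)
    show "rep_act ?I \<one>\<^bsub>G\<^esub> v = v" if "v \<in> rep_space ?I" for v
      using that by (auto simp: fun_eq_iff induced_rep_simps)
    show "rep_act ?I (g \<otimes>\<^bsub>G\<^esub> h) v = rep_act ?I g (rep_act ?I h v)"
      if "g \<in> carrier G" "h \<in> carrier G" "v \<in> rep_space ?I" for g h v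
      using that by (auto simp: fun_eq_iff induced_rep_simps(2) G.inv_mult_group G.m_assoc)
  qed
  moreover have "rep_space ?I \<subseteq> funs_on (carrier G \<times> P)"
  proof
    fix F assume F: "F \<in> rep_space ?I"
    have "F (g, x) = 0" if "g \<notin> carrier G \<or> x \<notin> P" for g x
      using F that perm_repD(7)[OF R, of "\<lambda>x. F (g, x)" x] by (auto simp: induced_rep_simps)
    then show "F \<in> funs_on (carrier G \<times> P)" by (auto simp: funs_on_def)
  qed
  moreover have "bij_betw (\<lambda>(g, x). (inv\<^bsub>G\<^esub> a \<otimes>\<^bsub>G\<^esub> g, x)) (carrier G \<times> P) (carrier G \<times> P)"
    if a: "a \<in> carrier G" for a
    by (rule bij_betw_byWitness[where f' = "\<lambda>(g, x). (a \<otimes>\<^bsub>G\<^esub> g, x)"])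
      (use a in \<open>auto simp: G.m_assoc[symmetric]\<close>)
  ultimately show ?thesis
    using G(2) perm_repD(2)[OF R] by (auto simp: perm_rep_def induced_rep_simps(2))
qed

lemma perm_rep_mult:
  assumes V: "perm_rep G V P \<beta>" and "v \<in> rep_space V" "g \<in> carrier G" "h \<in> carrier G"
    "g \<otimes>\<^bsub>G\<^esub> h \<in> carrier G" "x \<in> P"
  shows "v (\<beta> (g \<otimes>\<^bsub>G\<^esub> h) x) = v (\<beta> h (\<beta> g x))"
  using perm_repD(6,8)[OF V] is_repD(2,5)[OF perm_repD(1)[OF V]] assms(2-) by metis

lemma perm_rep_one:
  assumes V: "perm_rep G V P \<beta>" and "v \<in> rep_space V" "\<one>\<^bsub>G\<^esub> \<in> carrier G" "x \<in> P"
  shows "v (\<beta> \<one>\<^bsub>G\<^esub> x) = v x"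
  using perm_repD(6)[OF V assms(3,2,4)] is_repD(4)[OF perm_repD(1)[OF V] assms(2)] by simp

text \<open>An invariant \<open>F (x, (g, y))\<close> is determined by its values at \<open>g = \<one>\<close>, since the action can move \<open>g\<close>
  there.  The element \<open>\<iota> h\<close> moves \<open>\<one>\<close> to \<open>\<iota> h\<close>, and the equivariance along \<open>H\<close> in the definition of
  induced functions brings it back at the cost of acting on \<open>y\<close> by \<open>h\<close>.\<close>

theorem frobenius_reciprocity:
  fixes G :: "('g, 'm) monoid_scheme" and H :: "('h, 'n) monoid_scheme"
    and V :: "('g, 'x) rep" and W :: "('h, 'y) rep"
  assumes G: "group G" "finite (carrier G)" and H: "group H"
    and V: "perm_rep G V P \<beta>" and W: "perm_rep H W Q \<gamma>" and \<iota>: "\<iota> \<in> hom H G"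
  shows "cfun.dim (fixed_space G (tensor_rep V (induced_rep G H \<iota> W))) =
    cfun.dim {f \<in> tensor_space (rep_space V) (rep_space W).
      \<forall>h\<in>carrier H. \<forall>x\<in>P. \<forall>y\<in>Q. f (\<beta> (\<iota> h) x, \<gamma> h y) = f (x, y)}" (is "_ = cfun.dim ?B")
proof -
  interpret G: group G by (rule G(1))
  interpret H: group H by (rule H)
  have \<iota>c: "\<iota> h \<in> carrier G" if "h \<in> carrier H" for h using \<iota> that by (auto simp: hom_def)
  let ?I = "induced_rep G H \<iota> W"
  let ?J = "\<lambda>(x, y). (x, (\<one>\<^bsub>G\<^esub>, y))"
  have I: "perm_rep G ?I (carrier G \<times> Q) (\<lambda>a (g, x). (inv\<^bsub>G\<^esub> a \<otimes>\<^bsub>G\<^esub> g, x))"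
    by (rule perm_rep_induced[OF G H W]) (rule \<iota>c)
  note sV = perm_repD(4)[OF V] and sW = perm_repD(4)[OF W] and sI = perm_repD(4)[OF I]
  define A where "A = fixed_space G (tensor_rep V ?I)"
  have A_iff: "F \<in> A \<longleftrightarrow> F \<in> tensor_space (rep_space V) (rep_space ?I) \<and>
    (\<forall>a\<in>carrier G. \<forall>x\<in>P. \<forall>g\<in>carrier G. \<forall>y\<in>Q. F (\<beta> a x, (inv\<^bsub>G\<^esub> a \<otimes>\<^bsub>G\<^esub> g, y)) = F (x, (g, y)))" for F
    unfolding A_def fixed_tensor_iff[OF V I] by auto
  have from_one: "F (x, (g, y)) = F (\<beta> g x, (\<one>\<^bsub>G\<^esub>, y))"
    if F: "F \<in> A" and "x \<in> P" "g \<in> carrier G" "y \<in> Q" for F x g y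
    using F that unfolding A_iff by (metis G.l_inv)
  have supp: "F (x, (g, y)) = 0" if F: "F \<in> A" and "x \<notin> P \<or> g \<notin> carrier G \<or> y \<notin> Q" for F x g y
  proof -
    have "F \<in> funs_on (P \<times> (carrier G \<times> Q))"
      using F tensor_space_funs_on[OF sV sI perm_repD(3)[OF V] perm_repD(3)[OF I]] unfolding A_iff by blast
    then show ?thesis using that by (auto simp: funs_on_def)
  qed
  have inj: "inj_on (\<lambda>F. F \<circ> ?J) A"
  proof (rule inj_onI, rule ext)
    fix F F' :: "'x \<times> 'g \<times> 'y \<Rightarrow> complex" and p :: "'x \<times> 'g \<times> 'y"
    assume F: "F \<in> A" and F': "F' \<in> A" and eq: "F \<circ> ?J = F' \<circ> ?J"
    obtain x g y where p: "p = (x, (g, y))" using surj_pair by metis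
    have "F (x, (\<one>\<^bsub>G\<^esub>, y)) = F' (x, (\<one>\<^bsub>G\<^esub>, y))" for x y
      using fun_cong[OF eq, of "(x, y)"] by simp
    then show "F p = F' p"
      unfolding p using from_one[OF F] from_one[OF F'] supp[OF F] supp[OF F'] by metis
  qed
  have "(\<lambda>F. F \<circ> ?J) ` A = ?B"
  proof (rule subset_antisym; rule subsetI)
    fix f assume "f \<in> (\<lambda>F. F \<circ> ?J) ` A"
    then obtain F where F: "F \<in> A" and f: "f = F \<circ> ?J" by blast
    have Ft: "F \<in> tensor_space (rep_space V) (rep_space ?I)" using F A_iff by blast
    note sl = tensor_slice[OF sV sI Ft]
    have "f \<in> tensor_space (rep_space V) (rep_space W)"
      by (rule tensor_spaceI[OF perm_repD(2,4,3)[OF V] perm_repD(2,4,3)[OF W]])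
        (use sl(1) sl(2) in \<open>simp_all add: f induced_rep_simps\<close>)
    moreover have "f (\<beta> (\<iota> h) x, \<gamma> h y) = f (x, y)" if h: "h \<in> carrier H" and x: "x \<in> P" and y: "y \<in> Q" for h x y
    proof -
      have slW: "(\<lambda>y. F (\<beta> (\<iota> h) x, (\<one>\<^bsub>G\<^esub>, y))) \<in> rep_space W"
        using sl(1)[of "\<beta> (\<iota> h) x"] by (simp add: induced_rep_simps)
      have "\<forall>h'\<in>carrier H. (\<lambda>y. F (\<beta> (\<iota> h) x, (\<one>\<^bsub>G\<^esub> \<otimes>\<^bsub>G\<^esub> \<iota> h', y))) =
          rep_act W (inv\<^bsub>H\<^esub> h') (\<lambda>y. F (\<beta> (\<iota> h) x, (\<one>\<^bsub>G\<^esub>, y)))"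
        using sl(1)[of "\<beta> (\<iota> h) x"] unfolding induced_rep_simps by blast
      from this[rule_format, of "inv\<^bsub>H\<^esub> h"]
      have "(\<lambda>y. F (\<beta> (\<iota> h) x, (\<iota> (inv\<^bsub>H\<^esub> h), y))) = rep_act W h (\<lambda>y. F (\<beta> (\<iota> h) x, (\<one>\<^bsub>G\<^esub>, y)))"
        using h \<iota>c by simp
      then have "F (\<beta> (\<iota> h) x, (\<iota> (inv\<^bsub>H\<^esub> h), y)) = F (\<beta> (\<iota> h) x, (\<one>\<^bsub>G\<^esub>, \<gamma> h y))"
        using perm_repD(6)[OF W h slW y] by metis
      moreover have "\<iota> (inv\<^bsub>H\<^esub> h) = inv\<^bsub>G\<^esub> (\<iota> h)"
        using group_hom.hom_inv[of H G \<iota> h] h G(1) H \<iota> by (simp add: group_hom_def group_hom_axioms_def)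
      moreover have "F (\<beta> (\<iota> h) x, (inv\<^bsub>G\<^esub> (\<iota> h) \<otimes>\<^bsub>G\<^esub> \<one>\<^bsub>G\<^esub>, y)) = F (x, (\<one>\<^bsub>G\<^esub>, y))"
        using F h x y \<iota>c unfolding A_iff by blast
      ultimately show ?thesis using \<iota>c[OF h] by (simp add: f)
    qed
    ultimately show "f \<in> ?B" by blast
  next
    fix f assume fB: "f \<in> ?B"
    then have ft: "f \<in> tensor_space (rep_space V) (rep_space W)"
      and fi: "\<And>h x y. h \<in> carrier H \<Longrightarrow> x \<in> P \<Longrightarrow> y \<in> Q \<Longrightarrow> f (\<beta> (\<iota> h) x, \<gamma> h y) = f (x, y)" by auto
    note sl = tensor_slice[OF sV sW ft]
    define F where "F = (\<lambda>(x, (g, y)). if g \<in> carrier G \<and> x \<in> P then f (\<beta> g x, y) else 0)"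
    have "F \<in> tensor_space (rep_space V) (rep_space ?I)"
    proof (rule tensor_spaceI[OF perm_repD(2,4,3)[OF V] perm_repD(2,4,3)[OF I]])
      fix p :: "'g \<times> 'y"
      obtain g y where p: "p = (g, y)" by fastforce
      show "(\<lambda>x. F (x, p)) \<in> rep_space V"
      proof (cases "g \<in> carrier G")
        case True
        have "(\<lambda>x. F (x, p)) = rep_act V g (\<lambda>x. f (x, y))"
        proof
          fix x
          show "F (x, p) = rep_act V g (\<lambda>x. f (x, y)) x"
            using True perm_repD(6)[OF V True sl(2)]
              perm_repD(7)[OF V is_repD(2)[OF perm_repD(1)[OF V] True sl(2)]]
            by (simp add: F_def p)
        qed
        then show ?thesis using is_repD(2)[OF perm_repD(1)[OF V] True sl(2)] by simp
      next
        case False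
        then have "(\<lambda>x. F (x, p)) = 0" by (simp add: F_def p fun_eq_iff zero_fun_apply)
        then show ?thesis using cfun.subspace_0[OF sV] by simp
      qed
    next
      fix x
      show "(\<lambda>p. F (x, p)) \<in> rep_space ?I"
        unfolding induced_rep_simps
      proof (intro conjI ballI allI impI)
        show "F (x, (g, y)) = 0" if "g \<notin> carrier G" for g y using that by (simp add: F_def)
        have slice: "(\<lambda>y. F (x, (g, y))) = (if x \<in> P then (\<lambda>y. f (\<beta> g x, y)) else 0)"
          if "g \<in> carrier G" for g using that by (simp add: F_def fun_eq_iff zero_fun_apply)
        then show "(\<lambda>y. F (x, (g, y))) \<in> rep_space W" if "g \<in> carrier G" for g
          using sl(1) cfun.subspace_0[OF sW] that by simp
        show "(\<lambda>y. F (x, (g \<otimes>\<^bsub>G\<^esub> \<iota> h, y))) = rep_act W (inv\<^bsub>H\<^esub> h) (\<lambda>y. F (x, (g, y)))"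
          if g: "g \<in> carrier G" and h: "h \<in> carrier H" for g h
        proof (cases "x \<in> P")
          case False
          then show ?thesis
            using slice g h \<iota>c[OF h] linear_on_zero[OF is_repD(3)[OF perm_repD(1)[OF W]] sW] by simp
        next
          case True
          have hi: "inv\<^bsub>H\<^esub> h \<in> carrier H" using h by simp
          have "f (\<beta> (g \<otimes>\<^bsub>G\<^esub> \<iota> h) x, y) = rep_act W (inv\<^bsub>H\<^esub> h) (\<lambda>y. f (\<beta> g x, y)) y" for y
          proof (cases "y \<in> Q")
            case y: True
            define y' where "y' = \<gamma> (inv\<^bsub>H\<^esub> h) y"
            have y': "y' \<in> Q" unfolding y'_def using perm_repD(8)[OF W hi y] .
            have "w (\<gamma> h y') = w y" if "w \<in> rep_space W" for w
              unfolding y'_def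
              using perm_rep_mult[OF W that hi h _ y] perm_rep_one[OF W that _ y] h by simp
            then have "f (\<beta> (\<iota> h) (\<beta> g x), y) = f (\<beta> (\<iota> h) (\<beta> g x), \<gamma> h y')" using sl(1) by metis
            also have "\<dots> = f (\<beta> g x, y')" using fi[OF h perm_repD(8)[OF V g True] y'] .
            finally have "f (\<beta> (\<iota> h) (\<beta> g x), y) = f (\<beta> g x, y')" .
            moreover have "f (\<beta> (g \<otimes>\<^bsub>G\<^esub> \<iota> h) x, y) = f (\<beta> (\<iota> h) (\<beta> g x), y)"
              using perm_rep_mult[OF V sl(2) g \<iota>c[OF h] _ True] g \<iota>c[OF h] by simp
            ultimately show ?thesis using perm_repD(6)[OF W hi sl(1) y] by (simp add: y'_def)
          next
            case False
            then show ?thesis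
              using perm_repD(7)[OF W sl(1)] perm_repD(7)[OF W is_repD(2)[OF perm_repD(1)[OF W] hi sl(1)]]
              by simp
          qed
          then show ?thesis using slice g \<iota>c[OF h] True by (simp add: fun_eq_iff)
        qed
      qed
    qed
    moreover have "F (\<beta> a x, (inv\<^bsub>G\<^esub> a \<otimes>\<^bsub>G\<^esub> g, y)) = F (x, (g, y))"
      if a: "a \<in> carrier G" and x: "x \<in> P" and g: "g \<in> carrier G" for a x g y
    proof -
      have "f (\<beta> (inv\<^bsub>G\<^esub> a \<otimes>\<^bsub>G\<^esub> g) (\<beta> a x), y) = f (\<beta> (a \<otimes>\<^bsub>G\<^esub> (inv\<^bsub>G\<^esub> a \<otimes>\<^bsub>G\<^esub> g)) x, y)"
        using perm_rep_mult[OF V sl(2) a, of "inv\<^bsub>G\<^esub> a \<otimes>\<^bsub>G\<^esub> g" x] a g x by simp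
      also have "a \<otimes>\<^bsub>G\<^esub> (inv\<^bsub>G\<^esub> a \<otimes>\<^bsub>G\<^esub> g) = g" using a g by (simp add: G.m_assoc[symmetric])
      finally show ?thesis using a g x perm_repD(8)[OF V a x] by (simp add: F_def)
    qed
    ultimately have "F \<in> A" using A_iff by blast
    moreover have "F \<circ> ?J = f"
    proof
      fix p :: "'x \<times> 'y"
      obtain x y where p: "p = (x, y)" by fastforce
      show "(F \<circ> ?J) p = f p"
        using perm_rep_one[OF V sl(2)] perm_repD(7)[OF V sl(2)] by (simp add: p F_def)
    qed
    ultimately show "f \<in> (\<lambda>F. F \<circ> ?J) ` A" by blast
  qed
  moreover have "cfun.subspace A"
    unfolding A_def using subspace_fixed_space[OF perm_repD(1)[OF perm_rep_tensor[OF G(1) V I]]] .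
  ultimately show ?thesis using dim_comp[OF _ inj] by (simp add: A_def)
qed

section \<open>Harmonic functions from one slice\<close>

definition lift_fun :: "nat \<Rightarrow> nat list \<Rightarrow> (nat set list \<Rightarrow> complex) \<Rightarrow> nat set list \<Rightarrow> complex"
  where "lift_fun r d u T =
    (if T \<in> tabs (r # d) \<and> hd T = {Suc (sum_list d)..r + sum_list d} then u (tl T) else 0)"

definition restrict_perm :: "'a set \<Rightarrow> ('a \<Rightarrow> 'a) \<Rightarrow> 'a \<Rightarrow> 'a"
  where "restrict_perm S h = (\<lambda>i. if i \<in> S then h i else i)"

lemma restrict_perm_permutes:
  assumes "inj h" "h ` S = S"
  shows "restrict_perm S h permutes S"
proof (rule bij_imp_permutes)
  have "bij_betw h S S" using assms by (auto simp: bij_betw_def intro: inj_on_subset)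
  then show "bij_betw (restrict_perm S h) S S"
    by (subst bij_betw_cong[of S _ h]) (auto simp: restrict_perm_def)
qed (simp add: restrict_perm_def)

lemma specht_zero: "u \<in> rep_space (specht d) \<Longrightarrow> T \<notin> tabs d \<Longrightarrow> u T = 0"
  using specht_funs_on by (auto simp: funs_on_def)

lemma lift_fun_lift_row:
  assumes u: "u \<in> rep_space (specht d)" and h: "h permutes {1..r + sum_list d}"
  shows "lift_fun r d u (tab_act h (lift_row r d T)) =
    (if h ` {1..sum_list d} = {1..sum_list d} then u (tab_act (restrict_perm {1..sum_list d} h) T) else 0)"
proof (cases "T \<in> tabs d")
  case False
  have "tab_act h (lift_row r d T) \<notin> tabs (r # d)"
    using tab_act_tabs_on_permutes[of h "{1..sum_list (r # d)}" "lift_row r d T" "r # d"] h False by simp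
  moreover have "u (tab_act (restrict_perm {1..sum_list d} h) T) = 0" if "h ` {1..sum_list d} = {1..sum_list d}"
    using tab_act_tabs_on_permutes[OF restrict_perm_permutes[OF permutes_inj[OF h] that], of T d] False
    by (intro specht_zero[OF u]) simp
  ultimately show ?thesis by (simp add: lift_fun_def)
next
  case True
  let ?k = "sum_list d" and ?n = "r + sum_list d"
  have in_tabs: "tab_act h (lift_row r d T) \<in> tabs (r # d)"
    using tab_act_tabs_on_permutes[of h "{1..sum_list (r # d)}" "lift_row r d T" "r # d"] h True by simp
  have hd: "hd (tab_act h (lift_row r d T)) = h ` {Suc ?k..?n}" by (simp add: lift_row_def)
  have co: "{Suc ?k..?n} = {1..?n} - {1..?k}" by auto
  have im: "h ` {Suc ?k..?n} = {1..?n} - h ` {1..?k}"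
    unfolding co image_set_diff[OF permutes_inj[OF h]] permutes_image[OF h] ..
  have sub: "h ` {1..?k} \<subseteq> {1..?n}" using permutes_image[OF h] by auto
  have "h ` {Suc ?k..?n} = {Suc ?k..?n} \<longleftrightarrow> h ` {1..?k} = {1..?k}"
  proof -
    have "{1..?n} - A = {1..?n} - B \<longleftrightarrow> A = B" if "A \<subseteq> {1..?n}" "B \<subseteq> {1..?n}" for A B :: "nat set"
      using that by blast
    from this[OF sub, of "{1..?k}"] show ?thesis by (metis im co atLeastatMost_subset_iff le_add2 order_refl)
  qed
  moreover have "tl (tab_act h (lift_row r d T)) = tab_act (restrict_perm {1..?k} h) T"
  proof -
    have "tab_act h T = tab_act (restrict_perm {1..?k} h) T"
      by (rule tab_act_cong) (use tabs_on_Union[OF True] in \<open>simp add: restrict_perm_def\<close>)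
    then show ?thesis by (simp add: lift_row_def)
  qed
  ultimately show ?thesis using in_tabs hd by (simp add: lift_fun_def)
qed

definition swap_on :: "('a \<Rightarrow> 'a) \<Rightarrow> 'a set \<Rightarrow> 'a \<Rightarrow> 'a"
  where "swap_on \<tau> E = (\<lambda>x. if x \<in> E \<union> \<tau> ` E then \<tau> x else x)"

text \<open>Here \<open>\<gamma>\<close> places the slice at the lower entries \<open>\<gamma> ` {1..sum_list d}\<close>, and \<open>\<tau>\<close> is meant to be an
  involution that matches each of them with a partner outside this set.\<close>

definition alternating_lift ::
  "nat \<Rightarrow> nat list \<Rightarrow> (nat \<Rightarrow> nat) \<Rightarrow> (nat \<Rightarrow> nat) \<Rightarrow> (nat set list \<Rightarrow> complex) \<Rightarrow> nat set list \<Rightarrow> complex"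
  where "alternating_lift r d \<gamma> \<tau> u T = (\<Sum>E\<in>Pow (\<gamma> ` {1..sum_list d}).
    (-1) ^ card E * lift_fun r d u (tab_act (inv' \<gamma> \<circ> swap_on \<tau> E) T))"

context
  fixes \<tau> :: "nat \<Rightarrow> nat" and n :: nat and Z :: "nat set"
  assumes \<tau>: "\<tau> permutes {1..n}" "\<And>x. \<tau> (\<tau> x) = x" and Z: "Z \<subseteq> {1..n}" "\<tau> ` Z \<inter> Z = {}"
begin

lemma swap_on_involution: "swap_on \<tau> E (swap_on \<tau> E x) = x"
  using \<tau>(2) by (auto simp: swap_on_def)

lemma swap_on_permutes:
  assumes "E \<subseteq> {1..n}"
  shows "swap_on \<tau> E permutes {1..n}"
proof (rule bij_imp_permutes)
  have in_n: "\<tau> x \<in> {1..n} \<longleftrightarrow> x \<in> {1..n}" for x using permutes_in_image[OF \<tau>(1)] .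
  then have "swap_on \<tau> E x \<in> {1..n}" if "x \<in> {1..n}" for x using that by (auto simp: swap_on_def)
  then show "bij_betw (swap_on \<tau> E) {1..n} {1..n}"
    by (intro bij_betw_byWitness[where f' = "swap_on \<tau> E"]) (auto simp: swap_on_involution)
  show "swap_on \<tau> E x = x" if "x \<notin> {1..n}" for x
  proof -
    have "x \<notin> E \<union> \<tau> ` E" using that assms in_n by blast
    then show ?thesis by (simp add: swap_on_def)
  qed
qed

lemma swap_on_image:
  assumes "E \<subseteq> Z"
  shows "swap_on \<tau> E ` Z = (Z - E) \<union> \<tau> ` E"
proof -
  have "swap_on \<tau> E x = (if x \<in> E then \<tau> x else x)" if "x \<in> Z" for x
    using that Z(2) assms by (auto simp: swap_on_def)
  then have "swap_on \<tau> E ` Z = (\<lambda>x. if x \<in> E then \<tau> x else x) ` Z" by (intro image_cong) auto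
  also have "\<dots> = (Z - E) \<union> \<tau> ` E" using assms by auto
  finally show ?thesis .
qed

lemma swap_on_transpose:
  assumes E: "E \<subseteq> Z" and z: "z \<in> Z"
  shows "swap_on \<tau> E \<circ> transpose z (\<tau> z) = swap_on \<tau> (if z \<in> E then E - {z} else insert z E)"
proof
  fix x
  have inj: "\<tau> a = \<tau> b \<longleftrightarrow> a = b" for a b using \<tau>(2) by metis
  have \<tau>E: "\<tau> a \<notin> E" if "a \<in> Z" for a using that Z(2) E by auto
  have nz: "\<tau> z \<noteq> z" using Z(2) z by (metis disjoint_iff imageI)
  have im: "\<tau> a \<in> \<tau> ` F \<longleftrightarrow> a \<in> F" for a F using inj by auto
  have im': "a \<in> \<tau> ` F \<longleftrightarrow> \<tau> a \<in> F" for a F using \<tau>(2) by (metis image_iff)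
  show "(swap_on \<tau> E \<circ> transpose z (\<tau> z)) x = swap_on \<tau> (if z \<in> E then E - {z} else insert z E) x"
    using nz \<tau>E[OF z] \<tau>(2)
    by (cases "x = z"; cases "x = \<tau> z") (auto simp: swap_on_def im' transpose_def inj)
qed

end

text \<open>The slices are sums of translates of \<open>u\<close>.  For harmonicity, note that the alternating lift is supported
  on tabloids whose lower entries contain exactly one of each pair \<open>z, \<tau> z\<close>, and that it changes sign
  when \<open>z\<close> and \<open>\<tau> z\<close> are exchanged.  In a harmonic relation the nonzero terms therefore cancel in pairs:
  if \<open>i\<close> may be exchanged with \<open>x\<close>, it may also be exchanged with \<open>\<tau> x\<close>, with the opposite value.\<close>

lemma alternating_lift_in_specht:
  assumes Y: "young_diagram (r # d)" and u: "u \<in> rep_space (specht d)"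
    and \<gamma>: "\<gamma> permutes {1..r + sum_list d}"
    and \<tau>: "\<tau> permutes {1..r + sum_list d}" "\<And>x. \<tau> (\<tau> x) = x"
      "\<tau> ` \<gamma> ` {1..sum_list d} \<inter> \<gamma> ` {1..sum_list d} = {}"
  shows "alternating_lift r d \<gamma> \<tau> u \<in> rep_space (specht (r # d))"
proof -
  let ?k = "sum_list d" and ?n = "r + sum_list d" and ?v = "alternating_lift r d \<gamma> \<tau> u"
  define Z where "Z = \<gamma> ` {1..?k}"
  have Zn: "Z \<subseteq> {1..?n}" using permutes_image[OF \<gamma>] by (auto simp: Z_def)
  have \<tau>Z: "\<tau> ` Z \<inter> Z = {}" using \<tau>(3) by (simp add: Z_def)
  have finZ: "finite Z" by (simp add: Z_def)
  note swap = swap_on_permutes[OF \<tau>(1,2) Zn \<tau>Z] and image = swap_on_image[OF \<tau>(1,2) Zn \<tau>Z]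
    and trans = swap_on_transpose[OF \<tau>(1,2) Zn \<tau>Z] and invol = swap_on_involution[OF \<tau>(1,2) Zn \<tau>Z]
  define g where "g E = inv' \<gamma> \<circ> swap_on \<tau> E" for E
  have v_eq: "?v T = (\<Sum>E\<in>Pow Z. (-1) ^ card E * lift_fun r d u (tab_act (g E) T))" for T
    by (simp add: alternating_lift_def Z_def g_def)
  have g_perm: "g E permutes {1..?n}" if "E \<subseteq> Z" for E
    unfolding g_def using permutes_compose[OF swap permutes_inv[OF \<gamma>]] that Zn by blast
  have "?v \<in> harmonic_space r d"
    unfolding harmonic_space_def mem_Collect_eq
  proof (intro conjI allI impI)
    have "lift_fun r d u (tab_act (g E) T) = 0" if "T \<notin> tabs (r # d)" "E \<subseteq> Z" for E T
      using tab_act_tabs_on_permutes[of "g E" "{1..sum_list (r # d)}" T "r # d"] g_perm[OF that(2)] that(1)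
      by (simp add: lift_fun_def)
    then show "?v \<in> funs_on (tabs (r # d))" by (auto simp: funs_on_def v_eq intro!: sum.neutral)
  next
    fix h assume h: "h permutes {1..?n}"
    have "?v \<circ> tab_act h \<circ> lift_row r d =
      (\<Sum>E\<in>Pow Z. cscale ((-1) ^ card E) (\<lambda>T. lift_fun r d u (tab_act (g E \<circ> h) (lift_row r d T))))"
      by (rule ext) (simp only: comp_apply v_eq tab_act_comp fun_app)
    also have "\<dots> \<in> rep_space (specht d)"
    proof (intro cfun.subspace_sum[OF subspace_specht] cfun.subspace_scale[OF subspace_specht])
      fix E assume E: "E \<in> Pow Z"
      have p: "g E \<circ> h permutes {1..?n}" using permutes_compose[OF h g_perm] E by blast
      let ?h = "g E \<circ> h"
      have e: "(\<lambda>T. lift_fun r d u (tab_act ?h (lift_row r d T))) =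
          (if ?h ` {1..?k} = {1..?k} then u \<circ> tab_act (restrict_perm {1..?k} ?h) else 0)"
        proof
          fix T
          show "lift_fun r d u (tab_act ?h (lift_row r d T)) =
              (if ?h ` {1..?k} = {1..?k} then u \<circ> tab_act (restrict_perm {1..?k} ?h) else 0) T"
            unfolding lift_fun_lift_row[OF u p] by (cases "?h ` {1..?k} = {1..?k}") (simp_all only: if_True if_False comp_apply zero_fun_apply simp_thms)
        qed
      show "(\<lambda>T. lift_fun r d u (tab_act ?h (lift_row r d T))) \<in> rep_space (specht d)"
        unfolding e
        using specht_invariant[OF restrict_perm_permutes[OF permutes_inj[OF p]] u]
          cfun.subspace_0[OF subspace_specht] by simp
    qed
    finally show "?v \<circ> tab_act h \<circ> lift_row r d \<in> rep_space (specht d)" .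
  next
    show "harmonic (r # d) ?v"
      unfolding harmonic_def
    proof (intro ballI)
      fix T i assume T: "T \<in> tabs (r # d)" and i: "i \<in> {1..sum_list (r # d)} - hd T"
      obtain R T' where TR: "T = R # T'" "R \<subseteq> {1..?n}" "finite R"
        using T by (auto elim!: tabs_ConsE)
      define A where "A = insert i R"
      have iR: "i \<notin> R" using i TR by simp
      have An: "A \<subseteq> {1..?n}" using i TR by (auto simp: A_def)
      define f where "f x = ?v (tab_act (transpose i x) T)" for x
      have transversal: "\<exists>E\<subseteq>Z. {1..?n} - hd S = swap_on \<tau> E ` Z" if "?v S \<noteq> 0" "S \<in> tabs (r # d)" for S
      proof -
        have "\<exists>E\<in>Pow Z. lift_fun r d u (tab_act (g E) S) \<noteq> 0"
        proof (rule ccontr)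
          assume "\<not> ?thesis"
          then have "?v S = 0" unfolding v_eq by (intro sum.neutral) (simp del: map_map)
          then show False using that(1) by blast
        qed
        then obtain E where E: "E \<subseteq> Z" "lift_fun r d u (tab_act (g E) S) \<noteq> 0" by blast
        have "g E ` hd S = {Suc ?k..?n}"
          using E(2) hd_tab_act[OF that(2)] by (auto simp: lift_fun_def split: if_splits)
        then have "g E ` ({1..?n} - hd S) = {1..?n} - {Suc ?k..?n}"
          unfolding image_set_diff[OF permutes_inj[OF g_perm[OF E(1)]]] permutes_image[OF g_perm[OF E(1)]] by simp
        then have "g E ` ({1..?n} - hd S) = {1..?k}" by auto
        then have "swap_on \<tau> E ` \<gamma> ` (g E ` ({1..?n} - hd S)) = swap_on \<tau> E ` Z" by (simp add: Z_def)
        moreover have "swap_on \<tau> E (\<gamma> (g E x)) = x" for x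
          by (simp add: g_def permutes_inverses[OF \<gamma>] invol)
        ultimately show ?thesis using E(1) by (auto simp: image_image)
      qed
      have anti: "?v (tab_act (transpose z (\<tau> z)) S) = - ?v S" if z: "z \<in> Z" for z S
      proof -
        define \<phi> where "\<phi> E = (if z \<in> E then E - {z} else insert z E)" for E
        have \<phi>\<phi>: "\<phi> (\<phi> E) = E" for E by (auto simp: \<phi>_def)
        have \<phi>Z: "\<phi> E \<subseteq> Z" if "E \<subseteq> Z" for E using that z by (auto simp: \<phi>_def)
        have gE: "tab_act (g E) (tab_act (transpose z (\<tau> z)) S) = tab_act (g (\<phi> E)) S" if "E \<subseteq> Z" for E
        proof -
          have "g E \<circ> transpose z (\<tau> z) = g (\<phi> E)"
            using trans[OF that z] by (simp add: g_def \<phi>_def comp_assoc)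
          then show ?thesis by (simp only: tab_act_comp)
        qed
        have sgn: "(-1) ^ card (\<phi> E) = - ((-1) ^ card E :: complex)" if "E \<subseteq> Z" for E
        proof (cases "z \<in> E")
          case True
          then have "card E = Suc (card (\<phi> E))"
            using finite_subset[OF that finZ] by (simp add: \<phi>_def card_Suc_Diff1 del: card_Diff_insert)
          then show ?thesis by simp
        next
          case False
          then show ?thesis using finite_subset[OF that finZ] by (simp add: \<phi>_def)
        qed
        have "?v (tab_act (transpose z (\<tau> z)) S) =
            (\<Sum>E\<in>Pow Z. (-1) ^ card E * lift_fun r d u (tab_act (g (\<phi> E)) S))"
          unfolding v_eq by (intro sum.cong) (auto simp: gE simp del: map_map)
        also have "\<dots> = (\<Sum>E\<in>Pow Z. - ((-1) ^ card E * lift_fun r d u (tab_act (g E) S)))"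
          by (rule sum.reindex_bij_witness[where i = \<phi> and j = \<phi>])
            (use \<phi>\<phi> \<phi>Z in \<open>auto simp: sgn simp del: map_map\<close>)
        finally show ?thesis by (simp add: sum_negf v_eq)
      qed
      \<comment> \<open>Outside \<open>D\<close> the involution \<open>\<tau>\<close> may leave \<open>A\<close>.\<close>
      define D where "D = {x \<in> A. f x \<noteq> 0}"
      have step: "\<tau> x \<in> D \<and> f (\<tau> x) = - f x" if x: "x \<in> D" for x
      proof -
        have xA: "x \<in> A" and fx: "f x \<noteq> 0" using x by (auto simp: D_def)
        let ?S = "tab_act (transpose i x) T"
        have "transpose i x permutes {1..?n}" using i xA An by (intro permutes_swap_id) auto
        then have S: "?S \<in> tabs (r # d)"
          using tab_act_tabs_on_permutes[of "transpose i x" "{1..sum_list (r # d)}" T "r # d"] T by simp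
        have hdS: "hd ?S = A - {x}"
        proof (cases "x = i")
          case True
          then show ?thesis using iR by (simp add: TR A_def)
        next
          case False
          then have "x \<in> R" using xA by (simp add: A_def)
          then show ?thesis
            using transpose_image_swap[of x R i] iR False by (auto simp: TR(1) A_def transpose_commute)
        qed
        obtain E where E: "E \<subseteq> Z" "{1..?n} - hd ?S = (Z - E) \<union> \<tau> ` E"
          using transversal[OF fx[unfolded f_def] S] image by auto
        have "x \<in> (Z - E) \<union> \<tau> ` E" using E(2) hdS xA An by auto
        then have xz: "x \<in> Z - E \<or> (\<exists>z\<in>E. x = \<tau> z)" by auto
        then have neq: "\<tau> x \<noteq> x"
        proof
          assume "x \<in> Z - E"
          then show ?thesis using \<tau>Z by auto
        next
          assume "\<exists>z\<in>E. x = \<tau> z"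
          then obtain z where "z \<in> E" "x = \<tau> z" by blast
          then show ?thesis using \<tau>Z E(1) \<tau>(2)[of z] by auto
        qed
        have "\<tau> x \<notin> (Z - E) \<union> \<tau> ` E"
        proof
          assume "\<tau> x \<in> (Z - E) \<union> \<tau> ` E"
          then consider "\<tau> x \<in> Z - E" | "x \<in> E" using \<tau>(2) by (metis UnE imageE)
          then show False
          proof cases
            case 1
            have "x \<notin> Z" using 1 \<tau>Z by auto
            then obtain z where "z \<in> E" "x = \<tau> z" using xz by blast
            then show False using 1 \<tau>(2) by auto
          next
            case 2
            then obtain z where "z \<in> E" "x = \<tau> z" using xz by blast
            then show False using 2 E(1) \<tau>Z by auto
          qed
        qed
        moreover have "\<tau> x \<in> {1..?n}" using permutes_in_image[OF \<tau>(1)] xA An by blast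
        ultimately have \<tau>xA: "\<tau> x \<in> A" using E(2) hdS by blast
        have "tab_act (transpose i (\<tau> x)) T = tab_act (transpose x (\<tau> x)) ?S"
          unfolding TR(1)
          by (rule tab_act_transpose_exchange[OF T[unfolded TR(1)] iR])
            (use xA \<tau>xA neq in \<open>auto simp: A_def\<close>)
        moreover have "?v (tab_act (transpose x (\<tau> x)) ?S) = - ?v ?S"
        proof (cases "x \<in> Z")
          case True
          then show ?thesis using anti by blast
        next
          case False
          then obtain z where "z \<in> Z" "x = \<tau> z" using xz E(1) by blast
          then show ?thesis using anti[of z ?S] \<tau>(2) by (simp only: transpose_commute[of "\<tau> z" z])
        qed
        ultimately have "f (\<tau> x) = - f x" by (simp only: f_def)
        then show ?thesis using \<tau>xA fx by (simp add: D_def)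
      qed
      have "sum f D = 0"
        by (rule sum_sign_reversing_involution[where \<phi> = \<tau>]) (use step \<tau>(2) in auto)
      moreover have "sum f A = sum f D"
        using TR(3) by (intro sum.mono_neutral_right) (auto simp: D_def A_def)
      moreover have "sum f A = f i + sum f R" using TR(3) iR by (simp add: A_def)
      moreover have "f i = ?v T" by (simp add: f_def)
      moreover have "(\<Sum>x\<in>hd T. ?v (tab_act (transpose i x) T)) = sum f R"
        by (rule sum.cong) (simp_all add: TR(1) f_def)
      ultimately show "?v T + (\<Sum>x\<in>hd T. ?v (tab_act (transpose i x) T)) = 0" by simp
    qed
  qed
  then show ?thesis using specht_absolutely_simple(2)[OF Y refl] by simp
qed

section \<open>Kronecker coefficients as dimensions\<close>

definition kronecker_space :: "nat list \<Rightarrow> nat list \<Rightarrow> nat list \<Rightarrow> (nat set list \<times> nat set list \<times> nat set list \<Rightarrow> complex) set"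
  where "kronecker_space L M S =
    fixed_space (sym_group (sum_list S)) (tensor_rep (specht S) (tensor_rep (specht L) (specht M)))"

lemma perm_rep_specht_tensor:
  assumes "sum_list L = n" "sum_list M = n"
  shows "perm_rep (sym_group n) (tensor_rep (specht L) (specht M)) (tabs L \<times> tabs M)
    (\<lambda>p (U, U'). (tab_pull p U, tab_pull p U'))"
  using perm_rep_tensor[OF sym_group_is_group, of n "specht L" "tabs L" tab_pull "specht M" "tabs M" tab_pull]
    perm_rep_specht[of L] perm_rep_specht[of M] assms by simp

lemma kronecker_coeff_eq_dim:
  assumes "young_diagram S" "sum_list L = sum_list S" "sum_list M = sum_list S"
  shows "kronecker_coeff L M S = cfun.dim (kronecker_space L M S)"
  unfolding kronecker_coeff_def kronecker_space_def
  by (rule multiplicity_eq_dim_fixed[OF sym_group_is_group finite_sym_group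
        specht_absolutely_simple(1)[OF assms(1)] perm_rep_specht_tensor[OF assms(2,3)]])

lemma kronecker_space_iff:
  assumes "sum_list L = sum_list S" "sum_list M = sum_list S"
  shows "F \<in> kronecker_space L M S \<longleftrightarrow>
    F \<in> tensor_space (rep_space (specht S)) (tensor_space (rep_space (specht L)) (rep_space (specht M))) \<and>
    (\<forall>p. p permutes {1..sum_list S} \<longrightarrow> (\<forall>T\<in>tabs S. \<forall>U\<in>tabs L. \<forall>U'\<in>tabs M.
       F (tab_act p T, (tab_act p U, tab_act p U')) = F (T, (U, U'))))"
  unfolding kronecker_space_def fixed_tensor_iff[OF perm_rep_specht perm_rep_specht_tensor[OF assms]]
  using all_tab_pull_iff[of "sum_list S" "\<lambda>f. \<forall>T\<in>tabs S. \<forall>U\<in>tabs L. \<forall>U'\<in>tabs M. F (f T, (f U, f U')) = F (T, (U, U'))"]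
  by auto

section \<open>Littlewood-Richardson coefficients as dimensions\<close>

lemma young_embedding_apply:
  assumes "p permutes {1..a}" "q permutes {1..b}"
  shows "i \<le> a \<Longrightarrow> young_embedding a (p, q) i = p i" "i \<le> a \<Longrightarrow> p i \<le> a"
    "a < i \<Longrightarrow> young_embedding a (p, q) i = q (i - a) + a" "a < i \<Longrightarrow> 0 < q (i - a)"
proof -
  show "i \<le> a \<Longrightarrow> young_embedding a (p, q) i = p i" "a < i \<Longrightarrow> young_embedding a (p, q) i = q (i - a) + a"
    by (simp_all add: young_embedding_def)
  show "i \<le> a \<Longrightarrow> p i \<le> a"
    using permutes_in_image[OF assms(1), of i] assms(1) by (cases "i = 0") (auto simp: permutes_def)
  have "q 0 = 0" using assms(2) by (auto simp: permutes_def)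
  then show "a < i \<Longrightarrow> 0 < q (i - a)"
    using permutes_inj[OF assms(2)] by (metis inj_eq neq0_conv zero_less_diff)
qed

lemma young_embedding_comp:
  assumes "p permutes {1..a}" "q permutes {1..b}" "p' permutes {1..a}" "q' permutes {1..b}"
  shows "young_embedding a (p \<circ> p', q \<circ> q') = young_embedding a (p, q) \<circ> young_embedding a (p', q')"
proof
  fix i
  show "young_embedding a (p \<circ> p', q \<circ> q') i = (young_embedding a (p, q) \<circ> young_embedding a (p', q')) i"
    using young_embedding_apply[OF assms(3,4), of i]
    by (cases "i \<le> a") (simp_all add: young_embedding_def)
qed

lemma young_embedding_permutes:
  assumes "p permutes {1..a}" "q permutes {1..b}"
  shows "young_embedding a (p, q) permutes {1..a + b}"
    and "inv' (young_embedding a (p, q)) = young_embedding a (inv' p, inv' q)"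
proof -
  note inv = permutes_inv[OF assms(1)] permutes_inv[OF assms(2)]
  have id: "young_embedding a (id, id) = id" by (auto simp: young_embedding_def fun_eq_iff)
  have 1: "young_embedding a (p, q) \<circ> young_embedding a (inv' p, inv' q) = id"
    unfolding young_embedding_comp[OF assms inv, symmetric]
    by (simp only: permutes_inv_o[OF assms(1)] permutes_inv_o[OF assms(2)] id)
  have 2: "young_embedding a (inv' p, inv' q) \<circ> young_embedding a (p, q) = id"
    unfolding young_embedding_comp[OF inv assms, symmetric]
    by (simp only: permutes_inv_o[OF assms(1)] permutes_inv_o[OF assms(2)] id)
  have out: "young_embedding a (p, q) x = x" if "x \<notin> {1..a + b}" for x
  proof (cases "x \<le> a")
    case True
    then have "x \<notin> {1..a}" using that by auto
    then show ?thesis using True assms(1) by (simp add: young_embedding_def permutes_def)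
  next
    case False
    then have "x - a \<notin> {1..b}" using that by auto
    then have "q (x - a) = x - a" using assms(2) by (simp add: permutes_def)
    then show ?thesis using False by (simp add: young_embedding_def)
  qed
  have bij: "bij (young_embedding a (p, q))" using 1 2 o_bij by blast
  then show "young_embedding a (p, q) permutes {1..a + b}"
    unfolding permutes_def using out by (simp add: bij_iff)
  show "inv' (young_embedding a (p, q)) = young_embedding a (inv' p, inv' q)"
    using inv_unique_comp[OF 1 2] .
qed

lemma young_embedding_hom:
  "young_embedding a \<in> hom (sym_group a \<times>\<times> sym_group b) (sym_group (a + b))"
  using young_embedding_permutes(1) young_embedding_comp
  by (auto simp: hom_def DirProd_def sym_group_def)

lemma perm_rep_outer_specht:
  "perm_rep (sym_group (sum_list l) \<times>\<times> sym_group (sum_list m)) (outer_tensor_rep (specht l) (specht m))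
    (tabs l \<times> tabs m) (\<lambda>h (U, U'). (tab_pull (fst h) U, tab_pull (snd h) U'))"
proof -
  have "monoid (sym_group (sum_list l) \<times>\<times> sym_group (sum_list m))"
    using DirProd_group[OF sym_group_is_group sym_group_is_group] group.is_monoid by blast
  moreover have "(\<lambda>(g, h). tensor_map (rep_act (specht l) g) (rep_act (specht m) h)) =
      (\<lambda>a. tensor_map (rep_act (specht l) (fst a)) (rep_act (specht m) (snd a)))" by auto
  ultimately show ?thesis
    unfolding outer_tensor_rep_def
    by (simp only:) (rule perm_rep_tensor_along[OF perm_rep_specht perm_rep_specht];
        auto simp: DirProd_def sym_group_def)
qed

definition lr_space :: "nat list \<Rightarrow> nat list \<Rightarrow> nat list \<Rightarrow> (nat set list \<times> nat set list \<times> nat set list \<Rightarrow> complex) set"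
  where "lr_space l m s =
    {f \<in> tensor_space (rep_space (specht s)) (tensor_space (rep_space (specht l)) (rep_space (specht m))).
      \<forall>p q. p permutes {1..sum_list l} \<longrightarrow> q permutes {1..sum_list m} \<longrightarrow>
        (\<forall>T\<in>tabs s. \<forall>U\<in>tabs l. \<forall>U'\<in>tabs m.
          f (tab_act (young_embedding (sum_list l) (p, q)) T, (tab_act p U, tab_act q U')) = f (T, (U, U')))}"

lemma lr_coeff_eq_dim:
  assumes "young_diagram s" and sz: "sum_list s = sum_list l + sum_list m"
  shows "lr_coeff l m s = cfun.dim (lr_space l m s)"
proof -
  let ?a = "sum_list l" and ?b = "sum_list m"
  let ?G = "sym_group (sum_list s)" and ?H = "sym_group ?a \<times>\<times> sym_group ?b"
  have \<iota>: "young_embedding ?a \<in> hom ?H ?G" unfolding sz by (rule young_embedding_hom)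
  have H: "group ?H" by (rule DirProd_group[OF sym_group_is_group sym_group_is_group])
  have I: "perm_rep ?G (induced_rep ?G ?H (young_embedding ?a) (outer_tensor_rep (specht l) (specht m)))
      (carrier ?G \<times> (tabs l \<times> tabs m)) (\<lambda>a (g, x). (inv\<^bsub>?G\<^esub> a \<otimes>\<^bsub>?G\<^esub> g, x))"
    by (rule perm_rep_induced[OF sym_group_is_group finite_sym_group H perm_rep_outer_specht])
      (use \<iota> in \<open>auto simp: hom_def\<close>)
  have "lr_coeff l m s = cfun.dim (fixed_space ?G (tensor_rep (specht s)
      (induced_rep ?G ?H (young_embedding ?a) (outer_tensor_rep (specht l) (specht m)))))"
    unfolding lr_coeff_def
    by (rule multiplicity_eq_dim_fixed[OF sym_group_is_group finite_sym_group specht_absolutely_simple(1)[OF assms(1)] I])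
  also have "\<dots> = cfun.dim {f \<in> tensor_space (rep_space (specht s)) (rep_space (outer_tensor_rep (specht l) (specht m))).
      \<forall>h\<in>carrier ?H. \<forall>x\<in>tabs s. \<forall>y\<in>tabs l \<times> tabs m.
        f (tab_pull (young_embedding ?a h) x, (\<lambda>(U, U'). (tab_pull (fst h) U, tab_pull (snd h) U')) y) = f (x, y)}"
    by (rule frobenius_reciprocity[OF sym_group_is_group finite_sym_group H perm_rep_specht perm_rep_outer_specht \<iota>])
  also have "\<dots> = cfun.dim (lr_space l m s)"
  proof (rule arg_cong[where f = cfun.dim])
    have pull: "tab_pull p = tab_act (inv' p)" if "p permutes {1..n}" for p n
      using map_vimage_eq[OF that] by (rule ext)
    have pull_y: "tab_pull (young_embedding ?a (p, q)) = tab_act (young_embedding ?a (inv' p, inv' q))"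
      if "p permutes {1..?a}" "q permutes {1..?b}" for p q
      unfolding pull[OF young_embedding_permutes(1)[OF that]] young_embedding_permutes(2)[OF that] ..
    have inv_inv: "inv' (inv' p) = p" if "p permutes {1..n}" for p :: "nat \<Rightarrow> nat" and n
      using inv_inv_eq[OF permutes_bij[OF that]] .
    have all: "(\<forall>h\<in>carrier ?H. R (tab_pull (young_embedding ?a h)) (tab_pull (fst h)) (tab_pull (snd h))) \<longleftrightarrow>
        (\<forall>p q. p permutes {1..?a} \<longrightarrow> q permutes {1..?b} \<longrightarrow>
          R (tab_act (young_embedding ?a (p, q))) (tab_act p) (tab_act q))" for R
    proof (intro iffI allI impI ballI)
      fix p q assume R: "\<forall>h\<in>carrier ?H. R (tab_pull (young_embedding ?a h)) (tab_pull (fst h)) (tab_pull (snd h))"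
        and p: "p permutes {1..?a}" and q: "q permutes {1..?b}"
      have "(inv' p, inv' q) \<in> carrier ?H"
        using permutes_inv[OF p] permutes_inv[OF q] by (simp add: DirProd_def sym_group_def)
      from bspec[OF R this] show "R (tab_act (young_embedding ?a (p, q))) (tab_act p) (tab_act q)"
        by (simp only: fst_conv snd_conv pull_y[OF permutes_inv[OF p] permutes_inv[OF q]]
            pull[OF permutes_inv[OF p]] pull[OF permutes_inv[OF q]] inv_inv[OF p] inv_inv[OF q])
    next
      fix h assume R: "\<forall>p q. p permutes {1..?a} \<longrightarrow> q permutes {1..?b} \<longrightarrow>
          R (tab_act (young_embedding ?a (p, q))) (tab_act p) (tab_act q)" and "h \<in> carrier ?H"
      then obtain p q where h: "h = (p, q)" and p: "p permutes {1..?a}" and q: "q permutes {1..?b}"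
        by (auto simp: DirProd_def sym_group_def)
      show "R (tab_pull (young_embedding ?a h)) (tab_pull (fst h)) (tab_pull (snd h))"
        unfolding h fst_conv snd_conv pull_y[OF p q] pull[OF p] pull[OF q]
        using R permutes_inv[OF p] permutes_inv[OF q] by blast
    qed
    have sp: "rep_space (outer_tensor_rep (specht l) (specht m)) = tensor_space (rep_space (specht l)) (rep_space (specht m))"
      by (simp add: outer_tensor_rep_def)
    show "{f \<in> tensor_space (rep_space (specht s)) (rep_space (outer_tensor_rep (specht l) (specht m))).
      \<forall>h\<in>carrier ?H. \<forall>x\<in>tabs s. \<forall>y\<in>tabs l \<times> tabs m.
        f (tab_pull (young_embedding ?a h) x, (\<lambda>(U, U'). (tab_pull (fst h) U, tab_pull (snd h) U')) y) = f (x, y)} = lr_space l m s"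
      unfolding lr_space_def sp
    proof (rule Collect_cong, rule conj_cong[OF refl])
      fix f :: "nat set list \<times> nat set list \<times> nat set list \<Rightarrow> complex"
      show "(\<forall>h\<in>carrier ?H. \<forall>x\<in>tabs s. \<forall>y\<in>tabs l \<times> tabs m.
        f (tab_pull (young_embedding ?a h) x, (\<lambda>(U, U'). (tab_pull (fst h) U, tab_pull (snd h) U')) y) = f (x, y)) \<longleftrightarrow>
        (\<forall>p q. p permutes {1..sum_list l} \<longrightarrow> q permutes {1..sum_list m} \<longrightarrow>
        (\<forall>T\<in>tabs s. \<forall>U\<in>tabs l. \<forall>U'\<in>tabs m.
          f (tab_act (young_embedding (sum_list l) (p, q)) T, (tab_act p U, tab_act q U')) = f (T, (U, U'))))"
        using all[of "\<lambda>y p q. \<forall>T\<in>tabs s. \<forall>U\<in>tabs l. \<forall>U'\<in>tabs m. f (y T, (p U, q U')) = f (T, (U, U'))"]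
        by auto
    qed
  qed
  finally show ?thesis .
qed

section \<open>Invariants of three tabloids\<close>

text \<open>For fixed \<open>U\<close> and \<open>U'\<close>, \<open>harmonic_eq_zero\<close> applies to \<open>T \<mapsto> F (T, U, U')\<close> with \<open>B\<close> the union of the lower
  entries of \<open>U\<close> and \<open>U'\<close>.  Counting shows that lower entries of \<open>T\<close> inside \<open>B\<close> must fill \<open>B\<close>, and that
  \<open>B\<close> is then a disjoint union.\<close>

lemma kronecker_space_eq_zero:
  assumes Y: "young_diagram (s # \<sigma>)" and sz: "sum_list (r # l) = sum_list (s # \<sigma>)" "sum_list (r' # m) = sum_list (s # \<sigma>)"
    and le: "sum_list l + sum_list m \<le> sum_list \<sigma>"
    and F: "F \<in> kronecker_space (r # l) (r' # m) (s # \<sigma>)"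
    and zero: "\<And>T U U'. T \<in> tabs (s # \<sigma>) \<Longrightarrow> U \<in> tabs (r # l) \<Longrightarrow> U' \<in> tabs (r' # m) \<Longrightarrow>
      {1..s + sum_list \<sigma>} - hd T = ({1..s + sum_list \<sigma>} - hd U) \<union> ({1..s + sum_list \<sigma>} - hd U') \<Longrightarrow>
      ({1..s + sum_list \<sigma>} - hd U) \<inter> ({1..s + sum_list \<sigma>} - hd U') = {} \<Longrightarrow>
      sum_list \<sigma> = sum_list l + sum_list m \<Longrightarrow> F (T, (U, U')) = 0"
  shows "F = 0"
proof -
  let ?n = "s + sum_list \<sigma>"
  let ?V = "rep_space (specht (s # \<sigma>))" and ?W = "tensor_space (rep_space (specht (r # l))) (rep_space (specht (r' # m)))"
  have n: "sum_list (s # \<sigma>) = ?n" "r + sum_list l = ?n" "r' + sum_list m = ?n" using sz by simp_all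
  have Ft: "F \<in> tensor_space ?V ?W"
    and Fi: "\<And>p T U U'. p permutes {1..?n} \<Longrightarrow> T \<in> tabs (s # \<sigma>) \<Longrightarrow> U \<in> tabs (r # l) \<Longrightarrow> U' \<in> tabs (r' # m) \<Longrightarrow>
       F (tab_act p T, (tab_act p U, tab_act p U')) = F (T, (U, U'))"
    using F unfolding kronecker_space_iff[OF sz] n(1) by blast+
  note sl = tensor_slice[OF subspace_specht subspace_tensor Ft]
  have "(\<lambda>T. F (T, (U, U'))) = 0" if U: "U \<in> tabs (r # l)" and U': "U' \<in> tabs (r' # m)" for U U'
  proof -
    note hU = tabs_Cons_hd[OF U, unfolded n] and hU' = tabs_Cons_hd[OF U', unfolded n]
    let ?X = "{1..?n} - hd U" and ?X' = "{1..?n} - hd U'"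
    have "(\<lambda>T. F (T, (U, U'))) \<in> harmonic_space s \<sigma>"
      using sl(2)[of "(U, U')"] specht_absolutely_simple(2)[OF Y refl] by simp
    then have h: "harmonic (s # \<sigma>) (\<lambda>T. F (T, (U, U')))" "(\<lambda>T. F (T, (U, U'))) \<in> funs_on (tabs (s # \<sigma>))"
      unfolding harmonic_space_def by blast+
    show ?thesis
    proof (rule harmonic_eq_zero[OF h, where B = "?X \<union> ?X'"])
      fix i x T assume ix: "i \<in> {1..?n} - (?X \<union> ?X')" "x \<in> {1..?n} - (?X \<union> ?X')" and T: "T \<in> tabs (s # \<sigma>)"
      have "tab_act (transpose i x) U = U" "tab_act (transpose i x) U' = U'"
        using tab_act_transpose_fix[OF U] tab_act_transpose_fix[OF U'] ix by auto
      moreover have "transpose i x permutes {1..?n}" using ix by (intro permutes_swap_id) auto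
      ultimately show "F (tab_act (transpose i x) T, (U, U')) = F (T, (U, U'))"
        using Fi[OF _ T U U', of "transpose i x"] by (simp only:)
    next
      fix T assume T: "T \<in> tabs (s # \<sigma>)" and sub: "{1..?n} - hd T \<subseteq> ?X \<union> ?X'"
      have c: "card (?X \<union> ?X') + card (?X \<inter> ?X') = sum_list l + sum_list m"
        using card_Un_Int[of ?X ?X'] hU(4) hU'(4) by simp
      have "sum_list \<sigma> \<le> card (?X \<union> ?X')"
        using card_mono[OF _ sub] tabs_Cons_hd(4)[OF T] by simp
      then have e: "card (?X \<union> ?X') = sum_list \<sigma>" "card (?X \<inter> ?X') = 0" "sum_list \<sigma> = sum_list l + sum_list m"
        using c le by linarith+
      have "?X \<inter> ?X' = {}" using e(2) by (simp only: card_0_eq[OF finite_Int[OF disjI1[OF finite_Diff[OF finite_atLeastAtMost]]]])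
      moreover have "{1..?n} - hd T = ?X \<union> ?X'"
        using sub e(1) tabs_Cons_hd(4)[OF T] by (intro card_subset_eq) auto
      ultimately show "F (T, (U, U')) = 0" using zero[OF T U U' _ _ e(3)] by blast
    qed
  qed
  then have in_tabs: "F (T, (U, U')) = 0" if "U \<in> tabs (r # l)" "U' \<in> tabs (r' # m)" for T U U'
    using fun_cong[of "\<lambda>T. F (T, (U, U'))" 0 T] that by (simp add: zero_fun_apply)
  have "?W \<subseteq> funs_on (tabs (r # l) \<times> tabs (r' # m))"
    by (rule tensor_space_funs_on[OF subspace_specht subspace_specht specht_funs_on specht_funs_on])
  then have "F (T, (U, U')) = 0" if "U \<notin> tabs (r # l) \<or> U' \<notin> tabs (r' # m)" for T U U'
    using sl(1)[of T] that by (auto simp: funs_on_def)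
  note out_tabs = this
  show "F = 0"
  proof
    fix p :: "nat set list \<times> nat set list \<times> nat set list"
    obtain T U U' where p: "p = (T, (U, U'))" by (cases p) auto
    show "F p = 0 p"
      unfolding p zero_fun_apply
      by (cases "U \<in> tabs (r # l) \<and> U' \<in> tabs (r' # m)") (blast intro: in_tabs out_tabs)+
  qed
qed

text \<open>The situation of part (b), with first rows \<open>s\<close>, \<open>r\<close>, \<open>r'\<close> on top of the diagrams \<open>\<sigma>\<close>, \<open>l\<close>, \<open>m\<close>.
  The permutation \<open>\<gamma>\<close> carries the entries of tabloids of shape \<open>m\<close> to the numbers on which the second
  factor of \<open>young_embedding (sum_list l)\<close> acts.\<close>

context
  fixes s r r' :: nat and \<sigma> l m :: "nat list" and n :: nat and \<gamma> :: "nat \<Rightarrow> nat"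
  assumes Y: "young_diagram (s # \<sigma>)" "young_diagram (r # l)" "young_diagram (r' # m)"
    and n: "s + sum_list \<sigma> = n" "r + sum_list l = n" "r' + sum_list m = n"
    and k: "sum_list \<sigma> = sum_list l + sum_list m"
    and half: "2 * sum_list \<sigma> \<le> n"
    and \<gamma>: "\<gamma> permutes {1..n}" "\<And>i. i \<in> {1..sum_list m} \<Longrightarrow> \<gamma> i = i + sum_list l"
begin

text \<open>In standard position the lower entries are \<open>{1..sum_list \<sigma>}\<close> for the first tabloid, and its initial
  and final parts of sizes \<open>sum_list l\<close> and \<open>sum_list m\<close> for the other two; this is the partition of
  \<open>young_embedding\<close>.\<close>

definition standard_position :: "nat set list \<times> nat set list \<times> nat set list \<Rightarrow> nat set list \<times> nat set list \<times> nat set list"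
  where "standard_position = (\<lambda>(T, U, U'). (lift_row s \<sigma> T, lift_row r l U, tab_act \<gamma> (lift_row r' m U')))"

lemma sizes: "sum_list (s # \<sigma>) = n" "sum_list (r # l) = n" "sum_list (r' # m) = n"
    "sum_list (r # l) = sum_list (s # \<sigma>)" "sum_list (r' # m) = sum_list (s # \<sigma>)"
  using n by simp_all

lemma \<gamma>_image: "\<gamma> ` {1..sum_list m} = {sum_list l + 1..sum_list \<sigma>}"
proof -
  have "\<gamma> ` {1..sum_list m} = (\<lambda>i. i + sum_list l) ` {1..sum_list m}" using \<gamma>(2) by (intro image_cong) auto
  then show ?thesis unfolding k by (simp add: add.commute)
qed

lemma kronecker_spaceD:
  assumes "F \<in> kronecker_space (r # l) (r' # m) (s # \<sigma>)"
  shows "F \<in> tensor_space (rep_space (specht (s # \<sigma>))) (tensor_space (rep_space (specht (r # l))) (rep_space (specht (r' # m))))"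
    "p permutes {1..n} \<Longrightarrow> T \<in> tabs (s # \<sigma>) \<Longrightarrow> U \<in> tabs (r # l) \<Longrightarrow> U' \<in> tabs (r' # m) \<Longrightarrow>
       F (tab_act p T, (tab_act p U, tab_act p U')) = F (T, (U, U'))"
  using assms unfolding kronecker_space_iff[OF sizes(4,5)] sizes(1) by blast+

lemma tab_act_lift_tabs:
  assumes "d = s # \<sigma> \<or> d = r # l \<or> d = r' # m" "p permutes {1..n}"
  shows "tab_act p T \<in> tabs d \<longleftrightarrow> T \<in> tabs d"
  using tab_act_tabs_on_permutes[of p "{1..sum_list d}" T d] assms sizes by auto

lemma restriction_in_lr_space:
  assumes F: "F \<in> kronecker_space (r # l) (r' # m) (s # \<sigma>)"
  shows "F \<circ> standard_position \<in> lr_space l m \<sigma>"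
proof -
  note Ft = kronecker_spaceD(1)[OF F] and Fi = kronecker_spaceD(2)[OF F]
  note H = specht_absolutely_simple(2)[OF Y(1) refl] specht_absolutely_simple(2)[OF Y(2) refl] specht_absolutely_simple(2)[OF Y(3) refl]
  have slT: "(\<lambda>T. F (T, (U, U'))) \<in> harmonic_space s \<sigma>" for U U'
    using tensor_slice(2)[OF subspace_specht subspace_tensor Ft, of "(U, U')"] H by simp
  have slW: "(\<lambda>y. F (T, y)) \<in> tensor_space (rep_space (specht (r # l))) (rep_space (specht (r' # m)))" for T
    using tensor_slice(1)[OF subspace_specht subspace_tensor Ft, of T] .
  have slU: "(\<lambda>U. F (T, (U, U'))) \<in> harmonic_space r l" for T U'
    using tensor_slice(2)[OF subspace_specht subspace_specht slW, of T U'] H by simp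
  have slU': "(\<lambda>U'. F (T, (U, U'))) \<in> harmonic_space r' m" for T U
    using tensor_slice(1)[OF subspace_specht subspace_specht slW, of T U] H by simp
  note S = perm_repD(2,4,3)[OF perm_rep_specht]
  have "F \<circ> standard_position \<in> tensor_space (rep_space (specht \<sigma>)) (tensor_space (rep_space (specht l)) (rep_space (specht m)))"
  proof (rule tensor_spaceI[OF S])
    show "finite (tabs l \<times> tabs m)" by (simp add: finite_tabs_on)
    show "cfun.subspace (tensor_space (rep_space (specht l)) (rep_space (specht m)))" by (rule subspace_tensor)
    show "tensor_space (rep_space (specht l)) (rep_space (specht m)) \<subseteq> funs_on (tabs l \<times> tabs m)"
      by (rule tensor_space_funs_on[OF subspace_specht subspace_specht specht_funs_on specht_funs_on])
    show "(\<lambda>T. (F \<circ> standard_position) (T, y)) \<in> rep_space (specht \<sigma>)" for y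
      using harmonic_space_slice[OF slT] by (cases y) (simp add: standard_position_def comp_def)
    show "(\<lambda>y. (F \<circ> standard_position) (T, y)) \<in> tensor_space (rep_space (specht l)) (rep_space (specht m))" for T
    proof (rule tensor_spaceI[OF S S])
      show "(\<lambda>U. (F \<circ> standard_position) (T, U, U')) \<in> rep_space (specht l)" for U'
        using harmonic_space_slice[OF slU] by (simp add: standard_position_def comp_def)
      have "\<gamma> permutes {1..r' + sum_list m}" using \<gamma>(1) n by simp
      then have "v \<circ> tab_act \<gamma> \<circ> lift_row r' m \<in> rep_space (specht m)" if "v \<in> harmonic_space r' m" for v
        using that unfolding harmonic_space_def by blast
      from this[OF slU'] show "(\<lambda>U'. (F \<circ> standard_position) (T, U, U')) \<in> rep_space (specht m)" for U
        by (simp add: standard_position_def comp_def)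
    qed
  qed
  moreover have "(F \<circ> standard_position) (tab_act (young_embedding (sum_list l) (p, q)) T, (tab_act p U, tab_act q U'))
      = (F \<circ> standard_position) (T, (U, U'))"
    if p: "p permutes {1..sum_list l}" and q: "q permutes {1..sum_list m}"
      and T: "T \<in> tabs \<sigma>" "U \<in> tabs l" "U' \<in> tabs m" for p q T U U'
  proof -
    let ?y = "young_embedding (sum_list l) (p, q)"
    have y: "?y permutes {1..sum_list \<sigma>}" using young_embedding_permutes(1)[OF p q] k by simp
    have yn: "?y permutes {1..n}" using y n by (auto intro: permutes_subset)
    let ?y' = "inv' \<gamma> \<circ> ?y \<circ> \<gamma>"
    have y'n: "?y' permutes {1..n}"
      using permutes_compose[OF \<gamma>(1) permutes_compose[OF yn permutes_inv[OF \<gamma>(1)]]] by (simp add: comp_assoc)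
    have "?y' i = q i" if i: "i \<in> {1..sum_list m}" for i
    proof -
      have "q i \<in> {1..sum_list m}" using permutes_in_image[OF q] i by blast
      then have "?y (\<gamma> i) = \<gamma> (q i)" using \<gamma>(2) i by (simp add: young_embedding_def)
      then show ?thesis by (simp add: permutes_inverses[OF \<gamma>(1)])
    qed
    then have 3: "tab_act ?y' (lift_row r' m U') = lift_row r' m (tab_act q U')"
      using y'n n by (intro tab_act_lift_row[OF q _ _ T(3)]) auto
    have "\<gamma> \<circ> ?y' = ?y \<circ> \<gamma>" by (simp add: fun_eq_iff permutes_inverses[OF \<gamma>(1)])
    then have "tab_act \<gamma> (tab_act ?y' (lift_row r' m U')) = tab_act ?y (tab_act \<gamma> (lift_row r' m U'))"
      by (simp only: tab_act_comp)
    then have 3: "tab_act \<gamma> (lift_row r' m (tab_act q U')) = tab_act ?y (tab_act \<gamma> (lift_row r' m U'))"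
      unfolding 3 .
    have 1: "lift_row s \<sigma> (tab_act ?y T) = tab_act ?y (lift_row s \<sigma> T)"
      using yn n by (intro tab_act_lift_row[OF y _ _ T(1), symmetric]) auto
    have 2: "lift_row r l (tab_act p U) = tab_act ?y (lift_row r l U)"
      using yn n by (intro tab_act_lift_row[OF p _ _ T(2), symmetric]) (auto simp: young_embedding_def)
    show ?thesis
      unfolding standard_position_def comp_apply prod.case 1 2 3
      using T by (intro Fi[OF yn]) (simp_all only: tab_act_lift_tabs[OF _ \<gamma>(1)] lift_row_in_tabs simp_thms)
  qed
  ultimately show ?thesis unfolding lr_space_def by blast
qed

text \<open>A triple in which the lower entries of \<open>T\<close> are the disjoint union of those of \<open>U\<close> and \<open>U'\<close> is a
  translate of one in standard position.\<close>

lemma restriction_inj: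
  assumes F: "F \<in> kronecker_space (r # l) (r' # m) (s # \<sigma>)" and z: "F \<circ> standard_position = 0"
  shows "F = 0"
proof (rule kronecker_space_eq_zero[OF Y(1) sizes(4,5) _ F])
  show "sum_list l + sum_list m \<le> sum_list \<sigma>" by (simp add: k)
  fix T U U' assume T: "T \<in> tabs (s # \<sigma>)" and U: "U \<in> tabs (r # l)" and U': "U' \<in> tabs (r' # m)"
    and un: "{1..s + sum_list \<sigma>} - hd T = ({1..s + sum_list \<sigma>} - hd U) \<union> ({1..s + sum_list \<sigma>} - hd U')"
    and dis: "({1..s + sum_list \<sigma>} - hd U) \<inter> ({1..s + sum_list \<sigma>} - hd U') = {}"
  let ?X = "{1..n} - hd U" and ?X' = "{1..n} - hd U'"
  have un: "{1..n} - hd T = ?X \<union> ?X'" and dis: "?X \<inter> ?X' = {}" using un dis n by simp_all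
  have "card ?X = sum_list l" "card ?X' = sum_list m"
    using tabs_Cons_hd(4)[OF U] tabs_Cons_hd(4)[OF U'] n by simp_all
  then obtain f f' where f: "bij_betw f {1..sum_list l} ?X" and f': "bij_betw f' {1..sum_list m} ?X'"
    using finite_same_card_bij[of "{1..sum_list l}" ?X] finite_same_card_bij[of "{1..sum_list m}" ?X'] by auto
  define g where "g i = (if i \<le> sum_list l then f i else f' (i - sum_list l))" for i
  have g1: "bij_betw g {1..sum_list l} ?X"
    by (subst bij_betw_cong[of _ g f]) (use f in \<open>simp_all add: g_def\<close>)
  have "bij_betw (\<lambda>i. i - sum_list l) {sum_list l + 1..sum_list \<sigma>} {1..sum_list m}"
    by (rule bij_betw_byWitness[where f' = "\<lambda>i. i + sum_list l"]) (auto simp: k)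
  then have "bij_betw (f' \<circ> (\<lambda>i. i - sum_list l)) {sum_list l + 1..sum_list \<sigma>} ?X'"
    using f' by (rule bij_betw_trans)
  then have g2: "bij_betw g {sum_list l + 1..sum_list \<sigma>} ?X'"
    by (subst bij_betw_cong[of _ g "f' \<circ> (\<lambda>i. i - sum_list l)"]) (simp_all add: g_def)
  have split: "{1..sum_list l} \<union> {sum_list l + 1..sum_list \<sigma>} = {1..sum_list \<sigma>}" by (auto simp: k)
  have g: "bij_betw g {1..sum_list \<sigma>} (?X \<union> ?X')"
    using bij_betw_combine[OF g1 g2 dis] unfolding split .
  obtain h where h: "h permutes {1..n}" "\<And>x. x \<in> {1..sum_list \<sigma>} \<Longrightarrow> h x = g x"
    by (rule extend_to_permutation[of "{1..n}" "{1..sum_list \<sigma>}" g])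
      (use g n in \<open>auto simp: bij_betw_def\<close>)
  have im: "h ` A = g ` A" if "A \<subseteq> {1..sum_list \<sigma>}" for A
    using that h(2) by (intro image_cong) auto
  have imT: "h ` {1..sum_list \<sigma>} = {1..s + sum_list \<sigma>} - hd T"
    unfolding im[OF order_refl] bij_betw_imp_surj_on[OF g] n un ..
  have imU: "h ` {1..sum_list l} = {1..r + sum_list l} - hd U"
    using im[of "{1..sum_list l}"] bij_betw_imp_surj_on[OF g1] by (simp add: n k)
  have imU': "(h \<circ> \<gamma>) ` {1..sum_list m} = {1..r' + sum_list m} - hd U'"
    unfolding image_comp[symmetric] \<gamma>_image
    using im[of "{sum_list l + 1..sum_list \<sigma>}"] bij_betw_imp_surj_on[OF g2] by (simp add: n)
  have hs: "h permutes {1..s + sum_list \<sigma>}" "h permutes {1..r + sum_list l}" "h \<circ> \<gamma> permutes {1..r' + sum_list m}"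
    using h(1) permutes_compose[OF \<gamma>(1) h(1)] n by simp_all
  obtain T0 where T0: "T0 \<in> tabs \<sigma>" "T = tab_act h (lift_row s \<sigma> T0)" using tabs_standard[OF T hs(1) imT] .
  obtain U0 where U0: "U0 \<in> tabs l" "U = tab_act h (lift_row r l U0)" using tabs_standard[OF U hs(2) imU] .
  obtain U0' where U0': "U0' \<in> tabs m" "U' = tab_act (h \<circ> \<gamma>) (lift_row r' m U0')"
    using tabs_standard[OF U' hs(3) imU'] .
  have "F (T, (U, U')) = F (tab_act h (lift_row s \<sigma> T0), (tab_act h (lift_row r l U0), tab_act h (tab_act \<gamma> (lift_row r' m U0'))))"
    unfolding T0(2) U0(2) U0'(2) tab_act_comp ..
  also have "\<dots> = F (lift_row s \<sigma> T0, (lift_row r l U0, tab_act \<gamma> (lift_row r' m U0')))"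
    using T0(1) U0(1) U0'(1)
    by (intro kronecker_spaceD(2)[OF F h(1)]) (simp_all only: tab_act_lift_tabs[OF _ \<gamma>(1)] lift_row_in_tabs simp_thms)
  also have "\<dots> = 0"
    using fun_cong[OF z, of "(T0, U0, U0')"] by (simp add: standard_position_def zero_fun_apply)
  finally show "F (T, (U, U')) = 0" .
qed

section \<open>Extending invariants from the standard position\<close>

text \<open>A matching of the numbers up to \<open>sum_list \<sigma>\<close> with the next \<open>sum_list \<sigma>\<close> numbers.  There is room for it
  by the assumption \<open>2 * sum_list \<sigma> \<le> n\<close>.\<close>

definition partner :: "nat \<Rightarrow> nat"
  where "partner i = (if i \<in> {1..sum_list \<sigma>} then i + sum_list \<sigma>
     else if i \<in> {sum_list \<sigma> + 1..2 * sum_list \<sigma>} then i - sum_list \<sigma> else i)"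

lemma partner_involution: "partner (partner i) = i"
  by (auto simp: partner_def)

lemma partner_permutes: "partner permutes {1..n}"
proof (rule bij_imp_permutes)
  show "bij_betw partner {1..n} {1..n}"
    by (rule bij_betw_byWitness[where f' = partner])
      (use half in \<open>auto simp: partner_involution, auto simp: partner_def\<close>)
  show "partner i = i" if "i \<notin> {1..n}" for i using that half by (auto simp: partner_def)
qed

lemma partner_disjoint: "A \<subseteq> {1..sum_list \<sigma>} \<Longrightarrow> B \<subseteq> {1..sum_list \<sigma>} \<Longrightarrow> partner ` A \<inter> B = {}"
  by (auto simp: partner_def)

lemma swap_image: "E \<subseteq> Z \<Longrightarrow> Z \<subseteq> {1..sum_list \<sigma>} \<Longrightarrow> swap_on partner E ` Z = (Z - E) \<union> partner ` E"
proof -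
  assume E: "E \<subseteq> Z" and Z: "Z \<subseteq> {1..sum_list \<sigma>}"
  have "{1..sum_list \<sigma>} \<subseteq> {1..n}" using n by auto
  then show ?thesis
    using swap_on_image[OF partner_permutes partner_involution _ partner_disjoint[OF Z Z] E] Z by blast
qed

lemma swap_swap: "swap_on partner E (swap_on partner E x) = x"
  by (rule swap_on_involution[OF partner_permutes partner_involution, of "{}"]) auto

lemma swap_permutes: "E \<subseteq> {1..sum_list \<sigma>} \<Longrightarrow> swap_on partner E permutes {1..n}"
  by (rule swap_on_permutes[OF partner_permutes partner_involution, of "{}"]) (use n in auto)

text \<open>The hypotheses say that \<open>h\<close> maps the whole interval and its two parts to transversals of the matching,
  chosen by \<open>E\<close>, \<open>E'\<close> and \<open>E''\<close>.  The first is the union of the other two, so the choices agree.\<close>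

lemma swaps_agree:
  assumes E: "E \<subseteq> {1..sum_list \<sigma>}" "E' \<subseteq> {1..sum_list l}" "E'' \<subseteq> {sum_list l + 1..sum_list \<sigma>}"
    and im: "(swap_on partner E \<circ> h) ` {1..sum_list \<sigma>} = {1..sum_list \<sigma>}"
      "(swap_on partner E' \<circ> h) ` {1..sum_list l} = {1..sum_list l}"
      "(swap_on partner E'' \<circ> h) ` {sum_list l + 1..sum_list \<sigma>} = {sum_list l + 1..sum_list \<sigma>}"
  shows "E = E' \<union> E''"
    and "\<And>i. i \<in> {1..sum_list l} \<Longrightarrow> swap_on partner E (h i) = swap_on partner E' (h i)"
    and "\<And>i. i \<in> {sum_list l + 1..sum_list \<sigma>} \<Longrightarrow> swap_on partner E (h i) = swap_on partner E'' (h i)"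
proof -
  let ?K = "{1..sum_list \<sigma>}" and ?A = "{1..sum_list l}" and ?B = "{sum_list l + 1..sum_list \<sigma>}"
  have K: "?K = ?A \<union> ?B" "?A \<inter> ?B = {}" by (auto simp: k)
  have AB: "?A \<subseteq> ?K" "?B \<subseteq> ?K" by (auto simp: k)
  have h_im: "h ` Z = (Z - D) \<union> partner ` D"
    if "(swap_on partner D \<circ> h) ` Z = Z" "D \<subseteq> Z" "Z \<subseteq> ?K" for D Z
  proof -
    have "h ` Z = swap_on partner D ` (swap_on partner D \<circ> h) ` Z" by (simp add: image_image swap_swap)
    then show ?thesis unfolding that(1) swap_image[OF that(2,3)] .
  qed
  have hK: "h ` ?K = (?K - E) \<union> partner ` E" using h_im[OF im(1) E(1)] by simp
  have hA: "h ` ?A = (?A - E') \<union> partner ` E'" using h_im[OF im(2) E(2) AB(1)] .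
  have hB: "h ` ?B = (?B - E'') \<union> partner ` E''" using h_im[OF im(3) E(3) AB(2)] .
  have un: "(?K - E) \<union> partner ` E = (?A - E') \<union> partner ` E' \<union> ((?B - E'') \<union> partner ` E'')"
    using hK hA hB K(1) by (simp only: image_Un)
  have out: "partner x \<notin> ?K" if "x \<in> ?K" for x using that by (auto simp: partner_def)
  have p_inj: "x = y" if "partner x = partner y" for x y using that partner_involution by metis
  have "x \<in> E \<longleftrightarrow> x \<in> E' \<union> E''" if x: "x \<in> ?K" for x
  proof -
    have "x \<notin> partner ` D" if "D \<subseteq> ?K" for D using out that x by auto
    then have "x \<in> (?K - E) \<longleftrightarrow> x \<in> (?A - E') \<union> (?B - E'')"
      using un E K(1) by (metis Un_iff sup.coboundedI1 sup.coboundedI2)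
    then show ?thesis using x E K by blast
  qed
  then show eq: "E = E' \<union> E''" using E K by blast
  have same: "swap_on partner (D \<union> D') x = swap_on partner D x"
    if D: "D \<subseteq> Z" "D' \<subseteq> Z'" "Z \<subseteq> ?K" "Z' \<subseteq> ?K" "Z \<inter> Z' = {}" and x: "x \<in> (Z - D) \<union> partner ` D" for D D' Z Z' x
  proof (cases "x \<in> partner ` D")
    case True
    then show ?thesis by (auto simp: swap_on_def)
  next
    case False
    then have xZ: "x \<in> Z" "x \<notin> D" using x by auto
    then have "x \<notin> D'" using D by blast
    moreover have "x \<notin> partner ` (D \<union> D')"
    proof
      assume "x \<in> partner ` (D \<union> D')"
      then obtain z where z: "z \<in> D \<union> D'" "x = partner z" by blast
      then have "z \<in> ?K" using D by blast
      then show False using out z(2) xZ(1) D(3) by blast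
    qed
    ultimately show ?thesis using xZ False by (simp add: swap_on_def)
  qed
  show "swap_on partner E (h i) = swap_on partner E' (h i)" if "i \<in> ?A" for i
  proof -
    have "h i \<in> (?A - E') \<union> partner ` E'" using imageI[OF that, of h] unfolding hA .
    then show ?thesis unfolding eq by (rule same[OF E(2,3) AB K(2)])
  qed
  show "swap_on partner E (h i) = swap_on partner E'' (h i)" if "i \<in> ?B" for i
  proof -
    have "h i \<in> (?B - E'') \<union> partner ` E''" using imageI[OF that, of h] unfolding hB .
    moreover have "?B \<inter> ?A = {}" using K(2) by (simp only: Int_commute)
    ultimately show ?thesis unfolding eq Un_commute[of E' E''] by (intro same[OF E(3,2) AB(2,1)])
  qed
qed

lemma lr_pairing_invariant:
  assumes f: "f \<in> lr_space l m \<sigma>" and p: "p permutes {1..sum_list l}" and q: "q permutes {1..sum_list m}"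
  shows "inner_on (tabs \<sigma> \<times> tabs l \<times> tabs m)
      (\<lambda>(T, U, U'). u (tab_act (young_embedding (sum_list l) (p, q)) T) * (v (tab_act p U) * w (tab_act q U'))) f
    = inner_on (tabs \<sigma> \<times> tabs l \<times> tabs m) (pure_tensor u (pure_tensor v w)) f"
proof -
  let ?y = "young_embedding (sum_list l) (p, q)"
  let ?g = "\<lambda>(T, U, U'). (tab_act ?y T, tab_act p U, tab_act q U')"
  let ?X = "tabs \<sigma> \<times> tabs l \<times> tabs m"
  have y: "?y permutes {1..sum_list \<sigma>}" using young_embedding_permutes(1)[OF p q] k by simp
  have b: "bij_betw (tab_act p) (tabs d) (tabs d)" if "p permutes {1..sum_list d}" for p d
    by (rule bij_betw_byWitness[where f' = "tab_act (inv' p)"])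
      (use that tab_act_inv[OF that] tab_act_tabs_on_permutes[OF that] tab_act_tabs_on_permutes[OF permutes_inv[OF that]]
        in \<open>auto simp del: map_map\<close>)
  have bij: "bij_betw ?g ?X ?X"
    using bij_betw_map_prod[OF b[OF y] bij_betw_map_prod[OF b[OF p] b[OF q]]]
    by (simp add: map_prod_def case_prod_unfold)
  have "inner_on ?X (\<lambda>(T, U, U'). u (tab_act ?y T) * (v (tab_act p U) * w (tab_act q U'))) f =
      (\<Sum>x\<in>?X. pure_tensor u (pure_tensor v w) (?g x) * cnj (f (?g x)))"
    unfolding inner_on_def
  proof (rule sum.cong[OF refl])
    fix x assume "x \<in> ?X"
    then obtain T U U' where x: "x = (T, U, U')" "T \<in> tabs \<sigma>" "U \<in> tabs l" "U' \<in> tabs m" by auto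
    have "f (?g x) = f x" using f p q x unfolding lr_space_def by auto
    then show "(case x of (T, U, U') \<Rightarrow> u (tab_act ?y T) * (v (tab_act p U) * w (tab_act q U'))) * cnj (f x) =
        pure_tensor u (pure_tensor v w) (?g x) * cnj (f (?g x))"
      by (simp only: x(1) prod.case pure_tensor_apply)
  qed
  also have "\<dots> = inner_on ?X (pure_tensor u (pure_tensor v w)) f"
    unfolding inner_on_def
    using sum.reindex_bij_betw[OF bij, of "\<lambda>x. pure_tensor u (pure_tensor v w) x * cnj (f x)"] .
  finally show ?thesis .
qed

text \<open>One summand of the averaged product of three alternating lifts, paired with \<open>f\<close>.  If it does not vanish,
  all three swaps agree.  Then the signs cancel, because \<open>|E| = |E'| + |E''|\<close>, and the remaining
  permutations come from \<open>S\<^sub>a \<times> S\<^sub>b\<close>, under which \<open>f\<close> is invariant.\<close>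

lemma swapped_pairing:
  assumes f: "f \<in> lr_space l m \<sigma>" and h: "h permutes {1..n}"
    and E: "E \<subseteq> {1..sum_list \<sigma>}" "E' \<subseteq> {1..sum_list l}" "E'' \<subseteq> {sum_list l + 1..sum_list \<sigma>}"
    and u: "u \<in> rep_space (specht \<sigma>)" and v: "v \<in> rep_space (specht l)" and w: "w \<in> rep_space (specht m)"
  defines "I \<equiv> inner_on (tabs \<sigma> \<times> tabs l \<times> tabs m) (pure_tensor u (pure_tensor v w)) f"
  defines "C \<equiv> inner_on (tabs \<sigma> \<times> tabs l \<times> tabs m) (\<lambda>(T, U, U').
      ((-1) ^ card E * lift_fun s \<sigma> u (tab_act (swap_on partner E \<circ> h) (lift_row s \<sigma> T))) *
      (((-1) ^ card E' * lift_fun r l v (tab_act (swap_on partner E' \<circ> h) (lift_row r l U))) *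
       ((-1) ^ card E'' * lift_fun r' m w (tab_act (inv' \<gamma> \<circ> swap_on partner E'' \<circ> h \<circ> \<gamma>) (lift_row r' m U'))))) f"
  shows "C = 0 \<or> C = I" and "h = id \<Longrightarrow> E = {} \<Longrightarrow> E' = {} \<Longrightarrow> E'' = {} \<Longrightarrow> C = I"
proof -
  let ?K = "{1..sum_list \<sigma>}" and ?A = "{1..sum_list l}" and ?B = "{sum_list l + 1..sum_list \<sigma>}"
    and ?M = "{1..sum_list m}"
  define y where "y = swap_on partner E \<circ> h"
  define y' where "y' = swap_on partner E' \<circ> h"
  define y'' where "y'' = inv' \<gamma> \<circ> swap_on partner E'' \<circ> h \<circ> \<gamma>"
  have sub: "E' \<subseteq> ?K" "E'' \<subseteq> ?K" using E by (auto simp: k)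
  have yn: "y permutes {1..s + sum_list \<sigma>}" "y' permutes {1..r + sum_list l}" "y'' permutes {1..r' + sum_list m}"
    unfolding n y_def y'_def y''_def
    using permutes_compose[OF h swap_permutes[OF E(1)]] permutes_compose[OF h swap_permutes[OF sub(1)]]
      permutes_compose[OF \<gamma>(1) permutes_compose[OF permutes_compose[OF h swap_permutes[OF sub(2)]] permutes_inv[OF \<gamma>(1)]]]
    by (simp_all add: comp_assoc)
  note lift = lift_fun_lift_row[OF u yn(1)] lift_fun_lift_row[OF v yn(2)] lift_fun_lift_row[OF w yn(3)]
  have main: "C = I" if im: "y ` ?K = ?K" "y' ` ?A = ?A" "y'' ` ?M = ?M"
  proof -
    have "\<gamma> ` y'' ` ?M = ?B" unfolding im(3) \<gamma>_image ..
    moreover have "\<gamma> ` y'' ` ?M = (swap_on partner E'' \<circ> h) ` (\<gamma> ` ?M)"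
      by (simp add: y''_def image_image permutes_inverses[OF \<gamma>(1)])
    ultimately have im3: "(swap_on partner E'' \<circ> h) ` ?B = ?B" unfolding \<gamma>_image by simp
    note agree = swaps_agree[OF E im(1,2)[unfolded y_def y'_def] im3]
    have "E' \<inter> E'' \<subseteq> ?A \<inter> ?B" using E by blast
    then have "E' \<inter> E'' = {}" by auto
    then have "card E = card E' + card E''"
      unfolding agree(1) using E by (intro card_Un_disjoint) (auto intro: finite_subset)
    then have sgn: "(-1) ^ card E * ((-1) ^ card E' * (-1) ^ card E'') = (1 :: complex)"
      by (simp flip: power_add mult_2)
    define p where "p = restrict_perm ?A y'"
    define q where "q = restrict_perm ?M y''"
    have p: "p permutes ?A" unfolding p_def using restrict_perm_permutes[OF permutes_inj[OF yn(2)] im(2)] .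
    have q: "q permutes ?M" unfolding q_def using restrict_perm_permutes[OF permutes_inj[OF yn(3)] im(3)] .
    have emb: "restrict_perm ?K y = young_embedding (sum_list l) (p, q)"
    proof
      fix i
      consider "i \<in> ?A" | "i \<in> ?B" | "i \<notin> ?K" "i = 0 \<or> sum_list l < i" using k by fastforce
      then show "restrict_perm ?K y i = young_embedding (sum_list l) (p, q) i"
      proof cases
        case 1
        then show ?thesis
          using agree(2)[OF 1] k by (simp add: restrict_perm_def young_embedding_def p_def y_def y'_def)
      next
        case 2
        define j where "j = i - sum_list l"
        have j: "j \<in> ?M" "i = j + sum_list l" using 2 k by (auto simp: j_def)
        have "y'' j \<in> ?M" using im(3) j(1) by blast
        then have "\<gamma> (y'' j) = y'' j + sum_list l" using \<gamma>(2) by blast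
        moreover have "\<gamma> (y'' j) = swap_on partner E'' (h i)"
          using \<gamma>(2)[OF j(1)] j(2) by (simp add: y''_def permutes_inverses[OF \<gamma>(1)])
        ultimately have "y i = y'' j + sum_list l" using agree(3)[OF 2] by (simp add: y_def)
        then show ?thesis
          using 2 j by (simp add: restrict_perm_def young_embedding_def q_def)
      next
        case 3
        then have "i - sum_list l \<notin> ?M \<or> i = 0" using k by auto
        then show ?thesis using 3
          by (auto simp: restrict_perm_def young_embedding_def p_def q_def)
      qed
    qed
    have "C = inner_on (tabs \<sigma> \<times> tabs l \<times> tabs m)
        (\<lambda>(T, U, U'). u (tab_act (young_embedding (sum_list l) (p, q)) T) * (v (tab_act p U) * w (tab_act q U'))) f"
    proof -
      have sg: "((-1) ^ card E * a) * (((-1) ^ card E' * b) * ((-1) ^ card E'' * c)) = a * (b * c)" for a b c :: complex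
      proof -
        have "((-1) ^ card E * a) * (((-1) ^ card E' * b) * ((-1) ^ card E'' * c)) =
            ((-1) ^ card E * ((-1) ^ card E' * (-1) ^ card E'')) * (a * (b * c))" by (simp only: ac_simps)
        then show ?thesis unfolding sgn by simp
      qed
      show ?thesis
        unfolding C_def y_def[symmetric] y'_def[symmetric] y''_def[symmetric] lift sg
        by (simp only: im if_True simp_thms emb p_def[symmetric] q_def[symmetric])
    qed
    then show ?thesis unfolding I_def lr_pairing_invariant[OF f p q] .
  qed
  have "C = 0" if "\<not> (y ` ?K = ?K \<and> y' ` ?A = ?A \<and> y'' ` ?M = ?M)"
    unfolding C_def y_def[symmetric] y'_def[symmetric] y''_def[symmetric] lift inner_on_def
    by (rule sum.neutral) (use that in \<open>auto simp del: map_map image_comp\<close>)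
  then show "C = 0 \<or> C = I" using main by blast
  show "C = I" if "h = id" "E = {}" "E' = {}" "E'' = {}"
  proof (rule main)
    have "swap_on partner {} = id" by (auto simp: swap_on_def fun_eq_iff)
    then have "y = id" "y' = id" "y'' = id"
      using that permutes_inv_o(2)[OF \<gamma>(1)] by (simp_all add: y_def y'_def y''_def)
    then show "y ` ?K = ?K" "y' ` ?A = ?A" "y'' ` ?M = ?M" by simp_all
  qed
qed

lemma sum_product_triple:
  fixes a b c :: "'i \<Rightarrow> complex"
  shows "(\<Sum>i\<in>P. a i) * ((\<Sum>j\<in>P'. b j) * (\<Sum>k\<in>P''. c k)) = (\<Sum>(i, j, k)\<in>P \<times> P' \<times> P''. a i * (b j * c k))"
proof -
  have "(\<Sum>i\<in>P. a i) * ((\<Sum>j\<in>P'. b j) * (\<Sum>k\<in>P''. c k)) =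
      (\<Sum>i\<in>P. a i * (\<Sum>j\<in>P'. b j * (\<Sum>k\<in>P''. c k)))"
    by (simp only: sum_distrib_right)
  also have "\<dots> = (\<Sum>i\<in>P. \<Sum>j\<in>P'. \<Sum>k\<in>P''. a i * (b j * c k))" by (simp only: sum_distrib_left)
  finally show ?thesis by (simp only: sum.cartesian_product)
qed

text \<open>The pairing of \<open>f\<close> with the restriction of an averaged product of alternating lifts is a positive
  multiple of the pairing in the conclusion: every summand that contributes does so with the same value,
  and the summand for the identity permutation and no swaps contributes.\<close>

lemma pairing_eq_zero:
  assumes f: "f \<in> lr_space l m \<sigma>"
    and orth: "\<And>F. F \<in> kronecker_space (r # l) (r' # m) (s # \<sigma>) \<Longrightarrow>
      inner_on (tabs \<sigma> \<times> tabs l \<times> tabs m) (F \<circ> standard_position) f = 0"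
    and u: "u \<in> rep_space (specht \<sigma>)" and v: "v \<in> rep_space (specht l)" and w: "w \<in> rep_space (specht m)"
  shows "inner_on (tabs \<sigma> \<times> tabs l \<times> tabs m) (pure_tensor u (pure_tensor v w)) f = 0" (is "?I = 0")
proof -
  let ?X = "tabs \<sigma> \<times> tabs l \<times> tabs m" and ?G = "sym_group n"
  let ?K = "{1..sum_list \<sigma>}" and ?A = "{1..sum_list l}" and ?B = "{sum_list l + 1..sum_list \<sigma>}"
  let ?R = "tensor_rep (specht (s # \<sigma>)) (tensor_rep (specht (r # l)) (specht (r' # m)))"
  have AB: "?A \<subseteq> ?K" "?B \<subseteq> ?K" by (auto simp: k)
  define u' where "u' = alternating_lift s \<sigma> id partner u"
  define v' where "v' = alternating_lift r l id partner v"
  define w' where "w' = alternating_lift r' m \<gamma> partner w"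
  have u': "u' \<in> rep_space (specht (s # \<sigma>))"
    unfolding u'_def using partner_permutes partner_disjoint[of ?K ?K]
    by (intro alternating_lift_in_specht[OF Y(1) u]) (simp_all add: n partner_involution permutes_id)
  have v': "v' \<in> rep_space (specht (r # l))"
    unfolding v'_def using partner_permutes partner_disjoint[OF AB(1) AB(1)]
    by (intro alternating_lift_in_specht[OF Y(2) v]) (simp_all add: n partner_involution permutes_id)
  have w': "w' \<in> rep_space (specht (r' # m))"
    unfolding w'_def using partner_permutes partner_disjoint[OF AB(2) AB(2)] \<gamma>_image
    by (intro alternating_lift_in_specht[OF Y(3) w]) (use \<gamma>(1) in \<open>simp_all add: n partner_involution\<close>)
  define g where "g = pure_tensor u' (pure_tensor v' w')"
  have R: "is_rep ?G ?R"
    using perm_repD(1)[OF perm_rep_tensor[OF sym_group_is_group perm_rep_specht[of "s # \<sigma>"]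
        perm_rep_specht_tensor[OF sizes(4,5)]]] by (simp only: sizes(1))
  define F where "F = group_sum ?G ?R g"
  have "g \<in> rep_space ?R"
    unfolding g_def tensor_rep_simps by (intro pure_tensor_in u' v' w')
  from group_sum_fixed[OF sym_group_is_group R this]
  have F: "F \<in> kronecker_space (r # l) (r' # m) (s # \<sigma>)"
    unfolding F_def kronecker_space_def sizes(1) .
  define \<Phi> where "\<Phi> = (\<lambda>(h, E, E', E'') (T, U, U').
      ((-1) ^ card E * lift_fun s \<sigma> u (tab_act (swap_on partner E \<circ> inv' h) (lift_row s \<sigma> T))) *
      (((-1) ^ card E' * lift_fun r l v (tab_act (swap_on partner E' \<circ> inv' h) (lift_row r l U))) *
       ((-1) ^ card E'' * lift_fun r' m w (tab_act (inv' \<gamma> \<circ> swap_on partner E'' \<circ> inv' h \<circ> \<gamma>) (lift_row r' m U')))))"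
  define Q where "Q = carrier ?G \<times> Pow ?K \<times> Pow ?A \<times> Pow ?B"
  have finQ: "finite Q" unfolding Q_def by (simp add: finite_sym_group)
  have inv_id: "inv' id = (id :: nat \<Rightarrow> nat)" by (rule inv_id)
  have expand: "F \<circ> standard_position = (\<Sum>y\<in>Q. \<Phi> y)"
  proof
    fix x :: "nat set list \<times> nat set list \<times> nat set list"
    obtain T U U' where x: "x = (T, U, U')" by (cases x) auto
    have "(F \<circ> standard_position) x = (\<Sum>h\<in>carrier ?G. g (tab_pull h (lift_row s \<sigma> T),
        (tab_pull h (lift_row r l U), tab_pull h (tab_act \<gamma> (lift_row r' m U')))))"
      by (simp add: F_def group_sum_def sum_fun_apply standard_position_def x tensor_map_def del: map_map)
    also have "\<dots> = (\<Sum>h\<in>carrier ?G. \<Sum>(E, E', E'')\<in>Pow ?K \<times> Pow ?A \<times> Pow ?B. \<Phi> (h, E, E', E'') x)"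
    proof (rule sum.cong[OF refl])
      fix h assume "h \<in> carrier ?G"
      then have h: "h permutes {1..n}" by (simp add: sym_group_def)
      show "g (tab_pull h (lift_row s \<sigma> T), (tab_pull h (lift_row r l U), tab_pull h (tab_act \<gamma> (lift_row r' m U')))) =
        (\<Sum>(E, E', E'')\<in>Pow ?K \<times> Pow ?A \<times> Pow ?B. \<Phi> (h, E, E', E'') x)"
        unfolding map_vimage_eq[OF h] g_def pure_tensor_apply u'_def v'_def w'_def alternating_lift_def
          inv_id id_comp image_id \<gamma>_image tab_act_comp sum_product_triple \<Phi>_def prod.case x comp_assoc
        by (simp only: id_apply)
    qed
    also have "\<dots> = (\<Sum>y\<in>Q. \<Phi> y x)"
      unfolding Q_def by (simp add: sum.cartesian_product case_prod_unfold)
    finally show "(F \<circ> standard_position) x = (\<Sum>y\<in>Q. \<Phi> y) x" by (simp add: sum_fun_apply)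
  qed
  define c where "c y = inner_on ?X (\<Phi> y) f" for y
  have sum0: "(\<Sum>y\<in>Q. c y) = 0"
    using orth[OF F] unfolding expand inner_on_sum_left c_def .
  have vals: "c y = 0 \<or> c y = ?I" if "y \<in> Q" for y
  proof -
    obtain h E E' E'' where y: "y = (h, E, E', E'')" by (cases y) auto
    have "inv' h permutes {1..n}" "E \<subseteq> ?K" "E' \<subseteq> ?A" "E'' \<subseteq> ?B"
      using that permutes_inv by (auto simp: Q_def y sym_group_def)
    from swapped_pairing(1)[OF f this u v w] show ?thesis
      by (simp only: c_def \<Phi>_def y prod.case)
  qed
  have y0: "(id, {}, {}, {}) \<in> Q" "c (id, {}, {}, {}) = ?I"
  proof -
    show "(id, {}, {}, {}) \<in> Q" by (simp add: Q_def sym_group_def permutes_id)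
    have "id permutes {1..n}" "{} \<subseteq> ?K" "{} \<subseteq> ?A" "{} \<subseteq> ?B" by (simp_all add: permutes_id)
    from swapped_pairing(2)[OF f this u v w refl refl refl refl] show "c (id, {}, {}, {}) = ?I"
      by (simp only: c_def \<Phi>_def prod.case inv_id)
  qed
  show "?I = 0"
  proof (rule ccontr)
    assume I: "?I \<noteq> 0"
    have "(\<Sum>y\<in>Q. c y) = (\<Sum>y\<in>{y \<in> Q. c y = ?I}. c y)"
      using finQ vals by (intro sum.mono_neutral_right) auto
    also have "\<dots> = of_nat (card {y \<in> Q. c y = ?I}) * ?I" by simp
    finally have "card {y \<in> Q. c y = ?I} = 0" using sum0 I by simp
    then show False using y0 finQ by auto
  qed
qed

lemma subspace_lr_space: "cfun.subspace (lr_space l m \<sigma>)"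
proof (rule cfun.subspaceI)
  show "0 \<in> lr_space l m \<sigma>"
    by (simp add: lr_space_def zero_fun_apply cfun.subspace_0[OF subspace_tensor])
  show "x + y \<in> lr_space l m \<sigma>" if "x \<in> lr_space l m \<sigma>" "y \<in> lr_space l m \<sigma>" for x y
    using that by (simp add: lr_space_def plus_fun_apply cfun.subspace_add[OF subspace_tensor])
  show "cscale c x \<in> lr_space l m \<sigma>" if "x \<in> lr_space l m \<sigma>" for c x
    using that by (simp add: lr_space_def cscale_apply cfun.subspace_scale[OF subspace_tensor])
qed

lemma subspace_kronecker_space: "cfun.subspace (kronecker_space (r # l) (r' # m) (s # \<sigma>))"
  unfolding kronecker_space_def
  by (rule subspace_fixed_space[OF perm_repD(1)[OF perm_rep_tensor[OF sym_group_is_group perm_rep_specht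
        perm_rep_specht_tensor[OF sizes(4,5)]]]])

lemma restriction_surj: "(\<lambda>F. F \<circ> standard_position) ` kronecker_space (r # l) (r' # m) (s # \<sigma>) = lr_space l m \<sigma>"
proof (rule ccontr)
  let ?X = "tabs \<sigma> \<times> tabs l \<times> tabs m"
  let ?W = "(\<lambda>F. F \<circ> standard_position) ` kronecker_space (r # l) (r' # m) (s # \<sigma>)"
  assume "?W \<noteq> lr_space l m \<sigma>"
  then have proper: "?W \<subset> lr_space l m \<sigma>" using restriction_in_lr_space by blast
  interpret c: module_hom cscale cscale "\<lambda>F. F \<circ> standard_position"
    using linear_comp by (simp add: module_hom_iff_linear)
  have W: "cfun.subspace ?W" by (rule c.subspace_image[OF subspace_kronecker_space])
  have finX: "finite ?X" by (simp add: finite_tabs_on)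
  have X: "lr_space l m \<sigma> \<subseteq> funs_on ?X"
    using tensor_space_funs_on[OF subspace_specht subspace_tensor specht_funs_on
        tensor_space_funs_on[OF subspace_specht subspace_specht specht_funs_on specht_funs_on]]
    unfolding lr_space_def by blast
  obtain f where f: "f \<in> lr_space l m \<sigma>" "f \<noteq> 0" and orth: "\<And>z. z \<in> ?W \<Longrightarrow> inner_on ?X f z = 0"
    using orthogonal_vector[OF finX subspace_lr_space X W proper] by blast
  have "inner_on ?X (F \<circ> standard_position) f = 0" if "F \<in> kronecker_space (r # l) (r' # m) (s # \<sigma>)" for F
  proof -
    have "F \<circ> standard_position \<in> ?W" using that by blast
    from orth[OF this] show ?thesis
      using inner_on_commute[of ?X "F \<circ> standard_position" f] by (simp only: complex_cnj_zero)
  qed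
  note pair = pairing_eq_zero[OF f(1) this]
  have tens: "inner_on ?X (pure_tensor u z) f = 0"
    if u: "u \<in> rep_space (specht \<sigma>)" and z: "z \<in> tensor_space (rep_space (specht l)) (rep_space (specht m))" for u z
    using z unfolding tensor_space_def
  proof (induction rule: cfun.span_induct_alt)
    case base
    have "pure_tensor u 0 = (0 :: nat set list \<times> nat set list \<times> nat set list \<Rightarrow> complex)"
      by (auto simp: fun_eq_iff pure_tensor_def zero_fun_apply)
    then show ?case by simp
  next
    case (step c p z)
    have "pure_tensor u (cscale c p + z) = cscale c (pure_tensor u p) + pure_tensor u z"
      by (auto simp: fun_eq_iff pure_tensor_def fun_app algebra_simps)
    then show ?case using step pair[OF _ u] by (auto simp: inner_on_add_left inner_on_scale_left)
  qed
  have "inner_on ?X f z = 0" if "z \<in> tensor_space (rep_space (specht \<sigma>)) (tensor_space (rep_space (specht l)) (rep_space (specht m)))" for z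
    using that[unfolded tensor_space_def[of "rep_space (specht \<sigma>)"]]
    by (rule inner_on_span_right[rotated]) (use tens inner_on_commute[of ?X _ f] in \<open>auto simp: complex_cnj_zero_iff\<close>)
  then have "inner_on ?X f f = 0" using f(1) by (simp add: lr_space_def)
  then have "f = 0" using inner_on_self_eq_0[OF finX] X f(1) by blast
  then show False using f(2) by blast
qed

lemma kronecker_dim_eq_lr_dim:
  "cfun.dim (kronecker_space (r # l) (r' # m) (s # \<sigma>)) = cfun.dim (lr_space l m \<sigma>)"
proof -
  have "inj_on (\<lambda>F. F \<circ> standard_position) (kronecker_space (r # l) (r' # m) (s # \<sigma>))"
  proof (rule inj_onI)
    fix F F' assume F: "F \<in> kronecker_space (r # l) (r' # m) (s # \<sigma>)" "F' \<in> kronecker_space (r # l) (r' # m) (s # \<sigma>)"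
      and eq: "F \<circ> standard_position = F' \<circ> standard_position"
    have "(F - F') \<circ> standard_position = (F \<circ> standard_position) - (F' \<circ> standard_position)"
      by (simp add: fun_eq_iff fun_app)
    then have "F - F' = 0"
      using restriction_inj[OF cfun.subspace_diff[OF subspace_kronecker_space F]] eq by simp
    then show "F = F'" by simp
  qed
  from dim_comp[OF subspace_kronecker_space this] show ?thesis unfolding restriction_surj by simp
qed

end

section \<open>The first rows of the constituents\<close>

theorem proposition1p4:
  fixes L M l m :: "nat list" and n :: nat
  assumes "young_diagram L" and "young_diagram M"
    and "sum_list L = n" and "sum_list M = n"
    and "l = tl L" and "m = tl M"
    and "real (sum_list l) \<le> (real n + 1) / 2"
    and "real (sum_list m) \<le> (real n + 1) / 2"
    and "real (sum_list l) + real (sum_list m) \<le> real n / 2"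
  shows "(\<forall>S. young_diagram S \<and> sum_list S = n \<and>
            int (first_row S) < int n - int (sum_list l) - int (sum_list m) \<longrightarrow>
            kronecker_coeff L M S = 0) \<and>
         (\<forall>S. young_diagram S \<and> sum_list S = n \<and>
            int (first_row S) = int n - int (sum_list l) - int (sum_list m) \<longrightarrow>
            kronecker_coeff L M S = lr_coeff l m (tl S))"
proof (cases "n = 0")
  case True
  have nil: "d = []" if "young_diagram d" "sum_list d = 0" for d
    using that by (cases d) (auto simp: young_diagram_def)
  have "L = []" "M = []" using nil assms(1-4) True by simp_all
  then have Nil: "L = []" "M = []" "l = []" "m = []" using assms(5,6) by simp_all
  \<comment> \<open>There is no first row to delete: both spaces live on the single triple of empty tabloids.\<close>
  have "kronecker_coeff [] [] [] = lr_coeff [] [] []"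
  proof -
    have Y: "young_diagram []" by (simp add: young_diagram_def)
    have "kronecker_space [] [] [] = lr_space [] [] []"
      unfolding set_eq_iff kronecker_space_iff[OF refl refl] lr_space_def by simp
    then show ?thesis using kronecker_coeff_eq_dim[OF Y, of "[]" "[]"] lr_coeff_eq_dim[OF Y, of "[]" "[]"] by simp
  qed
  moreover have "S = []" if "young_diagram S" "sum_list S = n" for S
    using nil that True by blast
  moreover have "\<not> int (first_row S) < int n - int (sum_list l) - int (sum_list m)" for S
    using True by simp
  ultimately show ?thesis unfolding Nil by (metis list.sel(2))
next
  case False
  obtain r where L: "L = r # l" using assms(3,5) False by (cases L) auto
  obtain r' where M: "M = r' # m" using assms(4,6) False by (cases M) auto
  have "real (2 * (sum_list l + sum_list m)) \<le> real n" using assms(9) by simp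
  then have half: "2 * (sum_list l + sum_list m) \<le> n" by (simp only: of_nat_le_iff)
  have cons: "S = first_row S # tl S \<and> first_row S + sum_list (tl S) = n" if "sum_list S = n" for S
    using that False by (cases S) (auto simp: first_row_def)
  show ?thesis
  proof (intro conjI allI impI; elim conjE)
    fix S assume S: "young_diagram S" "sum_list S = n"
      and short: "int (first_row S) < int n - int (sum_list l) - int (sum_list m)"
    obtain s \<sigma> where S': "S = s # \<sigma>" "s + sum_list \<sigma> = n" "first_row S = s"
      using cons[OF S(2)] by metis
    have big: "sum_list l + sum_list m < sum_list \<sigma>" using short S' by linarith
    have sz: "sum_list (r # l) = sum_list (s # \<sigma>)" "sum_list (r' # m) = sum_list (s # \<sigma>)"
      using assms(3,4) S L M S' by simp_all
    have "F = 0" if "F \<in> kronecker_space (r # l) (r' # m) (s # \<sigma>)" for F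
      by (rule kronecker_space_eq_zero[OF S(1)[unfolded S'(1)] sz _ that]) (use big in simp_all)
    then have "kronecker_space L M S \<subseteq> cfun.span {}" unfolding L M S'(1) by auto
    then have "cfun.dim (kronecker_space L M S) = 0" using cfun.dim_le_card[of _ "{}"] by simp
    then show "kronecker_coeff L M S = 0"
      using kronecker_coeff_eq_dim[OF S(1), of L M] assms(3,4) S(2) by simp
  next
    fix S assume S: "young_diagram S" "sum_list S = n"
      and eq: "int (first_row S) = int n - int (sum_list l) - int (sum_list m)"
    obtain s \<sigma> where S': "S = s # \<sigma>" "s + sum_list \<sigma> = n" "first_row S = s"
      using cons[OF S(2)] by metis
    have k: "sum_list \<sigma> = sum_list l + sum_list m" using eq S' by linarith
    have rows: "r + sum_list l = n" "r' + sum_list m = n" using assms(3,4) L M by simp_all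
    obtain \<gamma> where \<gamma>: "\<gamma> permutes {1..n}" "\<And>i. i \<in> {1..sum_list m} \<Longrightarrow> \<gamma> i = i + sum_list l"
      by (rule extend_to_permutation[of "{1..n}" "{1..sum_list m}" "\<lambda>i. i + sum_list l"])
        (use half in auto)
    have Y: "young_diagram (s # \<sigma>)" "young_diagram (r # l)" "young_diagram (r' # m)"
      using S(1) assms(1,2) by (simp_all only: S'(1) L M)
    have "2 * sum_list \<sigma> \<le> n" using half k by simp
    from kronecker_dim_eq_lr_dim[OF Y S'(2) rows k this \<gamma>]
    have "kronecker_coeff L M S = cfun.dim (lr_space l m \<sigma>)"
      using kronecker_coeff_eq_dim[OF S(1), of L M] assms(3,4) S(2) by (simp add: L M S'(1))
    also have "\<dots> = lr_coeff l m (tl S)"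
      using lr_coeff_eq_dim[OF young_diagram_tl[OF Y(1)] k] by (simp add: S'(1))
    finally show "kronecker_coeff L M S = lr_coeff l m (tl S)" .
  qed
qed

end
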